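(* (Intermediate value theorem.) In the topos $\mathcal{T}_\mu$: if $f:I\to\mathbb{R}_d$ satisfies $f(0)<0<f(1)$, then there exists $x\in I$ with $f(x)=0$. Here $I=[0,1]\subseteq\mathbb{R}_d$.
   Context: Oracle computability. For $\alpha\in2^{\mathbb{N}}$ let $\varphi^\alpha_m$ enumerate the partial $\alpha$-computable functions $\mathbb{N}\rightharpoonup\mathbb{N}$, with indices independent of $\alpha$. Fix computable bijections $\langle\cdot,\cdot\rangle:\mathbb{N}^2\to\mathbb{N}$ and $n\mapsto q_n:\mathbb{N}\to\mathbb{Q}$. A function $g$ represents $x$ if $|x-q_{g(n)}|<2^{-n}$ for all $n$. Let $r(\alpha)=\sum_i\alpha(i)2^{-i-1}$ and $s(\alpha)(n)=r(m\mapsto\alpha(\langle n,m\rangle))$. For $a:\mathbb{N}\to[0,1]$, $n$ is an $a$-index if a single real is represented by a total $\varphi^\alpha_n$ for all $\alpha\in s^{-1}(a)$. Fix a Miller sequence $\mu$ (every $\mu$-index $n$ represents $\mu(n)$) and put $M_\mu=s^{-1}(\mu)$. A ppca $(A,P)$ is a set $A$, a nonempty set $P$, and partial applications $a\cdot_pb$ such that some $k,s\in A$ satisfy, for all $p,q,a,b,c$: - $k\cdot_pa=k\cdot_qa$; - $(k\cdot_pa)\cdot_pb=a$; - $s\cdot_pa=s\cdot_qa$; - $(s\cdot_pa)\cdot_pb=(s\cdot_qa)\cdot_qb$ (all these defined); - $((s\cdot_pa)\cdot_pb)\cdot_pc\simeq(a\cdot_pc)\cdot_p(b\cdot_pc)$.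 Its tripos sends $X$ to $\mathcal{P}(A)^X$, with $\phi\le\psi$ iff some $a$ satisfies $a\cdot_pb\in\psi(x)$ for all $x$, $b\in\phi(x)$ and $p$. The logical operations are: - $\top=A$ and $\bot=\emptyset$; - pairs realize conjunctions, boolean-tagged pairs realize disjunctions, uniformly in $p$; - $(\phi\to\psi)(x)=\{a\mid\forall p\,\forall b\in\phi(x):a\cdot_pb\in\psi(x)\}$; - $(\exists_r\phi)(x)=\bigcup_{r(y)=x}\phi(y)$; - $(\forall_r\phi)(x)=\{a\mid\forall y(r(y)=x\Rightarrow\forall b\,\forall q:a\cdot_qb\in\phi(y))\}$. $\mathcal{T}_\mu$ is the topos obtained by the tripos-to-topos construction from the tripos of the ppca with carrier $\mathbb{N}$, parameters $M_\mu$ and $m\cdot_\alpha n=\varphi^\alpha_m(n)$. $\mathbb{R}_d$ is its object of Dedekind reals. *)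

theory Defs
  imports Complex_Main "HOL-Library.Nat_Bijection"
begin

section \<open>Oracle computability\<close>

text \<open>Unary partial recursive functions relative to an oracle, with tuples coded by the
  Cantor pairing function \<^const>\<open>prod_encode\<close>.  The argument of \<open>PRec f g\<close> codes
  \<open>(a, m)\<close>, with \<open>m\<close> the recursion variable; \<open>PMu f\<close> is unbounded minimization, which is
  defined only if \<open>f\<close> is defined at all values below the least zero.\<close>

datatype prog =
    PZero | PSucc | PFst | PSnd | POracle
  | PPair prog prog | PComp prog prog | PRec prog prog | PMu prog

primrec run :: "(nat \<Rightarrow> bool) \<Rightarrow> prog \<Rightarrow> nat \<Rightarrow> nat option" where
  "run \<alpha> PZero = (\<lambda>n. Some 0)"
| "run \<alpha> PSucc = (\<lambda>n. Some (Suc n))"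
| "run \<alpha> PFst = (\<lambda>n. Some (fst (prod_decode n)))"
| "run \<alpha> PSnd = (\<lambda>n. Some (snd (prod_decode n)))"
| "run \<alpha> POracle = (\<lambda>n. Some (of_bool (\<alpha> n)))"
| "run \<alpha> (PPair f g) = (\<lambda>n. Option.bind (run \<alpha> f n) (\<lambda>x.
     Option.bind (run \<alpha> g n) (\<lambda>y. Some (prod_encode (x, y)))))"
| "run \<alpha> (PComp f g) = (\<lambda>n. Option.bind (run \<alpha> g n) (run \<alpha> f))"
| "run \<alpha> (PRec f g) = (\<lambda>n. case prod_decode n of (a, m) \<Rightarrow>
     rec_nat (run \<alpha> f a)
       (\<lambda>i r. Option.bind r (\<lambda>y. run \<alpha> g (prod_encode (a, prod_encode (i, y))))) m)"
| "run \<alpha> (PMu f) = (\<lambda>n.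
     if \<exists>k. run \<alpha> f (prod_encode (n, k)) = Some 0 \<and>
            (\<forall>j<k. run \<alpha> f (prod_encode (n, j)) \<noteq> None)
     then Some (LEAST k. run \<alpha> f (prod_encode (n, k)) = Some 0)
     else None)"

text \<open>A bijective Goedel numbering of programs.\<close>

function prog_of :: "nat \<Rightarrow> prog" where
  "prog_of 0 = PZero"
| "prog_of (Suc 0) = PSucc"
| "prog_of (Suc (Suc 0)) = PFst"
| "prog_of (Suc (Suc (Suc 0))) = PSnd"
| "prog_of (Suc (Suc (Suc (Suc 0)))) = POracle"
| "prog_of (Suc (Suc (Suc (Suc (Suc n))))) =
    (if n mod 4 = 0 then PPair (prog_of (fst (prod_decode (n div 4)))) (prog_of (snd (prod_decode (n div 4))))
     else if n mod 4 = 1 then PComp (prog_of (fst (prod_decode (n div 4)))) (prog_of (snd (prod_decode (n div 4))))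
     else if n mod 4 = 2 then PRec (prog_of (fst (prod_decode (n div 4)))) (prog_of (snd (prod_decode (n div 4))))
     else PMu (prog_of (n div 4)))"
  by pat_completeness auto
termination
proof -
  have le: "fst (prod_decode m) \<le> m" "snd (prod_decode m) \<le> m" for m
    using le_prod_encode_1[of "fst (prod_decode m)" "snd (prod_decode m)"]
      le_prod_encode_2[of "snd (prod_decode m)" "fst (prod_decode m)"] by simp_all
  have less: "fst (prod_decode (n div 4)) < Suc (Suc (Suc (Suc (Suc n))))"
    "snd (prod_decode (n div 4)) < Suc (Suc (Suc (Suc (Suc n))))" for n
    using le[of "n div 4"] div_le_dividend[of n 4] by linarith+
  show ?thesis
    by (relation "measure id") (use less in \<open>auto simp: less_Suc_eq_le intro: le_trans[OF div_le_dividend]\<close>)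
qed

definition phi :: "(nat \<Rightarrow> bool) \<Rightarrow> nat \<Rightarrow> nat \<Rightarrow> nat option" where
  "phi \<alpha> m n = run \<alpha> (prog_of m) n"

definition computable :: "(nat \<Rightarrow> nat) \<Rightarrow> bool" where
  "computable f \<longleftrightarrow> (\<exists>m. \<forall>\<alpha> n. phi \<alpha> m n = Some (f n))"

definition computable_rat_bijection :: "(nat \<Rightarrow> rat) \<Rightarrow> bool" where
  "computable_rat_bijection q \<longleftrightarrow> bij q
     \<and> computable (\<lambda>n. int_encode (fst (quotient_of (q n))))
     \<and> computable (\<lambda>n. nat (snd (quotient_of (q n))))"


section \<open>Miller sequences\<close>

definition represents :: "(nat \<Rightarrow> rat) \<Rightarrow> (nat \<Rightarrow> nat) \<Rightarrow> real \<Rightarrow> bool" where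
  "represents q g x \<longleftrightarrow> (\<forall>n. \<bar>x - of_rat (q (g n))\<bar> < 1 / 2 ^ n)"

definition bin_real :: "(nat \<Rightarrow> bool) \<Rightarrow> real" where
  "bin_real \<alpha> = (\<Sum>i. of_bool (\<alpha> i) * (1 / 2) ^ (i + 1))"

definition bin_seq :: "(nat \<Rightarrow> bool) \<Rightarrow> nat \<Rightarrow> real" where
  "bin_seq \<alpha> n = bin_real (\<lambda>m. \<alpha> (prod_encode (n, m)))"

definition index_represents :: "(nat \<Rightarrow> rat) \<Rightarrow> (nat \<Rightarrow> real) \<Rightarrow> nat \<Rightarrow> real \<Rightarrow> bool" where
  "index_represents q a n x \<longleftrightarrow>
     (\<forall>\<alpha>. bin_seq \<alpha> = a \<longrightarrow> (\<exists>g. (\<forall>k. phi \<alpha> n k = Some (g k)) \<and> represents q g x))"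

text \<open>The represented real has to lie in \<open>[0,1]\<close>: without this restriction no sequence in
  \<open>[0,1]\<close> could represent every index, as an index of a constant function may represent \<open>5\<close>.\<close>

definition real_index :: "(nat \<Rightarrow> rat) \<Rightarrow> (nat \<Rightarrow> real) \<Rightarrow> nat \<Rightarrow> bool" where
  "real_index q a n \<longleftrightarrow> (\<exists>x\<in>{0..1}. index_represents q a n x)"

definition miller_sequence :: "(nat \<Rightarrow> rat) \<Rightarrow> (nat \<Rightarrow> real) \<Rightarrow> bool" where
  "miller_sequence q \<mu> \<longleftrightarrow> range \<mu> \<subseteq> {0..1}
     \<and> (\<forall>n. real_index q \<mu> n \<longrightarrow> index_represents q \<mu> n (\<mu> n))"


section \<open>Parameterized partial combinatory algebras\<close>

text \<open>The carrier is the type \<open>'a\<close>; the set of parameters is a subset of the type \<open>'p\<close>.\<close>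

record ('a, 'p) ppca =
  params :: "'p set"
  app :: "'p \<Rightarrow> 'a \<Rightarrow> 'a \<Rightarrow> 'a option"

text \<open>Application of possibly undefined expressions; equality of values of type
  \<^typ>\<open>'a option\<close> is Kleene equality.\<close>

definition eapp :: "('a, 'p) ppca \<Rightarrow> 'p \<Rightarrow> 'a option \<Rightarrow> 'a option \<Rightarrow> 'a option" where
  "eapp T p u v = Option.bind u (\<lambda>a. Option.bind v (\<lambda>b. app T p a b))"

definition ppca_combinators :: "('a, 'p) ppca \<Rightarrow> 'a \<Rightarrow> 'a \<Rightarrow> bool" where
  "ppca_combinators T k s \<longleftrightarrow>
     (\<forall>p\<in>params T. \<forall>q\<in>params T. \<forall>a b c.
        app T p k a \<noteq> None \<and> app T p k a = app T q k a
      \<and> eapp T p (app T p k a) (Some b) = Some a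
      \<and> app T p s a \<noteq> None \<and> app T p s a = app T q s a
      \<and> eapp T p (app T p s a) (Some b) \<noteq> None
      \<and> eapp T p (app T p s a) (Some b) = eapp T q (app T q s a) (Some b)
      \<and> eapp T p (eapp T p (app T p s a) (Some b)) (Some c)
          = eapp T p (app T p a c) (app T p b c))"

definition is_ppca :: "('a, 'p) ppca \<Rightarrow> bool" where
  "is_ppca T \<longleftrightarrow> params T \<noteq> {} \<and> (\<exists>k s. ppca_combinators T k s)"

text \<open>Pairs and booleans are built from an arbitrary choice of \<open>k\<close> and \<open>s\<close>.\<close>

definition comb_k :: "('a, 'p) ppca \<Rightarrow> 'a" where
  "comb_k T = (SOME k. \<exists>s. ppca_combinators T k s)"

definition comb_s :: "('a, 'p) ppca \<Rightarrow> 'a" where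
  "comb_s T = (SOME s. ppca_combinators T (comb_k T) s)"

definition ek :: "('a, 'p) ppca \<Rightarrow> 'p \<Rightarrow> 'a option \<Rightarrow> 'a option" where
  "ek T p u = eapp T p (Some (comb_k T)) u"

definition es :: "('a, 'p) ppca \<Rightarrow> 'p \<Rightarrow> 'a option \<Rightarrow> 'a option \<Rightarrow> 'a option" where
  "es T p u v = eapp T p (eapp T p (Some (comb_s T)) u) v"

definition ei :: "('a, 'p) ppca \<Rightarrow> 'p \<Rightarrow> 'a option" where
  "ei T p = es T p (Some (comb_k T)) (Some (comb_k T))"

text \<open>\<open>s (s i (k a)) (k b)\<close>, which maps \<open>z\<close> to \<open>z a b\<close>; its projections are application to
  \<open>k\<close> and to \<open>k i\<close>, which also serve as the booleans.\<close>

definition is_pair :: "('a, 'p) ppca \<Rightarrow> 'a \<Rightarrow> 'a \<Rightarrow> 'a \<Rightarrow> bool" where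
  "is_pair T a b c \<longleftrightarrow>
     (\<forall>p\<in>params T. es T p (es T p (ei T p) (ek T p (Some a))) (ek T p (Some b)) = Some c)"

definition is_true :: "('a, 'p) ppca \<Rightarrow> 'a \<Rightarrow> bool" where
  "is_true T c \<longleftrightarrow> c = comb_k T"

definition is_false :: "('a, 'p) ppca \<Rightarrow> 'a \<Rightarrow> bool" where
  "is_false T c \<longleftrightarrow> (\<forall>p\<in>params T. ek T p (ei T p) = Some c)"


section \<open>The tripos of a ppca\<close>

text \<open>Predicates on \<open>'x\<close> have type \<open>'x \<Rightarrow> 'a set\<close>.  The propositional operations are
  pointwise, so they are given on truth values, i.e. subsets of the carrier.\<close>

definition entails :: "('a, 'p) ppca \<Rightarrow> ('x \<Rightarrow> 'a set) \<Rightarrow> ('x \<Rightarrow> 'a set) \<Rightarrow> bool" where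
  "entails T \<phi> \<psi> \<longleftrightarrow> (\<exists>a. \<forall>x. \<forall>b\<in>\<phi> x. \<forall>p\<in>params T. \<exists>c\<in>\<psi> x. app T p a b = Some c)"

definition tconj :: "('a, 'p) ppca \<Rightarrow> 'a set \<Rightarrow> 'a set \<Rightarrow> 'a set" (infixr "\<^bold>\<and>\<index>" 64) where
  "\<phi> \<^bold>\<and>\<^bsub>T\<^esub> \<psi> = {c. \<exists>a\<in>\<phi>. \<exists>b\<in>\<psi>. is_pair T a b c}"

definition tdisj :: "('a, 'p) ppca \<Rightarrow> 'a set \<Rightarrow> 'a set \<Rightarrow> 'a set" (infixr "\<^bold>\<or>\<index>" 63) where
  "\<phi> \<^bold>\<or>\<^bsub>T\<^esub> \<psi> = {c. (\<exists>t. \<exists>a\<in>\<phi>. is_true T t \<and> is_pair T t a c)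
                  \<or> (\<exists>t. \<exists>b\<in>\<psi>. is_false T t \<and> is_pair T t b c)}"

definition timp :: "('a, 'p) ppca \<Rightarrow> 'a set \<Rightarrow> 'a set \<Rightarrow> 'a set" (infixr "\<^bold>\<longrightarrow>\<index>" 62) where
  "\<phi> \<^bold>\<longrightarrow>\<^bsub>T\<^esub> \<psi> = {a. \<forall>p\<in>params T. \<forall>b\<in>\<phi>. \<exists>c\<in>\<psi>. app T p a b = Some c}"

definition tiff :: "('a, 'p) ppca \<Rightarrow> 'a set \<Rightarrow> 'a set \<Rightarrow> 'a set" (infixr "\<^bold>\<longleftrightarrow>\<index>" 62) where
  "\<phi> \<^bold>\<longleftrightarrow>\<^bsub>T\<^esub> \<psi> = ((\<phi> \<^bold>\<longrightarrow>\<^bsub>T\<^esub> \<psi>) \<^bold>\<and>\<^bsub>T\<^esub> (\<psi> \<^bold>\<longrightarrow>\<^bsub>T\<^esub> \<phi>))"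

definition tnot :: "('a, 'p) ppca \<Rightarrow> 'a set \<Rightarrow> 'a set" ("\<^bold>\<not>\<index> _" [65] 65) where
  "\<^bold>\<not>\<^bsub>T\<^esub> \<phi> = (\<phi> \<^bold>\<longrightarrow>\<^bsub>T\<^esub> {})"

definition ex_along :: "('y \<Rightarrow> 'x) \<Rightarrow> ('y \<Rightarrow> 'a set) \<Rightarrow> 'x \<Rightarrow> 'a set" where
  "ex_along r \<phi> x = (\<Union>y\<in>{y. r y = x}. \<phi> y)"

definition all_along :: "('a, 'p) ppca \<Rightarrow> ('y \<Rightarrow> 'x) \<Rightarrow> ('y \<Rightarrow> 'a set) \<Rightarrow> 'x \<Rightarrow> 'a set" where
  "all_along T r \<phi> x =
     {a. \<forall>y. r y = x \<longrightarrow> (\<forall>b. \<forall>p\<in>params T. \<exists>c\<in>\<phi> y. app T p a b = Some c)}"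

text \<open>Quantification along \<open>'x \<rightarrow> 1\<close>.  Applied pointwise in the remaining variables, these
  are the quantifiers along projections.\<close>

definition tex :: "('x \<Rightarrow> 'a set) \<Rightarrow> 'a set" where
  "tex \<phi> = ex_along (\<lambda>_. ()) \<phi> ()"

definition tall :: "('a, 'p) ppca \<Rightarrow> ('x \<Rightarrow> 'a set) \<Rightarrow> 'a set" where
  "tall T \<phi> = all_along T (\<lambda>_. ()) \<phi> ()"

definition valid :: "('a, 'p) ppca \<Rightarrow> 'a set \<Rightarrow> bool" where
  "valid T \<phi> \<longleftrightarrow> entails T (\<lambda>_::unit. UNIV) (\<lambda>_. \<phi>)"

text \<open>The truth value of a classical proposition.\<close>

definition tv :: "bool \<Rightarrow> 'a set" where
  "tv P = {_. P}"


section \<open>The topos of a ppca and its internal language\<close>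

text \<open>Objects are given by their equality predicates, with \<open>X x x\<close> the existence predicate
  of \<open>x\<close>.  Formulas of the internal language are interpreted in the tripos, with quantifiers
  relativized to existence.\<close>

type_synonym ('a, 'x) obj = "'x \<Rightarrow> 'x \<Rightarrow> 'a set"

definition topos_object :: "('a, 'p) ppca \<Rightarrow> ('a, 'x) obj \<Rightarrow> bool" where
  "topos_object T X \<longleftrightarrow>
     entails T (\<lambda>(x, y). X x y) (\<lambda>(x, y). X y x) \<and>
     entails T (\<lambda>(x, y, z). X x y \<^bold>\<and>\<^bsub>T\<^esub> X y z) (\<lambda>(x, y, z). X x z)"

definition all_in :: "('a, 'p) ppca \<Rightarrow> ('a, 'x) obj \<Rightarrow> ('x \<Rightarrow> 'a set) \<Rightarrow> 'a set" where
  "all_in T X \<phi> = tall T (\<lambda>x. X x x \<^bold>\<longrightarrow>\<^bsub>T\<^esub> \<phi> x)"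

definition ex_in :: "('a, 'p) ppca \<Rightarrow> ('a, 'x) obj \<Rightarrow> ('x \<Rightarrow> 'a set) \<Rightarrow> 'a set" where
  "ex_in T X \<phi> = tex (\<lambda>x. X x x \<^bold>\<and>\<^bsub>T\<^esub> \<phi> x)"

definition prod_obj :: "('a, 'p) ppca \<Rightarrow> ('a, 'x) obj \<Rightarrow> ('a, 'y) obj \<Rightarrow> ('a, 'x \<times> 'y) obj" where
  "prod_obj T X Y u v = (X (fst u) (fst v) \<^bold>\<and>\<^bsub>T\<^esub> Y (snd u) (snd v))"

text \<open>The subobject of \<open>X\<close> cut out by an (extensional) predicate \<open>\<phi>\<close>.\<close>

definition sub_obj :: "('a, 'p) ppca \<Rightarrow> ('a, 'x) obj \<Rightarrow> ('x \<Rightarrow> 'a set) \<Rightarrow> ('a, 'x) obj" where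
  "sub_obj T X \<phi> x y = (X x y \<^bold>\<and>\<^bsub>T\<^esub> \<phi> x)"

text \<open>Elements of the power object exist to the extent that they are strict and extensional;
  membership of \<open>x\<close> in \<open>U\<close> is \<open>U x\<close>.\<close>

definition pow_obj :: "('a, 'p) ppca \<Rightarrow> ('a, 'x) obj \<Rightarrow> ('a, 'x \<Rightarrow> 'a set) obj" where
  "pow_obj T X U V =
     (tall T (\<lambda>x. U x \<^bold>\<longrightarrow>\<^bsub>T\<^esub> X x x) \<^bold>\<and>\<^bsub>T\<^esub>
      tall T (\<lambda>x. tall T (\<lambda>y. U x \<^bold>\<and>\<^bsub>T\<^esub> X x y \<^bold>\<longrightarrow>\<^bsub>T\<^esub> U y)) \<^bold>\<and>\<^bsub>T\<^esub>
      tall T (\<lambda>x. U x \<^bold>\<longleftrightarrow>\<^bsub>T\<^esub> V x))"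

definition functional ::
  "('a, 'p) ppca \<Rightarrow> ('a, 'x) obj \<Rightarrow> ('a, 'y) obj \<Rightarrow> ('x \<times> 'y \<Rightarrow> 'a set) \<Rightarrow> 'a set" where
  "functional T X Y F =
     (all_in T X (\<lambda>x. all_in T Y (\<lambda>y. all_in T Y (\<lambda>y'.
        F (x, y) \<^bold>\<and>\<^bsub>T\<^esub> F (x, y') \<^bold>\<longrightarrow>\<^bsub>T\<^esub> Y y y'))) \<^bold>\<and>\<^bsub>T\<^esub>
      all_in T X (\<lambda>x. ex_in T Y (\<lambda>y. F (x, y))))"

text \<open>The exponential \<open>Y\<^sup>X\<close>: functional relations as elements of the power object of \<open>X \<times> Y\<close>.\<close>

definition exp_obj ::
  "('a, 'p) ppca \<Rightarrow> ('a, 'x) obj \<Rightarrow> ('a, 'y) obj \<Rightarrow> ('a, 'x \<times> 'y \<Rightarrow> 'a set) obj" where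
  "exp_obj T X Y = sub_obj T (pow_obj T (prod_obj T X Y)) (functional T X Y)"

definition topos_morphism ::
  "('a, 'p) ppca \<Rightarrow> ('a, 'x) obj \<Rightarrow> ('a, 'y) obj \<Rightarrow> ('x \<times> 'y \<Rightarrow> 'a set) \<Rightarrow> bool" where
  "topos_morphism T X Y F \<longleftrightarrow> valid T (exp_obj T X Y F F)"

text \<open>\<open>value_in T Y F x \<phi>\<close> says that the value at \<open>x\<close> of the function with graph \<open>F\<close>
  satisfies \<open>\<phi>\<close>.\<close>

definition value_in ::
  "('a, 'p) ppca \<Rightarrow> ('a, 'y) obj \<Rightarrow> ('x \<times> 'y \<Rightarrow> 'a set) \<Rightarrow> 'x \<Rightarrow> ('y \<Rightarrow> 'a set) \<Rightarrow> 'a set" where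
  "value_in T Y F x \<phi> = ex_in T Y (\<lambda>y. F (x, y) \<^bold>\<and>\<^bsub>T\<^esub> \<phi> y)"


section \<open>Dedekind reals\<close>

text \<open>\<open>Q\<close> is the object of rationals.  Reals are pairs of a lower and an upper cut, both
  elements of the power object of \<open>Q\<close>.  The order of the rationals is decidable, hence is
  given by its classical truth value.\<close>

type_synonym 'a cut = "(rat \<Rightarrow> 'a set) \<times> (rat \<Rightarrow> 'a set)"

definition dedekind_cut :: "('a, 'p) ppca \<Rightarrow> ('a, rat) obj \<Rightarrow> 'a cut \<Rightarrow> 'a set" where
  "dedekind_cut T Q x = (case x of (L, U) \<Rightarrow>
     ex_in T Q L \<^bold>\<and>\<^bsub>T\<^esub> ex_in T Q U \<^bold>\<and>\<^bsub>T\<^esub>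
     all_in T Q (\<lambda>a. L a \<^bold>\<longleftrightarrow>\<^bsub>T\<^esub> ex_in T Q (\<lambda>b. tv (a < b) \<^bold>\<and>\<^bsub>T\<^esub> L b)) \<^bold>\<and>\<^bsub>T\<^esub>
     all_in T Q (\<lambda>b. U b \<^bold>\<longleftrightarrow>\<^bsub>T\<^esub> ex_in T Q (\<lambda>a. tv (a < b) \<^bold>\<and>\<^bsub>T\<^esub> U a)) \<^bold>\<and>\<^bsub>T\<^esub>
     all_in T Q (\<lambda>a. \<^bold>\<not>\<^bsub>T\<^esub> (L a \<^bold>\<and>\<^bsub>T\<^esub> U a)) \<^bold>\<and>\<^bsub>T\<^esub>
     all_in T Q (\<lambda>a. all_in T Q (\<lambda>b. tv (a < b) \<^bold>\<longrightarrow>\<^bsub>T\<^esub> (L a \<^bold>\<or>\<^bsub>T\<^esub> U b))))"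

definition dedekind_obj :: "('a, 'p) ppca \<Rightarrow> ('a, rat) obj \<Rightarrow> ('a, 'a cut) obj" where
  "dedekind_obj T Q = sub_obj T (prod_obj T (pow_obj T Q) (pow_obj T Q)) (dedekind_cut T Q)"

definition cut_less :: "('a, 'p) ppca \<Rightarrow> ('a, rat) obj \<Rightarrow> 'a cut \<Rightarrow> 'a cut \<Rightarrow> 'a set" where
  "cut_less T Q x y = ex_in T Q (\<lambda>a. snd x a \<^bold>\<and>\<^bsub>T\<^esub> fst y a)"

definition cut_le :: "('a, 'p) ppca \<Rightarrow> ('a, rat) obj \<Rightarrow> 'a cut \<Rightarrow> 'a cut \<Rightarrow> 'a set" where
  "cut_le T Q x y = (\<^bold>\<not>\<^bsub>T\<^esub> cut_less T Q y x)"

definition rat_cut :: "('a, 'p) ppca \<Rightarrow> ('a, rat) obj \<Rightarrow> rat \<Rightarrow> 'a cut" where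
  "rat_cut T Q c = (\<lambda>a. Q a a \<^bold>\<and>\<^bsub>T\<^esub> tv (a < c), \<lambda>a. Q a a \<^bold>\<and>\<^bsub>T\<^esub> tv (c < a))"

definition unit_interval_obj :: "('a, 'p) ppca \<Rightarrow> ('a, rat) obj \<Rightarrow> ('a, 'a cut) obj" where
  "unit_interval_obj T Q = sub_obj T (dedekind_obj T Q)
     (\<lambda>x. cut_le T Q (rat_cut T Q 0) x \<^bold>\<and>\<^bsub>T\<^esub> cut_le T Q x (rat_cut T Q 1))"


section \<open>The topos of a Miller sequence\<close>

definition miller_ppca :: "(nat \<Rightarrow> real) \<Rightarrow> (nat, nat \<Rightarrow> bool) ppca" where
  "miller_ppca \<mu> = \<lparr> params = {\<alpha>. bin_seq \<alpha> = \<mu>}, app = phi \<rparr>"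

text \<open>As the natural numbers object is \<open>\<nat>\<close> with \<open>n\<close> realized by itself, the object of rationals
  is the set of rationals, each realized by its position in the enumeration \<open>q\<close>.\<close>

definition rat_obj :: "(nat \<Rightarrow> rat) \<Rightarrow> (nat, rat) obj" where
  "rat_obj q a b = {n. q n = a \<and> a = b}"

end

theory Submission
  imports Defs
begin

text \<open>If no oracle represents \<open>\<mu>\<close>, every proposition is vacuously valid.  Otherwise, with \<open>clip\<close>
  truncating to an interval, a realizer of \<open>f\<close> yields, for every \<open>n\<close>, an index of the real
  \<open>clip 0 1 (\<mu> n - clip (-1) 1 (f (\<mu> n)))\<close>, uniformly in \<open>n\<close> and in the oracle: an oracle
  computes \<open>\<mu> n\<close>, totality of \<open>f\<close> gives a Dedekind real \<open>f (\<mu> n)\<close>, and its locatedness gives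
  approximations.  By the recursion theorem some \<open>n\<close> is itself an index of this real, and as \<open>\<mu>\<close>
  is a Miller sequence, the real is \<open>\<mu> n\<close>.  This is Lawvere's fixed point argument for the
  countable interval; the fixed point equation together with \<open>f 0 < 0 < f 1\<close> forces
  \<open>f (\<mu> n) = 0\<close>.\<close>

section \<open>Closure properties of oracle computability\<close>

text \<open>Validity is uniform in the oracle: one number has to realize a proposition for all
  oracles in \<open>M\<close>. Yet distinct oracles may disagree on the digits of a dyadic \<mu> n,
  and the locatedness of \<open>f (\<mu> n)\<close> may choose different alternatives under
  different oracles. Following such answers, as bisection does, can lead to different reals, whereas
  the Miller property only speaks about indices that represent one real under all oracles. So oracle
  dependent answers are used for approximations only, whose limit is fixed classically in advance.
  Both truncations serve this: the outer one keeps the limit in [0,1], where the Miller property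
  applies, and the inner one confines the comparisons with \<open>f (\<mu> n)\<close> to a bounded
  range, so that finitely many of them, at fixed rationals, give each approximation. The answer n is
  computed from the realizer of f alone, by a recursion theorem with a parameter, and is therefore
  the same for all oracles. That \<open>f (\<mu> n)\<close> is zero is then proved classically, and
  only the equality with zero in the topos has to be realized anew.\<close>

abbreviation pfst :: "nat \<Rightarrow> nat" where "pfst z \<equiv> fst (prod_decode z)"
abbreviation psnd :: "nat \<Rightarrow> nat" where "psnd z \<equiv> snd (prod_decode z)"
abbreviation pe :: "nat \<Rightarrow> nat \<Rightarrow> nat" where "pe a b \<equiv> prod_encode (a, b)"

text \<open>The oracle is an argument of the function, so that a single program serves all oracles.
  This is the uniformity that \<open>entails\<close> demands of a realizer.\<close>

definition pcomp :: "((nat \<Rightarrow> bool) \<Rightarrow> nat \<Rightarrow> nat option) \<Rightarrow> bool" where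
  "pcomp F \<longleftrightarrow> (\<exists>P. \<forall>\<alpha> n. run \<alpha> P n = F \<alpha> n)"

definition tcomp :: "((nat \<Rightarrow> bool) \<Rightarrow> nat \<Rightarrow> nat) \<Rightarrow> bool" where
  "tcomp f \<longleftrightarrow> pcomp (\<lambda>\<alpha> n. Some (f \<alpha> n))"

definition dcomp :: "((nat \<Rightarrow> bool) \<Rightarrow> nat \<Rightarrow> bool) \<Rightarrow> bool" where
  "dcomp P \<longleftrightarrow> tcomp (\<lambda>\<alpha> n. of_bool (P \<alpha> n))"

lemma pcompI: "(\<And>\<alpha> n. run \<alpha> P n = F \<alpha> n) \<Longrightarrow> pcomp F"
  by (auto simp: pcomp_def)

lemma pcomp_Some: "tcomp f \<Longrightarrow> pcomp (\<lambda>\<alpha> n. Some (f \<alpha> n))"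
  by (simp add: tcomp_def)

lemma tcomp_id: "tcomp (\<lambda>\<alpha> n. n)"
  unfolding tcomp_def pcomp_def by (rule exI[of _ "PPair PFst PSnd"]) simp

text \<open>The continuation sees both the input and the intermediate value, so it is assumed
  computable on coded pairs. With premises in this uncurried form, computability goals are
  decomposed by their syntax.\<close>

lemma pcomp_bind:
  assumes "pcomp F" "pcomp (\<lambda>\<alpha> z. G \<alpha> (pfst z) (psnd z))"
  shows "pcomp (\<lambda>\<alpha> n. Option.bind (F \<alpha> n) (G \<alpha> n))"
proof -
  obtain P where P: "\<And>\<alpha> n. run \<alpha> P n = F \<alpha> n" using assms(1) by (auto simp: pcomp_def)
  obtain R where R: "\<And>\<alpha> z. run \<alpha> R z = G \<alpha> (pfst z) (psnd z)" using assms(2) by (auto simp: pcomp_def)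
  have "run \<alpha> (PComp R (PPair (PPair PFst PSnd) P)) n = Option.bind (F \<alpha> n) (G \<alpha> n)" for \<alpha> n
    by (cases "F \<alpha> n") (simp_all add: P R)
  then show ?thesis by (rule pcompI)
qed

lemma pcomp_comp:
  assumes "pcomp F" "tcomp f"
  shows "pcomp (\<lambda>\<alpha> n. F \<alpha> (f \<alpha> n))"
proof -
  obtain P where P: "\<And>\<alpha> n. run \<alpha> P n = F \<alpha> n" using assms(1) by (auto simp: pcomp_def)
  obtain R where R: "\<And>\<alpha> z. run \<alpha> R z = Some (f \<alpha> z)" using assms(2) by (auto simp: pcomp_def tcomp_def)
  have "run \<alpha> (PComp P R) n = F \<alpha> (f \<alpha> n)" for \<alpha> n by (simp add: P R)
  then show ?thesis by (rule pcompI)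
qed

lemma tcomp_comp: "tcomp g \<Longrightarrow> tcomp f \<Longrightarrow> tcomp (\<lambda>\<alpha> n. g \<alpha> (f \<alpha> n))"
  unfolding tcomp_def[of g] tcomp_def[of "\<lambda>\<alpha> n. g \<alpha> (f \<alpha> n)"] by (rule pcomp_comp)

lemma tcomp_Suc: "tcomp f \<Longrightarrow> tcomp (\<lambda>\<alpha> n. Suc (f \<alpha> n))"
  by (rule tcomp_comp[of "\<lambda>\<alpha> n. Suc n"]) (auto simp: tcomp_def pcomp_def intro: exI[of _ PSucc])

lemma tcomp_pfst: "tcomp f \<Longrightarrow> tcomp (\<lambda>\<alpha> n. pfst (f \<alpha> n))"
  by (rule tcomp_comp[of "\<lambda>\<alpha> n. pfst n"]) (auto simp: tcomp_def pcomp_def intro: exI[of _ PFst])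

lemma tcomp_psnd: "tcomp f \<Longrightarrow> tcomp (\<lambda>\<alpha> n. psnd (f \<alpha> n))"
  by (rule tcomp_comp[of "\<lambda>\<alpha> n. psnd n"]) (auto simp: tcomp_def pcomp_def intro: exI[of _ PSnd])

lemma tcomp_oracle: "tcomp f \<Longrightarrow> tcomp (\<lambda>\<alpha> n. of_bool (\<alpha> (f \<alpha> n)))"
  by (rule tcomp_comp[of "\<lambda>\<alpha> n. of_bool (\<alpha> n)"]) (auto simp: tcomp_def pcomp_def intro: exI[of _ POracle])

lemma tcomp_pe:
  assumes "tcomp f" "tcomp g"
  shows "tcomp (\<lambda>\<alpha> n. pe (f \<alpha> n) (g \<alpha> n))"
proof -
  obtain P where P: "\<And>\<alpha> n. run \<alpha> P n = Some (f \<alpha> n)" using assms(1) by (auto simp: pcomp_def tcomp_def)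
  obtain R where R: "\<And>\<alpha> z. run \<alpha> R z = Some (g \<alpha> z)" using assms(2) by (auto simp: pcomp_def tcomp_def)
  have "run \<alpha> (PPair P R) n = Some (pe (f \<alpha> n) (g \<alpha> n))" for \<alpha> n by (simp add: P R)
  then show ?thesis unfolding pcomp_def tcomp_def by blast
qed

lemma tcomp_const: "tcomp (\<lambda>\<alpha> n. c)"
proof (induction c)
  case 0
  show ?case by (auto simp: tcomp_def pcomp_def intro: exI[of _ PZero])
next
  case (Suc c)
  then show ?case by (rule tcomp_Suc)
qed

lemma pcomp_rec:
  assumes "pcomp F" "pcomp (\<lambda>\<alpha> z. G \<alpha> (pfst z) (pfst (psnd z)) (psnd (psnd z)))" "tcomp h"
  shows "pcomp (\<lambda>\<alpha> n. rec_nat (F \<alpha> n) (\<lambda>i r. Option.bind r (G \<alpha> n i)) (h \<alpha> n))"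
proof -
  obtain P where P: "\<And>\<alpha> n. run \<alpha> P n = F \<alpha> n" using assms(1) by (auto simp: pcomp_def)
  obtain R where R: "\<And>\<alpha> z. run \<alpha> R z = G \<alpha> (pfst z) (pfst (psnd z)) (psnd (psnd z))"
    using assms(2) by (auto simp: pcomp_def)
  have "run \<alpha> (PRec P R) (pe n m) = rec_nat (F \<alpha> n) (\<lambda>i r. Option.bind r (G \<alpha> n i)) m" for \<alpha> n m
    by (induction m) (simp_all add: P R)
  then have "run \<alpha> (PRec P R) n = rec_nat (F \<alpha> (pfst n)) (\<lambda>i r. Option.bind r (G \<alpha> (pfst n) i)) (psnd n)" for \<alpha> n
    by (metis prod.collapse prod_decode_inverse)
  then have "pcomp (\<lambda>\<alpha> n. rec_nat (F \<alpha> (pfst n)) (\<lambda>i r. Option.bind r (G \<alpha> (pfst n) i)) (psnd n))"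
    by (rule pcompI)
  from pcomp_comp[OF this tcomp_pe[OF tcomp_id assms(3)]] show ?thesis by simp
qed

lemma tcomp_rec:
  assumes "tcomp f" "tcomp (\<lambda>\<alpha> z. g \<alpha> (pfst z) (pfst (psnd z)) (psnd (psnd z)))" "tcomp h"
  shows "tcomp (\<lambda>\<alpha> n. rec_nat (f \<alpha> n) (g \<alpha> n) (h \<alpha> n))"
proof -
  have *: "rec_nat (Some a) (\<lambda>i r. Option.bind r (\<lambda>y. Some (G i y))) m = Some (rec_nat a G m)"
    for a and G :: "nat \<Rightarrow> nat \<Rightarrow> nat" and m by (induction m) auto
  show ?thesis
    using pcomp_rec[of "\<lambda>\<alpha> n. Some (f \<alpha> n)" "\<lambda>\<alpha> n i y. Some (g \<alpha> n i y)" h] assms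
    by (simp add: tcomp_def *)
qed

lemmas tcomp_basic = tcomp_id tcomp_const tcomp_Suc tcomp_pfst tcomp_psnd tcomp_oracle tcomp_pe

lemma tcomp_plus:
  assumes "tcomp f" "tcomp g"
  shows "tcomp (\<lambda>\<alpha> n. f \<alpha> n + g \<alpha> n)"
proof -
  have eq: "x + y = rec_nat x (\<lambda>i r. Suc r) y" for x y :: nat by (induction y) auto
  show ?thesis unfolding eq by (intro tcomp_rec tcomp_basic assms)
qed

lemma tcomp_times:
  assumes "tcomp f" "tcomp g"
  shows "tcomp (\<lambda>\<alpha> n. f \<alpha> n * g \<alpha> n)"
proof -
  have eq: "x * y = rec_nat 0 (\<lambda>i r. r + x) y" for x y :: nat by (induction y) auto
  show ?thesis unfolding eq by (intro tcomp_rec tcomp_plus tcomp_basic tcomp_comp[OF assms(1)] assms)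
qed

lemma tcomp_minus:
  assumes "tcomp f" "tcomp g"
  shows "tcomp (\<lambda>\<alpha> n. f \<alpha> n - g \<alpha> n)"
proof -
  have 1: "x - 1 = rec_nat 0 (\<lambda>i r. i) x" for x :: nat by (induction x) auto
  have "tcomp (\<lambda>\<alpha> n. n - 1)" unfolding 1 by (intro tcomp_rec tcomp_basic)
  then have pred: "tcomp h \<Longrightarrow> tcomp (\<lambda>\<alpha> n. h \<alpha> n - 1)" for h by (rule tcomp_comp)
  have eq: "x - y = rec_nat x (\<lambda>i r. r - 1) y" for x y :: nat by (induction y) auto
  have "tcomp (\<lambda>\<alpha> n. rec_nat (f \<alpha> n) (\<lambda>i r. r - 1) (g \<alpha> n))"
    by (intro tcomp_rec pred tcomp_basic assms)
  then show ?thesis unfolding eq[symmetric] .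
qed

lemma tcomp_if:
  assumes "dcomp P" "tcomp f" "tcomp g"
  shows "tcomp (\<lambda>\<alpha> n. if P \<alpha> n then f \<alpha> n else g \<alpha> n)"
proof -
  have eq: "(if b then x else y) = rec_nat y (\<lambda>i r. x) (of_bool b)" for b and x y :: nat by simp
  show ?thesis unfolding eq
    by (intro tcomp_rec tcomp_basic tcomp_comp[OF assms(2)] assms assms(1)[unfolded dcomp_def])
qed

lemma dcomp_not: "dcomp P \<Longrightarrow> dcomp (\<lambda>\<alpha> n. \<not> P \<alpha> n)"
proof -
  have eq: "(of_bool (\<not> b) :: nat) = 1 - of_bool b" for b by simp
  show "dcomp P \<Longrightarrow> dcomp (\<lambda>\<alpha> n. \<not> P \<alpha> n)" unfolding dcomp_def eq by (intro tcomp_minus tcomp_basic)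
qed

lemma dcomp_conj: "dcomp P \<Longrightarrow> dcomp R \<Longrightarrow> dcomp (\<lambda>\<alpha> n. P \<alpha> n \<and> R \<alpha> n)"
  using tcomp_times[of "\<lambda>\<alpha> n. of_bool (P \<alpha> n)" "\<lambda>\<alpha> n. of_bool (R \<alpha> n)"]
  by (simp add: dcomp_def of_bool_conj)

lemma dcomp_disj: "dcomp P \<Longrightarrow> dcomp R \<Longrightarrow> dcomp (\<lambda>\<alpha> n. P \<alpha> n \<or> R \<alpha> n)"
  using dcomp_not[OF dcomp_conj[OF dcomp_not dcomp_not, of P R]] by simp

lemma dcomp_less:
  assumes "tcomp f" "tcomp g"
  shows "dcomp (\<lambda>\<alpha> n. f \<alpha> n < g \<alpha> n)"
proof -
  have eq: "(of_bool (x < y) :: nat) = 1 - (1 - (y - x))" for x y :: nat by auto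
  show ?thesis unfolding dcomp_def eq by (intro tcomp_minus assms tcomp_basic)
qed

lemma dcomp_le: "tcomp f \<Longrightarrow> tcomp g \<Longrightarrow> dcomp (\<lambda>\<alpha> n. f \<alpha> n \<le> g \<alpha> n)"
  using dcomp_not[OF dcomp_less[of g f]] by (simp add: not_less)

lemma dcomp_eq: "tcomp f \<Longrightarrow> tcomp g \<Longrightarrow> dcomp (\<lambda>\<alpha> n. f \<alpha> n = g \<alpha> n)"
  using dcomp_conj[OF dcomp_le[of f g] dcomp_le[of g f]] by (simp add: order_eq_iff)

lemma tcomp_div:
  assumes "tcomp f" "d > 0"
  shows "tcomp (\<lambda>\<alpha> n. f \<alpha> n div d)"
proof -
  \<comment> \<open>The quotient goes up at \<open>Suc i\<close> exactly when the next multiple of d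
    has been reached, which makes division a recursion on the dividend.\<close>
  have eq: "x div d = rec_nat 0 (\<lambda>i r. if Suc r * d \<le> Suc i then Suc r else r) x" for x
  proof (induction x)
    case (Suc x)
    have "Suc x div d = (if Suc (x div d) * d \<le> Suc x then Suc (x div d) else x div d)"
    proof (cases "Suc x mod d = 0")
      case True
      then have "Suc x div d = Suc (x div d)" by (simp add: div_Suc)
      then show ?thesis by (metis div_times_less_eq_dividend)
    next
      case False
      then have *: "Suc x div d = x div d" by (simp add: div_Suc)
      have "Suc x < Suc (Suc x div d) * d"
        using assms(2) by (metis dividend_less_div_times mult_Suc)
      with * show ?thesis by auto
    qed
    with Suc show ?case by simp
  qed simp
  show ?thesis unfolding eq
    by (intro tcomp_rec tcomp_if dcomp_le tcomp_plus tcomp_times tcomp_basic assms)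
qed

lemma tcomp_mod:
  assumes "tcomp f" "d > 0"
  shows "tcomp (\<lambda>\<alpha> n. f \<alpha> n mod d)"
  unfolding modulo_nat_def by (intro tcomp_minus tcomp_times tcomp_div tcomp_basic assms)

lemma tcomp_power2: "tcomp f \<Longrightarrow> tcomp (\<lambda>\<alpha> n. 2 ^ f \<alpha> n)"
proof -
  have eq: "2 ^ x = rec_nat 1 (\<lambda>i r. 2 * r) x" for x :: nat by (induction x) auto
  assume "tcomp f"
  then show ?thesis unfolding eq by (intro tcomp_rec tcomp_times tcomp_basic)
qed

lemma tcomp_funpow:
  assumes "tcomp g" "tcomp f" "tcomp h"
  shows "tcomp (\<lambda>\<alpha> n. (g \<alpha> ^^ h \<alpha> n) (f \<alpha> n))"
proof -
  have eq: "(G ^^ m) x = rec_nat x (\<lambda>i r. G r) m" for G m and x :: nat by (induction m) auto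
  show ?thesis unfolding eq by (intro tcomp_rec tcomp_comp[OF assms(1)] tcomp_basic assms)
qed

lemma pcomp_mu:
  assumes "dcomp (\<lambda>\<alpha> z. P \<alpha> (pfst z) (psnd z))"
  shows "pcomp (\<lambda>\<alpha> n. if \<exists>k. P \<alpha> n k then Some (LEAST k. P \<alpha> n k) else None)"
proof -
  \<comment> \<open>Minimization looks for a zero, hence the negated truth value. As the test is
    total, it is defined at all values below the least zero.\<close>
  have "tcomp (\<lambda>\<alpha> z. of_bool (\<not> P \<alpha> (pfst z) (psnd z)))"
    using dcomp_not[OF assms] by (simp add: dcomp_def)
  then obtain R where R: "\<And>\<alpha> z. run \<alpha> R z = Some (of_bool (\<not> P \<alpha> (pfst z) (psnd z)))"
    by (auto simp: pcomp_def tcomp_def)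
  have "run \<alpha> (PMu R) n = (if \<exists>k. P \<alpha> n k then Some (LEAST k. P \<alpha> n k) else None)" for \<alpha> n
    by (simp add: R)
  then show ?thesis by (rule pcompI)
qed

lemma pcomp_if:
  assumes "dcomp P" "pcomp F" "pcomp G"
  shows "pcomp (\<lambda>\<alpha> n. if P \<alpha> n then F \<alpha> n else G \<alpha> n)"
proof -
  obtain p where p: "\<And>\<alpha> n. run \<alpha> p n = F \<alpha> n" using assms(2) by (auto simp: pcomp_def)
  obtain r where r: "\<And>\<alpha> n. run \<alpha> r n = G \<alpha> n" using assms(3) by (auto simp: pcomp_def)
  define c where "c = (\<lambda>\<alpha> n. of_bool (P \<alpha> n) :: nat)"
  have c: "tcomp c" using assms(1) by (simp add: dcomp_def c_def)
  text \<open>A dummy recursion of length \<open>0\<close> or \<open>1\<close> evaluates only the selected branch.\<close>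
  have *: "(if P \<alpha> n then F \<alpha> n else G \<alpha> n) =
      Option.bind (rec_nat (Some 0) (\<lambda>i r. Option.bind r (\<lambda>_. F \<alpha> n)) (c \<alpha> n))
        (\<lambda>x. rec_nat (Some x) (\<lambda>i r. Option.bind r (\<lambda>_. G \<alpha> n)) (1 - c \<alpha> n))" for \<alpha> n
    by (cases "P \<alpha> n"; cases "F \<alpha> n"; cases "G \<alpha> n") (simp_all add: c_def)
  show ?thesis unfolding *
    by (intro pcomp_bind pcomp_rec pcomp_Some pcomp_comp[OF assms(2)] pcomp_comp[OF assms(3)]
        tcomp_minus tcomp_basic c tcomp_comp[OF c])
qed

lemmas tcomp_intros = tcomp_basic tcomp_plus tcomp_times tcomp_minus tcomp_if tcomp_power2
  dcomp_not dcomp_conj dcomp_disj dcomp_less dcomp_le dcomp_eq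

section \<open>A universal program\<close>

text \<open>Stack machine states are coded as \<open>((0, e, n), K)\<close>, to evaluate program \<open>e\<close> at \<open>n\<close>, and
  \<open>((1, v), K)\<close>, to return \<open>v\<close> to the stack \<open>K\<close>, with \<open>0\<close> the empty stack.  The tag of a stack
  frame tells what awaits the returned value: \<open>0\<close> and \<open>1\<close> the first and second component of a
  pair, \<open>2\<close> a composition, \<open>3\<close> a recursion, \<open>4\<close> a minimization.\<close>

definition ev :: "nat \<Rightarrow> nat \<Rightarrow> nat \<Rightarrow> nat" where "ev e n K = pe (pe 0 (pe e n)) K"
definition rt :: "nat \<Rightarrow> nat \<Rightarrow> nat" where "rt v K = pe (pe 1 v) K"
definition push :: "nat \<Rightarrow> nat \<Rightarrow> nat \<Rightarrow> nat \<Rightarrow> nat \<Rightarrow> nat \<Rightarrow> nat" where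
  "push t a b c d K = Suc (pe (pe t (pe (pe a b) (pe c d))) K)"

definition mev :: "(nat \<Rightarrow> bool) \<Rightarrow> nat \<Rightarrow> nat \<Rightarrow> nat \<Rightarrow> nat" where
  "mev \<alpha> e n K =
    (if e = 0 then rt 0 K else if e = 1 then rt (Suc n) K
     else if e = 2 then rt (pfst n) K else if e = 3 then rt (psnd n) K
     else if e = 4 then rt (of_bool (\<alpha> n)) K
     else if (e - 5) mod 4 = 0
       then ev (pfst ((e - 5) div 4)) n (push 0 (psnd ((e - 5) div 4)) n 0 0 K)
     else if (e - 5) mod 4 = 1
       then ev (psnd ((e - 5) div 4)) n (push 2 (pfst ((e - 5) div 4)) 0 0 0 K)
     else if (e - 5) mod 4 = 2
       then ev (pfst ((e - 5) div 4)) (pfst n) (push 3 (psnd ((e - 5) div 4)) (pfst n) 0 (psnd n) K)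
     else ev ((e - 5) div 4) (pe n 0) (push 4 ((e - 5) div 4) n 0 0 K))"

text \<open>The data of a frame, by tag. 0: a is the second program, b its argument. 1: a is the
  first value. 2: a is the outer program. 3: a is the loop body, b the parameter, c the counter, d
  the bound, and v the c-th value. 4: a is the tested program, b its argument, c the candidate, and
  v the value at c.\<close>

definition mret :: "nat \<Rightarrow> nat \<Rightarrow> nat \<Rightarrow> nat \<Rightarrow> nat \<Rightarrow> nat \<Rightarrow> nat \<Rightarrow> nat" where
  "mret v t a b c d K =
    (if t = 0 then ev a b (push 1 v 0 0 0 K)
     else if t = 1 then rt (pe a v) K
     else if t = 2 then ev a v K
     else if t = 3 then
       (if c = d then rt v K else ev a (pe b (pe c v)) (push 3 a b (Suc c) d K))
     else (if v = 0 then rt c K else ev a (pe b (Suc c)) (push 4 a b (Suc c) 0 K)))"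

definition mstep :: "(nat \<Rightarrow> bool) \<Rightarrow> nat \<Rightarrow> nat" where
  "mstep \<alpha> c =
    (if pfst (pfst c) = 0
     then mev \<alpha> (pfst (psnd (pfst c))) (psnd (psnd (pfst c))) (psnd c)
     else if psnd c = 0 then c
     else mret (psnd (pfst c)) (pfst (pfst (psnd c - 1)))
       (pfst (pfst (psnd (pfst (psnd c - 1))))) (psnd (pfst (psnd (pfst (psnd c - 1)))))
       (pfst (psnd (psnd (pfst (psnd c - 1))))) (psnd (psnd (psnd (pfst (psnd c - 1)))))
       (psnd (psnd c - 1)))"

lemma mstep_ev: "mstep \<alpha> (ev e n K) = mev \<alpha> e n K"
  by (simp add: mstep_def ev_def)

lemma mstep_rt_push: "mstep \<alpha> (rt v (push t a b c d K)) = mret v t a b c d K"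
  by (simp add: mstep_def rt_def push_def)

lemma mstep_rt_0: "mstep \<alpha> (rt v 0) = rt v 0"
  by (simp add: mstep_def rt_def)

lemma tcomp_mstep: "tcomp mstep"
  unfolding mstep_def[abs_def] mev_def mret_def rt_def ev_def push_def
  by (intro tcomp_intros tcomp_div tcomp_mod) simp_all


section \<open>Goedel numbers of the program constructors\<close>

declare prog_of.simps [simp del]

lemma prog_of_5: "prog_of (5 + n) =
    (if n mod 4 = 0 then PPair (prog_of (pfst (n div 4))) (prog_of (psnd (n div 4)))
     else if n mod 4 = 1 then PComp (prog_of (pfst (n div 4))) (prog_of (psnd (n div 4)))
     else if n mod 4 = 2 then PRec (prog_of (pfst (n div 4))) (prog_of (psnd (n div 4)))
     else PMu (prog_of (n div 4)))"
proof -
  have *: "5 + n = Suc (Suc (Suc (Suc (Suc n))))" by simp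
  show ?thesis unfolding * by (rule prog_of.simps(6))
qed

definition code_pair :: "nat \<Rightarrow> nat \<Rightarrow> nat" where "code_pair a b = 5 + 4 * pe a b"
definition code_comp :: "nat \<Rightarrow> nat \<Rightarrow> nat" where "code_comp a b = 5 + (4 * pe a b + 1)"
definition code_rec :: "nat \<Rightarrow> nat \<Rightarrow> nat" where "code_rec a b = 5 + (4 * pe a b + 2)"
definition code_mu :: "nat \<Rightarrow> nat" where "code_mu a = 5 + (4 * a + 3)"

lemmas code_defs = code_pair_def code_comp_def code_rec_def code_mu_def

lemma four_div_mod:
  "(4 * x + 1) div 4 = x" "(4 * x + 2) div 4 = x" "(4 * x + 3) div 4 = x"
  "(4 * x + 1) mod 4 = 1" "(4 * x + 2) mod 4 = 2" "(4 * x + 3) mod 4 = 3" for x :: nat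
  by presburger+

lemma prog_cases [case_names Zero Succ Fst Snd Oracle Pair Comp Rec Mu]:
  fixes e :: nat
  obtains "e = 0" | "e = 1" | "e = 2" | "e = 3" | "e = 4"
  | a b where "e = code_pair a b" | a b where "e = code_comp a b"
  | a b where "e = code_rec a b" | a where "e = code_mu a"
proof -
  consider "e < 5" | m where "e = 5 + m" by (metis le_add_diff_inverse not_le)
  then show thesis
  proof cases
    case 1
    then have "e = 0 \<or> e = 1 \<or> e = 2 \<or> e = 3 \<or> e = 4" by linarith
    then show ?thesis using that(1-5) by blast
  next
    case (2 m)
    obtain j where j: "m = 4 * j + m mod 4" by (metis mult_div_mod_eq)
    obtain a b where ab: "j = pe a b" by (metis prod_decode_inverse prod.collapse)
    have "m mod 4 = 0 \<or> m mod 4 = 1 \<or> m mod 4 = 2 \<or> m mod 4 = 3" by linarith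
    then show ?thesis using that(6-9) 2 j ab unfolding code_defs by (metis add_0_right)
  qed
qed

lemma prog_of_simps:
  "prog_of 0 = PZero" "prog_of 1 = PSucc" "prog_of 2 = PFst" "prog_of 3 = PSnd" "prog_of 4 = POracle"
  "prog_of (code_pair a b) = PPair (prog_of a) (prog_of b)"
  "prog_of (code_comp a b) = PComp (prog_of a) (prog_of b)"
  "prog_of (code_rec a b) = PRec (prog_of a) (prog_of b)"
  "prog_of (code_mu a) = PMu (prog_of a)"
proof -
  have "2 = Suc (Suc 0)" "3 = Suc (Suc (Suc 0))" "4 = Suc (Suc (Suc (Suc 0)))" by simp_all
  with prog_of.simps(1-5) show "prog_of 0 = PZero" "prog_of 1 = PSucc" "prog_of 2 = PFst"
    "prog_of 3 = PSnd" "prog_of 4 = POracle" by (simp_all only: One_nat_def)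
  show "prog_of (code_pair a b) = PPair (prog_of a) (prog_of b)"
    unfolding code_defs prog_of_5 by simp
  show "prog_of (code_comp a b) = PComp (prog_of a) (prog_of b)"
    "prog_of (code_rec a b) = PRec (prog_of a) (prog_of b)"
    "prog_of (code_mu a) = PMu (prog_of a)"
    unfolding code_defs prog_of_5 four_div_mod by simp_all
qed

lemma mev_simps:
  "mev \<alpha> 0 n K = rt 0 K" "mev \<alpha> 1 n K = rt (Suc n) K" "mev \<alpha> 2 n K = rt (pfst n) K"
  "mev \<alpha> 3 n K = rt (psnd n) K" "mev \<alpha> 4 n K = rt (of_bool (\<alpha> n)) K"
  "mev \<alpha> (code_pair a b) n K = ev a n (push 0 b n 0 0 K)"
  "mev \<alpha> (code_comp a b) n K = ev b n (push 2 a 0 0 0 K)"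
  "mev \<alpha> (code_rec a b) n K = ev a (pfst n) (push 3 b (pfst n) 0 (psnd n) K)"
  "mev \<alpha> (code_mu a) n K = ev a (pe n 0) (push 4 a n 0 0 K)"
  unfolding mev_def code_defs diff_add_inverse four_div_mod by simp_all

lemma mret_simps:
  "mret v 0 a b c d K = ev a b (push 1 v 0 0 0 K)"
  "mret v 1 a b c d K = rt (pe a v) K"
  "mret v 2 a b c d K = ev a v K"
  "mret v 3 a b c d K = (if c = d then rt v K else ev a (pe b (pe c v)) (push 3 a b (Suc c) d K))"
  "mret v 4 a b c d K = (if v = 0 then rt c K else ev a (pe b (Suc c)) (push 4 a b (Suc c) 0 K))"
  by (simp_all add: mret_def)

section \<open>Correctness of the stack machine\<close>

definition reaches :: "(nat \<Rightarrow> bool) \<Rightarrow> nat \<Rightarrow> nat \<Rightarrow> bool" where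
  "reaches \<alpha> c c' \<longleftrightarrow> (\<exists>k. (mstep \<alpha> ^^ k) c = c')"

lemma reaches_refl: "reaches \<alpha> c c"
  unfolding reaches_def by (rule exI[of _ 0]) simp

lemma reaches_trans: "reaches \<alpha> a b \<Longrightarrow> reaches \<alpha> b c \<Longrightarrow> reaches \<alpha> a c"
  unfolding reaches_def by (metis funpow_add comp_apply)

lemma reaches_step: "reaches \<alpha> (mstep \<alpha> a) c \<Longrightarrow> reaches \<alpha> a c"
  unfolding reaches_def by (metis funpow_Suc_right comp_apply)

lemma reaches_ev: "reaches \<alpha> (mev \<alpha> e n K) c \<Longrightarrow> reaches \<alpha> (ev e n K) c"
  by (rule reaches_step) (simp add: mstep_ev)

lemma reaches_rt: "reaches \<alpha> (mret v t a b c d K) x \<Longrightarrow> reaches \<alpha> (rt v (push t a b c d K)) x"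
  by (rule reaches_step) (simp add: mstep_rt_push)

text \<open>The stack K is arbitrary so that the induction hypotheses apply to subprograms, which
  run on top of a pushed frame.\<close>

lemma machine_sound: "run \<alpha> (prog_of e) n = Some v \<Longrightarrow> reaches \<alpha> (ev e n K) (rt v K)"
proof (induction "prog_of e" arbitrary: e n v K)
  case PZero
  then show ?case by (cases e rule: prog_cases)
      (auto simp: prog_of_simps mev_simps simp del: One_nat_def intro!: reaches_ev reaches_refl)
next
  case PSucc
  then show ?case by (cases e rule: prog_cases)
      (auto simp: prog_of_simps mev_simps simp del: One_nat_def intro!: reaches_ev reaches_refl)
next
  case PFst
  then show ?case by (cases e rule: prog_cases)
      (auto simp: prog_of_simps mev_simps simp del: One_nat_def intro!: reaches_ev reaches_refl)
next
  case PSnd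
  then show ?case by (cases e rule: prog_cases)
      (auto simp: prog_of_simps mev_simps simp del: One_nat_def intro!: reaches_ev reaches_refl)
next
  case POracle
  then show ?case by (cases e rule: prog_cases)
      (auto simp: prog_of_simps mev_simps simp del: One_nat_def intro!: reaches_ev reaches_refl)
next
  case (PPair p1 p2)
  obtain a b where e: "e = code_pair a b" and p: "p1 = prog_of a" "p2 = prog_of b"
    using PPair.hyps(3) by (cases e rule: prog_cases) (auto simp: prog_of_simps simp del: One_nat_def)
  obtain x y where xy: "run \<alpha> (prog_of a) n = Some x" "run \<alpha> (prog_of b) n = Some y" "v = pe x y"
    using PPair.prems unfolding e prog_of_simps by (auto simp: bind_eq_Some_conv)
  show ?case unfolding e
    by (intro reaches_ev, unfold mev_simps, rule reaches_trans, rule PPair.hyps(1)[OF p(1) xy(1)],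
        rule reaches_rt, unfold mret_simps, rule reaches_trans, rule PPair.hyps(2)[OF p(2) xy(2)],
        rule reaches_rt, unfold mret_simps xy(3), rule reaches_refl)
next
  case (PComp p1 p2)
  obtain a b where e: "e = code_comp a b" and p: "p1 = prog_of a" "p2 = prog_of b"
    using PComp.hyps(3) by (cases e rule: prog_cases) (auto simp: prog_of_simps simp del: One_nat_def)
  obtain x where x: "run \<alpha> (prog_of b) n = Some x" "run \<alpha> (prog_of a) x = Some v"
    using PComp.prems unfolding e prog_of_simps by (auto simp: bind_eq_Some_conv)
  show ?case unfolding e
    by (intro reaches_ev, unfold mev_simps, rule reaches_trans, rule PComp.hyps(2)[OF p(2) x(1)],
        rule reaches_rt, unfold mret_simps, rule PComp.hyps(1)[OF p(1) x(2)])
next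
  case (PRec p1 p2)
  obtain a b where e: "e = code_rec a b" and p: "p1 = prog_of a" "p2 = prog_of b"
    using PRec.hyps(3) by (cases e rule: prog_cases) (auto simp: prog_of_simps simp del: One_nat_def)
  let ?f = "rec_nat (run \<alpha> (prog_of a) (pfst n))
       (\<lambda>i r. Option.bind r (\<lambda>y. run \<alpha> (prog_of b) (pe (pfst n) (pe i y))))"
  have f: "?f (psnd n) = Some v"
    using PRec.prems unfolding e prog_of_simps by (simp add: case_prod_beta)
  \<comment> \<open>Loop invariant: the value returned to the frame with counter i is the i-th value
    of the recursion.\<close>
  have loop: "\<exists>x. ?f 0 = Some x \<and>
      reaches \<alpha> (rt x (push 3 b (pfst n) 0 m K)) (rt w (push 3 b (pfst n) i m K))"
    if "?f i = Some w" "i \<le> m" for i w m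
    using that
  proof (induction i arbitrary: w)
    case 0
    then show ?case by (auto intro: reaches_refl)
  next
    case (Suc i)
    then obtain y where y: "?f i = Some y" "run \<alpha> (prog_of b) (pe (pfst n) (pe i y)) = Some w"
      by (auto simp: bind_eq_Some_conv)
    from Suc.IH[OF y(1)] Suc.prems(2) obtain x where x: "?f 0 = Some x"
      and r: "reaches \<alpha> (rt x (push 3 b (pfst n) 0 m K)) (rt y (push 3 b (pfst n) i m K))" by auto
    have "reaches \<alpha> (rt y (push 3 b (pfst n) i m K)) (rt w (push 3 b (pfst n) (Suc i) m K))"
      using Suc.prems(2) PRec.hyps(2)[OF p(2) y(2)] by (intro reaches_rt) (simp add: mret_simps)
    with x r show ?case by (blast intro: reaches_trans)
  qed
  from loop[OF f order_refl] obtain x where x: "run \<alpha> (prog_of a) (pfst n) = Some x"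
    and r: "reaches \<alpha> (rt x (push 3 b (pfst n) 0 (psnd n) K)) (rt v (push 3 b (pfst n) (psnd n) (psnd n) K))"
    by auto
  have "reaches \<alpha> (rt v (push 3 b (pfst n) (psnd n) (psnd n) K)) (rt v K)"
    by (intro reaches_rt) (simp add: mret_simps reaches_refl)
  with PRec.hyps(1)[OF p(1) x] r show ?case unfolding e
    by (intro reaches_ev, unfold mev_simps) (blast intro: reaches_trans)
next
  case (PMu p1)
  obtain a where e: "e = code_mu a" and p: "p1 = prog_of a"
    using PMu.hyps(2) by (cases e rule: prog_cases) (auto simp: prog_of_simps simp del: One_nat_def)
  let ?r = "\<lambda>k. run \<alpha> (prog_of a) (pe n k)"
  obtain k where k: "?r k = Some 0" "\<forall>j<k. ?r j \<noteq> None" and v: "v = (LEAST k. ?r k = Some 0)"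
    using PMu.prems unfolding e prog_of_simps by (auto split: if_splits)
  have v0: "?r v = Some 0" unfolding v by (rule LeastI[of _ k]) (rule k)
  \<comment> \<open>Below v the values are defined because v does not exceed k, and nonzero by
    minimality; so the machine moves on to the next candidate.\<close>
  have less: "?r j \<noteq> None \<and> ?r j \<noteq> Some 0" if "j < v" for j
  proof -
    have "v \<le> k" unfolding v by (rule Least_le) (rule k)
    then show ?thesis using k(2) not_less_Least[of j "\<lambda>k. ?r k = Some 0"] that unfolding v by auto
  qed
  have loop: "\<exists>y. ?r 0 = Some y \<and> reaches \<alpha> (rt y (push 4 a n 0 0 K)) (rt w (push 4 a n j 0 K))"
    if "?r j = Some w" "j \<le> v" for j w
    using that
  proof (induction j arbitrary: w)
    case 0
    then show ?case by (auto intro: reaches_refl)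
  next
    case (Suc j)
    then obtain u where u: "?r j = Some u" "u \<noteq> 0" using less[of j] by fastforce
    from Suc.IH[OF u(1)] Suc.prems(2) obtain y where y: "?r 0 = Some y"
      "reaches \<alpha> (rt y (push 4 a n 0 0 K)) (rt u (push 4 a n j 0 K))" by auto
    have "reaches \<alpha> (rt u (push 4 a n j 0 K)) (rt w (push 4 a n (Suc j) 0 K))"
      using u(2) PMu.hyps(1)[OF p Suc.prems(1)] by (intro reaches_rt) (simp add: mret_simps)
    with y show ?case by (blast intro: reaches_trans)
  qed
  from loop[OF v0 order_refl] obtain y where y: "?r 0 = Some y"
    "reaches \<alpha> (rt y (push 4 a n 0 0 K)) (rt 0 (push 4 a n v 0 K))" by auto
  have "reaches \<alpha> (rt 0 (push 4 a n v 0 K)) (rt v K)"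
    by (intro reaches_rt) (simp add: mret_simps reaches_refl)
  with PMu.hyps(1)[OF p y(1)] y(2) show ?case unfolding e
    by (intro reaches_ev, unfold mev_simps) (blast intro: reaches_trans)
qed


definition halts :: "(nat \<Rightarrow> bool) \<Rightarrow> nat \<Rightarrow> nat \<Rightarrow> bool" where
  "halts \<alpha> k c \<longleftrightarrow> (\<exists>v. (mstep \<alpha> ^^ k) c = rt v 0)"

lemma halts_mono: "halts \<alpha> j c \<Longrightarrow> j \<le> k \<Longrightarrow> halts \<alpha> k c"
proof -
  have "(mstep \<alpha> ^^ d) (rt v 0) = rt v 0" for d v by (induction d) (simp_all add: mstep_rt_0)
  then show "halts \<alpha> j c \<Longrightarrow> j \<le> k \<Longrightarrow> halts \<alpha> k c"
    unfolding halts_def by (metis funpow_add comp_apply le_add_diff_inverse2)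
qed

lemma rt_0_neq: "rt v (push t a b c d K) \<noteq> rt w 0" "ev e n K \<noteq> rt w K'"
  by (simp_all add: rt_def push_def ev_def)

lemma halts_ev: "halts \<alpha> k (ev e n K) \<Longrightarrow> \<exists>j<k. halts \<alpha> j (mev \<alpha> e n K)"
  unfolding halts_def by (cases k) (auto simp: rt_0_neq funpow_Suc_right mstep_ev simp del: funpow.simps(2))

lemma halts_rt: "halts \<alpha> k (rt v (push t a b c d K)) \<Longrightarrow> \<exists>j<k. halts \<alpha> j (mret v t a b c d K)"
  unfolding halts_def by (cases k) (auto simp: rt_0_neq funpow_Suc_right mstep_rt_push simp del: funpow.simps(2))

text \<open>Induction on the number of steps. That the value returns to K within the same bound k
  lets the rest of the computation, below the frame just popped, be treated by the same hypothesis.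
  That the machine returns the right value is left to \<open>machine_sound\<close> and
  determinism.\<close>

lemma machine_complete:
  "halts \<alpha> k (ev e n K) \<Longrightarrow> \<exists>w. run \<alpha> (prog_of e) n = Some w \<and> halts \<alpha> k (rt w K)"
proof (induction k arbitrary: e n K rule: less_induct)
  case (less k)
  from halts_ev[OF less.prems] obtain j where j: "j < k" "halts \<alpha> j (mev \<alpha> e n K)" by auto
  have basic: "\<exists>w. run \<alpha> (prog_of e) n = Some w \<and> halts \<alpha> k (rt w K)"
    if "run \<alpha> (prog_of e) n = Some w" "mev \<alpha> e n K = rt w K" for w
    using that j halts_mono[OF j(2), of k] by auto
  show ?case
  proof (cases e rule: prog_cases)
    case (Pair a b)
    obtain x where x: "run \<alpha> (prog_of a) n = Some x" "halts \<alpha> j (rt x (push 0 b n 0 0 K))"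
      using less.IH[OF j(1)] j(2) unfolding Pair mev_simps by blast
    obtain i where i: "i < j" "halts \<alpha> i (ev b n (push 1 x 0 0 0 K))"
      using halts_rt[OF x(2)] unfolding mret_simps by auto
    have ik: "i < k" using i j by simp
    obtain y where y: "run \<alpha> (prog_of b) n = Some y" "halts \<alpha> i (rt y (push 1 x 0 0 0 K))"
      using less.IH[OF ik i(2)] by blast
    obtain l where l: "l < i" "halts \<alpha> l (rt (pe x y) K)"
      using halts_rt[OF y(2)] unfolding mret_simps by auto
    show ?thesis using x(1) y(1) halts_mono[OF l(2), of k] l(1) ik by (simp add: Pair prog_of_simps)
  next
    case (Comp a b)
    obtain x where x: "run \<alpha> (prog_of b) n = Some x" "halts \<alpha> j (rt x (push 2 a 0 0 0 K))"
      using less.IH[OF j(1)] j(2) unfolding Comp mev_simps by blast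
    obtain i where i: "i < j" "halts \<alpha> i (ev a x K)"
      using halts_rt[OF x(2)] unfolding mret_simps by auto
    have ik: "i < k" using i j by simp
    obtain y where y: "run \<alpha> (prog_of a) x = Some y" "halts \<alpha> i (rt y K)"
      using less.IH[OF ik i(2)] by blast
    show ?thesis using x(1) y(1) halts_mono[OF y(2), of k] ik by (simp add: Comp prog_of_simps)
  next
    case (Rec a b)
    let ?f = "rec_nat (run \<alpha> (prog_of a) (pfst n))
       (\<lambda>i r. Option.bind r (\<lambda>y. run \<alpha> (prog_of b) (pe (pfst n) (pe i y))))"
    \<comment> \<open>Inner induction on the number l of remaining steps: the outer hypothesis
      evaluates the loop body, the inner one continues from the next counter.\<close>
    have loop: "\<exists>w. ?f (psnd n) = Some w \<and> halts \<alpha> k (rt w K)"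
      if "l < k" "halts \<alpha> l (rt r (push 3 b (pfst n) i (psnd n) K))" "?f i = Some r" "i \<le> psnd n" for l r i
      using that
    proof (induction l arbitrary: r i rule: less_induct)
      case (less l)
      from halts_rt[OF less.prems(2)] obtain l' where l': "l' < l"
        "halts \<alpha> l' (mret r 3 b (pfst n) i (psnd n) K)" by auto
      have l'k: "l' < k" using l' less.prems(1) by simp
      show ?case
      proof (cases "i = psnd n")
        case True
        then show ?thesis using l' less.prems(3) halts_mono[OF l'(2), of k] l'k by (auto simp: mret_simps)
      next
        case False
        then have "halts \<alpha> l' (ev b (pe (pfst n) (pe i r)) (push 3 b (pfst n) (Suc i) (psnd n) K))"
          using l'(2) by (simp add: mret_simps)
        from \<open>\<And>y e n K. y < k \<Longrightarrow> halts \<alpha> y (ev e n K) \<Longrightarrow> _\<close>[OF l'k this] obtain w where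
          w: "run \<alpha> (prog_of b) (pe (pfst n) (pe i r)) = Some w"
            "halts \<alpha> l' (rt w (push 3 b (pfst n) (Suc i) (psnd n) K))" by auto
        show ?thesis using less.IH[OF l'(1) l'k w(2)] w(1) less.prems(3,4) False by simp
      qed
    qed
    obtain x where x: "run \<alpha> (prog_of a) (pfst n) = Some x" "halts \<alpha> j (rt x (push 3 b (pfst n) 0 (psnd n) K))"
      using less.IH[OF j(1)] j(2) unfolding Rec mev_simps by blast
    show ?thesis using loop[OF j(1) x(2)] x(1) by (simp add: Rec prog_of_simps case_prod_beta)
  next
    case (Mu a)
    let ?r = "\<lambda>k. run \<alpha> (prog_of a) (pe n k)"
    have loop: "\<exists>w. run \<alpha> (prog_of e) n = Some w \<and> halts \<alpha> k (rt w K)"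
      if "l < k" "halts \<alpha> l (rt r (push 4 a n i 0 K))" "?r i = Some r" "\<forall>i'<i. \<exists>x. ?r i' = Some (Suc x)" for l r i
      using that
    proof (induction l arbitrary: r i rule: less_induct)
      case (less l)
      from halts_rt[OF less.prems(2)] obtain l' where l': "l' < l" "halts \<alpha> l' (mret r 4 a n i 0 K)" by auto
      have l'k: "l' < k" using l' less.prems(1) by simp
      show ?case
      proof (cases "r = 0")
        case True
        have "(LEAST k. ?r k = Some 0) = i"
          using less.prems(3,4) True by (intro Least_equality) (auto simp: not_less[symmetric])
        moreover have "\<exists>k. ?r k = Some 0 \<and> (\<forall>j<k. ?r j \<noteq> None)"
          using less.prems(3,4) True by (intro exI[of _ i]) fastforce
        ultimately have "run \<alpha> (prog_of e) n = Some i" by (simp add: Mu prog_of_simps)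
        then show ?thesis using l' True halts_mono[OF l'(2), of k] l'k by (simp add: mret_simps)
      next
        case False
        then have "halts \<alpha> l' (ev a (pe n (Suc i)) (push 4 a n (Suc i) 0 K))"
          using l'(2) by (simp add: mret_simps)
        from \<open>\<And>y e n K. y < k \<Longrightarrow> halts \<alpha> y (ev e n K) \<Longrightarrow> _\<close>[OF l'k this] obtain w where
          w: "?r (Suc i) = Some w" "halts \<alpha> l' (rt w (push 4 a n (Suc i) 0 K))" by auto
        have "\<forall>i'<Suc i. \<exists>x. ?r i' = Some (Suc x)"
          using less.prems(3,4) False by (auto simp: less_Suc_eq gr0_conv_Suc)
        then show ?thesis using less.IH[OF l'(1) l'k w(2,1)] by simp
      qed
    qed
    obtain x where x: "?r 0 = Some x" "halts \<alpha> j (rt x (push 4 a n 0 0 K))"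
      using less.IH[OF j(1)] j(2) unfolding Mu mev_simps by blast
    show ?thesis using loop[OF j(1) x(2,1)] by simp
  qed (use basic in \<open>simp_all add: prog_of_simps mev_simps del: One_nat_def\<close>)
qed

text \<open>A test on the components of the state is decidable, as the search for the halting time
  requires.\<close>

lemma halts_iff: "halts \<alpha> k c \<longleftrightarrow> psnd ((mstep \<alpha> ^^ k) c) = 0 \<and> pfst (pfst ((mstep \<alpha> ^^ k) c)) = 1"
  unfolding halts_def rt_def by (metis fst_conv snd_conv prod.collapse prod_decode_inverse prod_encode_inverse)

lemma universal: "pcomp (\<lambda>\<alpha> z. phi \<alpha> (pfst z) (psnd z))"
proof -
  define F where "F = (\<lambda>\<alpha> z. Option.bind
     (if \<exists>k. halts \<alpha> k (ev (pfst z) (psnd z) 0)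
      then Some (LEAST k. halts \<alpha> k (ev (pfst z) (psnd z) 0)) else None)
     (\<lambda>k. Some (psnd (pfst ((mstep \<alpha> ^^ k) (ev (pfst z) (psnd z) 0))))))"
  have "pcomp F" unfolding F_def halts_iff ev_def
    by (intro pcomp_bind pcomp_mu pcomp_Some tcomp_intros tcomp_funpow tcomp_mstep)
  moreover have "phi \<alpha> (pfst z) (psnd z) = F \<alpha> z" for \<alpha> z
  proof (cases "\<exists>k. halts \<alpha> k (ev (pfst z) (psnd z) 0)")
    case True
    define k where "k = (LEAST k. halts \<alpha> k (ev (pfst z) (psnd z) 0))"
    have k: "halts \<alpha> k (ev (pfst z) (psnd z) 0)" unfolding k_def using True by (rule LeastI_ex)
    from machine_complete[OF this] obtain w where w: "phi \<alpha> (pfst z) (psnd z) = Some w" by (auto simp: phi_def)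
    obtain v where v: "(mstep \<alpha> ^^ k) (ev (pfst z) (psnd z) 0) = rt v 0" using k by (auto simp: halts_def)
    from machine_sound[of \<alpha> _ _ w 0] w obtain m where
      m: "(mstep \<alpha> ^^ m) (ev (pfst z) (psnd z) 0) = rt w 0" by (auto simp: phi_def reaches_def)
    have stay: "(mstep \<alpha> ^^ d) (rt v 0) = rt v 0" for d v by (induction d) (simp_all add: mstep_rt_0)
    \<comment> \<open>Halted states are fixed by \<open>mstep\<close>, so the state after m + k
      steps is both \<open>rt v 0\<close> and \<open>rt w 0\<close>.\<close>
    have "(mstep \<alpha> ^^ (m + k)) (ev (pfst z) (psnd z) 0) = rt v 0"
      unfolding funpow_add comp_apply v stay ..
    moreover have "(mstep \<alpha> ^^ (k + m)) (ev (pfst z) (psnd z) 0) = rt w 0"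
      unfolding funpow_add comp_apply m stay ..
    ultimately have "v = w" by (simp add: add.commute rt_def)
    with w v True show ?thesis by (simp add: F_def k_def[symmetric] rt_def)
  next
    case False
    have "phi \<alpha> (pfst z) (psnd z) = None"
    proof (rule ccontr)
      assume "phi \<alpha> (pfst z) (psnd z) \<noteq> None"
      then obtain w where "run \<alpha> (prog_of (pfst z)) (psnd z) = Some w" by (auto simp: phi_def)
      from machine_sound[OF this, of 0] False show False by (auto simp: reaches_def halts_def)
    qed
    with False show ?thesis by (simp add: F_def)
  qed
  ultimately show ?thesis by (simp only:)
qed

lemma pcomp_phi: "tcomp f \<Longrightarrow> tcomp g \<Longrightarrow> pcomp (\<lambda>\<alpha> n. phi \<alpha> (f \<alpha> n) (g \<alpha> n))"
  using pcomp_comp[OF universal tcomp_pe[of f g]] by simp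

section \<open>Parametrization and the recursion theorem\<close>

lemma surj_prog_of: "\<exists>e. prog_of e = P"
proof (induction P)
  case (PPair P1 P2) then show ?case by (metis prog_of_simps(6))
next
  case (PComp P1 P2) then show ?case by (metis prog_of_simps(7))
next
  case (PRec P1 P2) then show ?case by (metis prog_of_simps(8))
next
  case (PMu P) then show ?case by (metis prog_of_simps(9))
qed (metis prog_of_simps)+

lemma pcomp_index: "pcomp F \<Longrightarrow> \<exists>e. \<forall>\<alpha> n. phi \<alpha> e n = F \<alpha> n"
  unfolding pcomp_def phi_def using surj_prog_of by metis

text \<open>0 and 1 are the codes of \<open>PZero\<close> and \<open>PSucc\<close>. The code itself
  is computable in n, which \<open>curry_index\<close> relies on.\<close>

definition code_const :: "nat \<Rightarrow> nat" where
  "code_const n = rec_nat 0 (\<lambda>i r. code_comp 1 r) n"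

lemma phi_code_const: "phi \<alpha> (code_const n) x = Some n"
  by (induction n) (simp_all add: code_const_def phi_def prog_of_simps del: One_nat_def)

text \<open>The s-m-n function. As 2 and 3 are the codes of \<open>PFst\<close> and
  \<open>PSnd\<close>, \<open>code_pair 2 3\<close> computes the identity.\<close>

definition curry_index :: "nat \<Rightarrow> nat \<Rightarrow> nat" where
  "curry_index e a = code_comp e (code_pair (code_const a) (code_pair 2 3))"

lemma phi_curry_index: "phi \<alpha> (curry_index e a) x = phi \<alpha> e (pe a x)"
  using phi_code_const[of \<alpha> a] by (simp add: curry_index_def phi_def prog_of_simps)

lemma tcomp_curry_index: "tcomp f \<Longrightarrow> tcomp g \<Longrightarrow> tcomp (\<lambda>\<alpha> n. curry_index (f \<alpha> n) (g \<alpha> n))"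
  unfolding curry_index_def code_const_def code_defs by (intro tcomp_intros tcomp_rec)

text \<open>Kleene's theorem with a parameter a. The program e finds its own code e in its argument
  and rebuilds from it \<open>curry_index e (pe e a)\<close>, which is \<open>h a\<close>. The
  function h does not consult the oracle.\<close>

theorem recursion_theorem:
  assumes "pcomp F"
  obtains h where "tcomp (\<lambda>_. h)" "\<And>\<alpha> a x. phi \<alpha> (h a) x = F \<alpha> (pe (pe (h a) a) x)"
proof -
  have "pcomp (\<lambda>\<alpha> z. F \<alpha> (pe (pe (curry_index (pfst (pfst z)) (pfst z)) (psnd (pfst z))) (psnd z)))"
    by (intro pcomp_comp[OF assms] tcomp_basic tcomp_curry_index)
  from pcomp_index[OF this] obtain e where e: "\<And>\<alpha> z. phi \<alpha> e z =
     F \<alpha> (pe (pe (curry_index (pfst (pfst z)) (pfst z)) (psnd (pfst z))) (psnd z))" by auto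
  show thesis
    by (rule that[of "\<lambda>a. curry_index e (pe e a)"])
      (simp_all add: phi_curry_index e tcomp_curry_index tcomp_basic)
qed

section \<open>The ppca of a set of oracles\<close>

definition oracle_ppca :: "(nat \<Rightarrow> bool) set \<Rightarrow> (nat, nat \<Rightarrow> bool) ppca" where
  "oracle_ppca M = \<lparr>params = M, app = phi\<rparr>"

lemma oracle_ppca_simps [simp]: "params (oracle_ppca M) = M" "app (oracle_ppca M) = phi"
  by (simp_all add: oracle_ppca_def)

text \<open>The s-m-n function is computed without consulting the oracle; this gives the
  independence of the parameter for \<open>s a\<close> and \<open>s a b\<close>, and
  \<open>code_const\<close> does the same for \<open>k a\<close>.\<close>

lemma ppca_combinators_oracle_ppca: "\<exists>k s. ppca_combinators (oracle_ppca M) k s"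
proof -
  have "pcomp (\<lambda>\<alpha> n. Some (code_const n))"
    unfolding code_const_def code_defs by (intro pcomp_Some tcomp_intros tcomp_rec)
  from pcomp_index[OF this] obtain k where k: "\<And>\<alpha> n. phi \<alpha> k n = Some (code_const n)" by auto
  have "pcomp (\<lambda>\<alpha> z. Option.bind (phi \<alpha> (pfst (pfst z)) (psnd z))
     (\<lambda>u. Option.bind (phi \<alpha> (psnd (pfst z)) (psnd z)) (\<lambda>v. phi \<alpha> u v)))"
    by (intro pcomp_bind pcomp_phi tcomp_basic)
  from pcomp_index[OF this] obtain e where e: "\<And>\<alpha> z. phi \<alpha> e z =
     Option.bind (phi \<alpha> (pfst (pfst z)) (psnd z))
     (\<lambda>u. Option.bind (phi \<alpha> (psnd (pfst z)) (psnd z)) (\<lambda>v. phi \<alpha> u v))" by auto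
  have "pcomp (\<lambda>\<alpha> z. Some (curry_index e z))"
    by (intro pcomp_Some tcomp_curry_index tcomp_basic)
  from pcomp_index[OF this] obtain e' where e': "\<And>\<alpha> z. phi \<alpha> e' z = Some (curry_index e z)" by auto
  have "pcomp (\<lambda>\<alpha> z. Some (curry_index e' z))"
    by (intro pcomp_Some tcomp_curry_index tcomp_basic)
  from pcomp_index[OF this] obtain s where s: "\<And>\<alpha> z. phi \<alpha> s z = Some (curry_index e' z)" by auto
  have "ppca_combinators (oracle_ppca M) k s"
    by (simp add: ppca_combinators_def k s e' e phi_code_const phi_curry_index eapp_def)
  then show ?thesis by blast
qed

text \<open>Contexts of entailments are combined by raw codes, on which programs act directly, instead
  of the pairs and booleans obtained from \<open>k\<close> and \<open>s\<close>.\<close>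

definition tensor :: "nat set \<Rightarrow> nat set \<Rightarrow> nat set" (infixr "\<otimes>" 61) where
  "A \<otimes> B = {pe a b | a b. a \<in> A \<and> b \<in> B}"

definition tagged :: "nat set \<Rightarrow> nat set \<Rightarrow> nat set" (infixr "\<oplus>" 60) where
  "A \<oplus> B = {pe 0 a | a. a \<in> A} \<union> {pe 1 b | b. b \<in> B}"

locale oracle_set =
  fixes M :: "(nat \<Rightarrow> bool) set"
  assumes nonempty: "M \<noteq> {}"
begin

abbreviation T where "T \<equiv> oracle_ppca M"

abbreviation (input) ent :: "('x \<Rightarrow> nat set) \<Rightarrow> ('x \<Rightarrow> nat set) \<Rightarrow> bool" (infix "\<tturnstile>" 50) where
  "\<Phi> \<tturnstile> \<Psi> \<equiv> entails T \<Phi> \<Psi>"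

subsection \<open>Pairs and booleans\<close>

lemma combs: "ppca_combinators T (comb_k T) (comb_s T)"
proof -
  have "\<exists>s. ppca_combinators T (comb_k T) s"
    unfolding comb_k_def by (rule someI_ex) (rule ppca_combinators_oracle_ppca)
  then show ?thesis unfolding comb_s_def by (rule someI_ex)
qed

lemma combs_at:
  assumes "\<alpha> \<in> M" "\<beta> \<in> M"
  shows "phi \<alpha> (comb_k T) a \<noteq> None" "phi \<alpha> (comb_k T) a = phi \<beta> (comb_k T) a"
    "eapp T \<alpha> (phi \<alpha> (comb_k T) a) (Some b) = Some a"
    "phi \<alpha> (comb_s T) a \<noteq> None"
    "eapp T \<alpha> (phi \<alpha> (comb_s T) a) (Some b) \<noteq> None"
    "eapp T \<alpha> (phi \<alpha> (comb_s T) a) (Some b) = eapp T \<beta> (phi \<beta> (comb_s T) a) (Some b)"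
    "eapp T \<alpha> (eapp T \<alpha> (phi \<alpha> (comb_s T) a) (Some b)) (Some x)
       = eapp T \<alpha> (phi \<alpha> a x) (phi \<alpha> b x)"
  using combs assms unfolding ppca_combinators_def oracle_ppca_simps by blast+

context
  fixes \<alpha> assumes \<alpha>: "\<alpha> \<in> M"
begin

lemma k_app: "\<exists>c. phi \<alpha> (comb_k T) a = Some c \<and> (\<forall>b. phi \<alpha> c b = Some a)"
proof -
  have "phi \<alpha> (comb_k T) a \<noteq> None" "\<forall>b. eapp T \<alpha> (phi \<alpha> (comb_k T) a) (Some b) = Some a"
    using combs_at(1,3)[OF \<alpha> \<alpha>] by blast+
  then show ?thesis by (auto simp: eapp_def)
qed

lemma s_app: "\<exists>c d. phi \<alpha> (comb_s T) a = Some c \<and> phi \<alpha> c b = Some d \<and>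
   (\<forall>x. phi \<alpha> d x = Option.bind (phi \<alpha> a x) (\<lambda>u. Option.bind (phi \<alpha> b x) (phi \<alpha> u)))"
proof -
  have "phi \<alpha> (comb_s T) a \<noteq> None" "eapp T \<alpha> (phi \<alpha> (comb_s T) a) (Some b) \<noteq> None"
    "\<forall>x. eapp T \<alpha> (eapp T \<alpha> (phi \<alpha> (comb_s T) a) (Some b)) (Some x) = eapp T \<alpha> (phi \<alpha> a x) (phi \<alpha> b x)"
    using combs_at(4,5,7)[OF \<alpha> \<alpha>] by blast+
  then show ?thesis by (auto simp: eapp_def)
qed

lemma ek_Some: "\<exists>c. ek T \<alpha> (Some a) = Some c \<and> (\<forall>b. phi \<alpha> c b = Some a)"
  using k_app[of a] by (simp add: ek_def eapp_def)

lemma es_Some: "\<exists>d. es T \<alpha> (Some a) (Some b) = Some d \<and>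
   (\<forall>x. phi \<alpha> d x = Option.bind (phi \<alpha> a x) (\<lambda>u. Option.bind (phi \<alpha> b x) (phi \<alpha> u)))"
  using s_app[of a b] by (auto simp: es_def eapp_def)

lemma ei_Some: "\<exists>i. ei T \<alpha> = Some i \<and> (\<forall>x. phi \<alpha> i x = Some x)"
proof -
  obtain d where d: "ei T \<alpha> = Some d"
    "\<And>x. phi \<alpha> d x = Option.bind (phi \<alpha> (comb_k T) x) (\<lambda>u. Option.bind (phi \<alpha> (comb_k T) x) (phi \<alpha> u))"
    using es_Some[of "comb_k T" "comb_k T"] by (auto simp: ei_def)
  have "phi \<alpha> d x = Some x" for x using k_app[of x] d(2)[of x] by auto
  with d(1) show ?thesis by blast
qed

lemma false_Some: "\<exists>f. ek T \<alpha> (ei T \<alpha>) = Some f \<and>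
  (\<forall>b. \<exists>i. phi \<alpha> f b = Some i \<and> (\<forall>x. phi \<alpha> i x = Some x))"
  using ei_Some ek_Some by force

lemma pair_Some: "\<exists>c. es T \<alpha> (es T \<alpha> (ei T \<alpha>) (ek T \<alpha> (Some a))) (ek T \<alpha> (Some b)) = Some c \<and>
  (\<forall>z. phi \<alpha> c z = Option.bind (phi \<alpha> z a) (\<lambda>u. phi \<alpha> u b))"
proof -
  obtain i where i: "ei T \<alpha> = Some i" "\<And>x. phi \<alpha> i x = Some x" using ei_Some by blast
  obtain u where u: "ek T \<alpha> (Some a) = Some u" "\<And>x. phi \<alpha> u x = Some a" using ek_Some by blast
  obtain v where v: "ek T \<alpha> (Some b) = Some v" "\<And>x. phi \<alpha> v x = Some b" using ek_Some by blast
  obtain d where d: "es T \<alpha> (Some i) (Some u) = Some d" "\<And>x. phi \<alpha> d x = phi \<alpha> x a"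
    using es_Some[of i u] i u by auto
  show ?thesis using es_Some[of d v] d v i(1) u(1) by auto
qed

end

lemma combs_param:
  assumes "\<alpha> \<in> M" "\<beta> \<in> M"
  shows "ek T \<alpha> u = ek T \<beta> u" "es T \<alpha> u v = es T \<beta> u v" "ei T \<alpha> = ei T \<beta>"
proof -
  show k: "ek T \<alpha> u = ek T \<beta> u" for u
    using combs_at(2)[OF assms] by (cases u) (auto simp: ek_def eapp_def)
  show s: "es T \<alpha> u v = es T \<beta> u v" for u v
  proof (cases "u = None \<or> v = None")
    case False
    then obtain a b where "u = Some a" "v = Some b" by auto
    then show ?thesis using combs_at(6)[OF assms, of a b]
      by (simp add: es_def eapp_def[of _ _ "Some _" "Some _"])
  qed (auto simp: es_def eapp_def)
  show "ei T \<alpha> = ei T \<beta>" unfolding ei_def by (rule s)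
qed

definition ppair :: "nat \<Rightarrow> nat \<Rightarrow> nat" where "ppair a b = (THE c. is_pair T a b c)"
definition pfalse :: nat where "pfalse = (THE c. is_false T c)"
abbreviation ptrue :: nat where "ptrue \<equiv> comb_k T"

text \<open>Since pairing does not depend on the parameter and \<open>M\<close> is inhabited, the
  relation \<open>is_pair\<close> is the graph of a function.\<close>

lemma is_pair_eq: "is_pair T a b c \<longleftrightarrow> c = ppair a b"
  and ppair_eq: "\<alpha> \<in> M \<Longrightarrow> es T \<alpha> (es T \<alpha> (ei T \<alpha>) (ek T \<alpha> (Some a))) (ek T \<alpha> (Some b)) = Some (ppair a b)"
proof -
  obtain \<beta> where \<beta>: "\<beta> \<in> M" using nonempty by auto
  from pair_Some[OF this, of a b] obtain c where
    c: "es T \<beta> (es T \<beta> (ei T \<beta>) (ek T \<beta> (Some a))) (ek T \<beta> (Some b)) = Some c" by auto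
  have "es T \<gamma> (es T \<gamma> (ei T \<gamma>) (ek T \<gamma> (Some a))) (ek T \<gamma> (Some b)) = Some c" if "\<gamma> \<in> M" for \<gamma>
    unfolding combs_param[OF that \<beta>] by (rule c)
  then have *: "is_pair T a b d \<longleftrightarrow> d = c" for d
    unfolding is_pair_def using \<beta> by auto
  then have "ppair a b = c" by (simp add: ppair_def)
  with * show "is_pair T a b d \<longleftrightarrow> d = ppair a b" for d by simp
  then have "is_pair T a b (ppair a b)" by simp
  then show "\<alpha> \<in> M \<Longrightarrow> es T \<alpha> (es T \<alpha> (ei T \<alpha>) (ek T \<alpha> (Some a))) (ek T \<alpha> (Some b)) = Some (ppair a b)"
    by (simp add: is_pair_def)
qed

lemma is_false_eq: "is_false T c \<longleftrightarrow> c = pfalse"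
  and pfalse_eq: "\<alpha> \<in> M \<Longrightarrow> ek T \<alpha> (ei T \<alpha>) = Some pfalse"
proof -
  obtain \<beta> where \<beta>: "\<beta> \<in> M" using nonempty by auto
  from false_Some[OF this] obtain c where c: "ek T \<beta> (ei T \<beta>) = Some c" by auto
  have "ek T \<gamma> (ei T \<gamma>) = Some c" if "\<gamma> \<in> M" for \<gamma>
    unfolding combs_param[OF that \<beta>] by (rule c)
  then have *: "is_false T d \<longleftrightarrow> d = c" for d
    unfolding is_false_def using \<beta> by auto
  then have "pfalse = c" by (simp add: pfalse_def)
  with * show "is_false T d \<longleftrightarrow> d = pfalse" for d by simp
  then have "is_false T pfalse" by simp
  then show "\<alpha> \<in> M \<Longrightarrow> ek T \<alpha> (ei T \<alpha>) = Some pfalse" by (simp add: is_false_def)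
qed

lemma pair_proj:
  assumes "\<alpha> \<in> M"
  shows "phi \<alpha> (ppair a b) ptrue = Some a" "phi \<alpha> (ppair a b) pfalse = Some b"
proof -
  have *: "phi \<alpha> (ppair a b) z = Option.bind (phi \<alpha> z a) (\<lambda>u. phi \<alpha> u b)" for z
    using pair_Some[OF assms, of a b] ppair_eq[OF assms, of a b] by auto
  show "phi \<alpha> (ppair a b) ptrue = Some a" using k_app[OF assms, of a] by (auto simp: *)
  show "phi \<alpha> (ppair a b) pfalse = Some b"
  proof -
    from false_Some[OF assms] pfalse_eq[OF assms] obtain i where
      "phi \<alpha> pfalse a = Some i" "\<forall>x. phi \<alpha> i x = Some x" by auto
    then show ?thesis by (simp add: *)
  qed
qed

text \<open>Otherwise the two projections of \<open>ppair 0 1\<close> would agree. This is what lets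
  a program read the tag of a disjunction in \<open>disj_tagged\<close>.\<close>

lemma ptrue_neq_pfalse: "ptrue \<noteq> pfalse"
proof
  assume eq: "ptrue = pfalse"
  obtain \<beta> where \<beta>: "\<beta> \<in> M" using nonempty by auto
  show False using pair_proj[OF \<beta>, of 0 1] eq by simp
qed

text \<open>The chosen k and s are fixed numbers, so pairing is computed by applying them through
  the universal program. For oracles outside \<open>M\<close> nothing is known about these
  applications.\<close>

lemma pcomp_ppair: "\<exists>F. pcomp F \<and> (\<forall>\<alpha>\<in>M. \<forall>a b. F \<alpha> (pe a b) = Some (ppair a b))"
proof -
  define F where "F = (\<lambda>\<alpha> z. es T \<alpha> (es T \<alpha> (ei T \<alpha>) (ek T \<alpha> (Some (pfst z)))) (ek T \<alpha> (Some (psnd z))))"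
  have "pcomp F" unfolding F_def es_def ek_def ei_def eapp_def oracle_ppca_simps
    by (intro pcomp_bind pcomp_phi pcomp_Some tcomp_basic)
  then show ?thesis using ppair_eq by (auto simp: F_def)
qed

lemma tconj_eq: "A \<^bold>\<and>\<^bsub>T\<^esub> B = {ppair a b | a b. a \<in> A \<and> b \<in> B}"
  by (auto simp: tconj_def is_pair_eq)

lemma tdisj_eq: "A \<^bold>\<or>\<^bsub>T\<^esub> B = {ppair ptrue a | a. a \<in> A} \<union> {ppair pfalse b | b. b \<in> B}"
  by (auto simp: tdisj_def is_pair_eq is_true_def is_false_eq)

subsection \<open>Rules of entailment\<close>

lemma entI:
  assumes "pcomp F" "\<And>x b \<alpha>. b \<in> \<Phi> x \<Longrightarrow> \<alpha> \<in> M \<Longrightarrow> \<exists>c\<in>\<Psi> x. F \<alpha> b = Some c"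
  shows "\<Phi> \<tturnstile> \<Psi>"
proof -
  obtain e where "\<And>\<alpha> n. phi \<alpha> e n = F \<alpha> n" using pcomp_index[OF assms(1)] by blast
  with assms(2) have "\<forall>x. \<forall>b\<in>\<Phi> x. \<forall>p\<in>M. \<exists>c\<in>\<Psi> x. phi p e b = Some c" by simp
  then show ?thesis unfolding entails_def oracle_ppca_simps by blast
qed

lemma entD:
  assumes "\<Phi> \<tturnstile> \<Psi>"
  obtains F where "pcomp F" "\<And>x b \<alpha>. b \<in> \<Phi> x \<Longrightarrow> \<alpha> \<in> M \<Longrightarrow> \<exists>c\<in>\<Psi> x. F \<alpha> b = Some c"
proof -
  obtain e where e: "\<And>x b \<alpha>. b \<in> \<Phi> x \<Longrightarrow> \<alpha> \<in> M \<Longrightarrow> \<exists>c\<in>\<Psi> x. phi \<alpha> e b = Some c"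
    using assms unfolding entails_def oracle_ppca_simps by blast
  have "pcomp (\<lambda>\<alpha> n. phi \<alpha> e n)" by (intro pcomp_phi tcomp_basic)
  with e show thesis by (rule that[rotated])
qed

lemma ent_mono: "(\<And>x. \<Phi> x \<subseteq> \<Psi> x) \<Longrightarrow> \<Phi> \<tturnstile> \<Psi>"
  by (rule entI[OF pcomp_Some[OF tcomp_id]]) auto

lemma ent_refl: "\<Phi> \<tturnstile> \<Phi>"
  by (rule ent_mono) simp

lemma ent_const: "(\<And>x. \<Phi> x \<noteq> {} \<Longrightarrow> c \<in> \<Psi> x) \<Longrightarrow> \<Phi> \<tturnstile> \<Psi>"
  by (rule entI[OF pcomp_Some[OF tcomp_const[of c]]]) auto

lemma ent_trans [trans]: "\<Phi> \<tturnstile> \<Psi> \<Longrightarrow> \<Psi> \<tturnstile> \<Xi> \<Longrightarrow> \<Phi> \<tturnstile> \<Xi>"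
proof -
  assume "\<Phi> \<tturnstile> \<Psi>" "\<Psi> \<tturnstile> \<Xi>"
  then obtain F G where F: "pcomp F" "\<And>x b \<alpha>. b \<in> \<Phi> x \<Longrightarrow> \<alpha> \<in> M \<Longrightarrow> \<exists>c\<in>\<Psi> x. F \<alpha> b = Some c"
    and G: "pcomp G" "\<And>x b \<alpha>. b \<in> \<Psi> x \<Longrightarrow> \<alpha> \<in> M \<Longrightarrow> \<exists>c\<in>\<Xi> x. G \<alpha> b = Some c" by (elim entD) blast
  have "pcomp (\<lambda>\<alpha> n. Option.bind (F \<alpha> n) (\<lambda>y. G \<alpha> y))"
    by (intro pcomp_bind F pcomp_comp[OF G(1)] tcomp_basic)
  then show "\<Phi> \<tturnstile> \<Xi>" by (rule entI) (use F(2) G(2) in fastforce)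
qed

lemma ent_subst: "\<Phi> \<tturnstile> \<Psi> \<Longrightarrow> (\<lambda>z. \<Phi> (f z)) \<tturnstile> (\<lambda>z. \<Psi> (f z))"
  unfolding entails_def by blast

lemma ent_tensor: "\<Phi> \<tturnstile> \<Psi> \<Longrightarrow> \<Phi> \<tturnstile> \<Xi> \<Longrightarrow> \<Phi> \<tturnstile> (\<lambda>x. \<Psi> x \<otimes> \<Xi> x)"
proof -
  assume "\<Phi> \<tturnstile> \<Psi>" "\<Phi> \<tturnstile> \<Xi>"
  then obtain F G where F: "pcomp F" "\<And>x b \<alpha>. b \<in> \<Phi> x \<Longrightarrow> \<alpha> \<in> M \<Longrightarrow> \<exists>c\<in>\<Psi> x. F \<alpha> b = Some c"
    and G: "pcomp G" "\<And>x b \<alpha>. b \<in> \<Phi> x \<Longrightarrow> \<alpha> \<in> M \<Longrightarrow> \<exists>c\<in>\<Xi> x. G \<alpha> b = Some c" by (elim entD) blast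
  have "pcomp (\<lambda>\<alpha> n. Option.bind (F \<alpha> n) (\<lambda>y. Option.bind (G \<alpha> n) (\<lambda>z. Some (pe y z))))"
    by (intro pcomp_bind pcomp_Some F pcomp_comp[OF G(1)] tcomp_basic)
  then show ?thesis by (rule entI) (use F(2) G(2) in \<open>fastforce simp: tensor_def\<close>)
qed

lemma ent_fst: "(\<lambda>x. \<Phi> x \<otimes> \<Psi> x) \<tturnstile> \<Phi>"
  by (rule entI[OF pcomp_Some[OF tcomp_pfst[OF tcomp_id]]]) (auto simp: tensor_def)

lemma ent_snd: "(\<lambda>x. \<Phi> x \<otimes> \<Psi> x) \<tturnstile> \<Psi>"
  by (rule entI[OF pcomp_Some[OF tcomp_psnd[OF tcomp_id]]]) (auto simp: tensor_def)

lemma ent_weak1: "\<Phi> \<tturnstile> \<Xi> \<Longrightarrow> (\<lambda>x. \<Phi> x \<otimes> \<Psi> x) \<tturnstile> \<Xi>"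
  by (rule ent_trans[OF ent_fst])

lemma ent_weak2: "\<Psi> \<tturnstile> \<Xi> \<Longrightarrow> (\<lambda>x. \<Phi> x \<otimes> \<Psi> x) \<tturnstile> \<Xi>"
  by (rule ent_trans[OF ent_snd])

lemma tensor_conj: "(\<lambda>x. \<Phi> x \<otimes> \<Psi> x) \<tturnstile> (\<lambda>x. \<Phi> x \<^bold>\<and>\<^bsub>T\<^esub> \<Psi> x)"
proof -
  obtain F where "pcomp F" "\<forall>\<alpha>\<in>M. \<forall>a b. F \<alpha> (pe a b) = Some (ppair a b)" using pcomp_ppair by blast
  then show ?thesis by (intro entI[of F]) (auto simp: tensor_def tconj_eq)
qed

lemma ent_conjI: "\<Phi> \<tturnstile> \<Psi> \<Longrightarrow> \<Phi> \<tturnstile> \<Xi> \<Longrightarrow> \<Phi> \<tturnstile> (\<lambda>x. \<Psi> x \<^bold>\<and>\<^bsub>T\<^esub> \<Xi> x)"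
  by (rule ent_trans[OF ent_tensor tensor_conj])

lemma conj_ent1: "(\<lambda>x. \<Phi> x \<^bold>\<and>\<^bsub>T\<^esub> \<Psi> x) \<tturnstile> \<Phi>"
proof -
  have "pcomp (\<lambda>\<alpha> n. phi \<alpha> n ptrue)" by (intro pcomp_phi tcomp_basic)
  then show ?thesis by (rule entI) (auto simp: tconj_eq pair_proj)
qed

lemma conj_ent2: "(\<lambda>x. \<Phi> x \<^bold>\<and>\<^bsub>T\<^esub> \<Psi> x) \<tturnstile> \<Psi>"
proof -
  have "pcomp (\<lambda>\<alpha> n. phi \<alpha> n pfalse)" by (intro pcomp_phi tcomp_basic)
  then show ?thesis by (rule entI) (auto simp: tconj_eq pair_proj)
qed

lemma ent_conjE1: "\<Phi> \<tturnstile> (\<lambda>x. \<Psi> x \<^bold>\<and>\<^bsub>T\<^esub> \<Xi> x) \<Longrightarrow> \<Phi> \<tturnstile> \<Psi>"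
  by (rule ent_trans[OF _ conj_ent1])

lemma ent_conjE2: "\<Phi> \<tturnstile> (\<lambda>x. \<Psi> x \<^bold>\<and>\<^bsub>T\<^esub> \<Xi> x) \<Longrightarrow> \<Phi> \<tturnstile> \<Xi>"
  by (rule ent_trans[OF _ conj_ent2])

lemma tagged_disj: "(\<lambda>x. \<Phi> x \<oplus> \<Psi> x) \<tturnstile> (\<lambda>x. \<Phi> x \<^bold>\<or>\<^bsub>T\<^esub> \<Psi> x)"
proof -
  obtain F where F: "pcomp F" "\<forall>\<alpha>\<in>M. \<forall>a b. F \<alpha> (pe a b) = Some (ppair a b)" using pcomp_ppair by blast
  have "pcomp (\<lambda>\<alpha> n. F \<alpha> (pe (if pfst n = 0 then ptrue else pfalse) (psnd n)))"
    by (intro pcomp_comp[OF F(1)] tcomp_intros)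
  then show ?thesis by (rule entI) (auto simp: tagged_def tdisj_eq F)
qed

lemma disj_tagged: "(\<lambda>x. \<Phi> x \<^bold>\<or>\<^bsub>T\<^esub> \<Psi> x) \<tturnstile> (\<lambda>x. \<Phi> x \<oplus> \<Psi> x)"
proof -
  have "pcomp (\<lambda>\<alpha> n. Option.bind (phi \<alpha> n ptrue) (\<lambda>t. Option.bind (phi \<alpha> n pfalse)
    (\<lambda>a. Some (pe (if t = ptrue then 0 else 1) a))))"
    by (intro pcomp_bind pcomp_Some pcomp_phi tcomp_intros)
  then show ?thesis
    by (rule entI) (use ptrue_neq_pfalse in \<open>auto simp: tagged_def tdisj_eq pair_proj\<close>)
qed

lemma ent_impI: "(\<lambda>x. \<Phi> x \<otimes> \<Psi> x) \<tturnstile> \<Xi> \<Longrightarrow> \<Phi> \<tturnstile> (\<lambda>x. \<Psi> x \<^bold>\<longrightarrow>\<^bsub>T\<^esub> \<Xi> x)"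
proof -
  assume "(\<lambda>x. \<Phi> x \<otimes> \<Psi> x) \<tturnstile> \<Xi>"
  then obtain F where F: "pcomp F"
    "\<And>x b \<alpha>. b \<in> \<Phi> x \<otimes> \<Psi> x \<Longrightarrow> \<alpha> \<in> M \<Longrightarrow> \<exists>c\<in>\<Xi> x. F \<alpha> b = Some c" by (elim entD) blast
  obtain e where e: "\<And>\<alpha> n. phi \<alpha> e n = F \<alpha> n" using pcomp_index[OF F(1)] by blast
  have "pcomp (\<lambda>\<alpha> n. Some (curry_index e n))" by (intro pcomp_Some tcomp_curry_index tcomp_basic)
  then show ?thesis
    by (rule entI) (use F(2) in \<open>fastforce simp: timp_def phi_curry_index e tensor_def\<close>)
qed

lemma ent_impE: "\<Phi> \<tturnstile> (\<lambda>x. \<Psi> x \<^bold>\<longrightarrow>\<^bsub>T\<^esub> \<Xi> x) \<Longrightarrow> \<Phi> \<tturnstile> \<Psi> \<Longrightarrow> \<Phi> \<tturnstile> \<Xi>"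
proof -
  assume "\<Phi> \<tturnstile> (\<lambda>x. \<Psi> x \<^bold>\<longrightarrow>\<^bsub>T\<^esub> \<Xi> x)" "\<Phi> \<tturnstile> \<Psi>"
  then have 1: "\<Phi> \<tturnstile> (\<lambda>x. (\<Psi> x \<^bold>\<longrightarrow>\<^bsub>T\<^esub> \<Xi> x) \<otimes> \<Psi> x)" by (rule ent_tensor)
  have "pcomp (\<lambda>\<alpha> n. phi \<alpha> (pfst n) (psnd n))" by (intro pcomp_phi tcomp_basic)
  then have "(\<lambda>x. (\<Psi> x \<^bold>\<longrightarrow>\<^bsub>T\<^esub> \<Xi> x) \<otimes> \<Psi> x) \<tturnstile> \<Xi>"
    by (rule entI) (auto simp: tensor_def timp_def)
  with 1 show ?thesis by (rule ent_trans)
qed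

lemma tall_eq: "tall T \<phi> = {a. \<forall>y b. \<forall>\<alpha>\<in>M. \<exists>c\<in>\<phi> y. phi \<alpha> a b = Some c}"
  by (simp add: tall_def all_along_def)

lemma tex_eq: "tex \<phi> = (\<Union>y. \<phi> y)"
  by (simp add: tex_def ex_along_def)

lemma ent_allI:
  assumes "(\<lambda>z. \<Phi> (fst z)) \<tturnstile> (\<lambda>z. \<Psi> (fst z) (snd z))"
  shows "\<Phi> \<tturnstile> (\<lambda>x. tall T (\<Psi> x))"
proof -
  from assms obtain F where F: "pcomp F"
    "\<And>z b \<alpha>. b \<in> \<Phi> (fst z) \<Longrightarrow> \<alpha> \<in> M \<Longrightarrow> \<exists>c\<in>\<Psi> (fst z) (snd z). F \<alpha> b = Some c" by (elim entD) blast
  \<comment> \<open>A realizer of \<open>tall\<close> is applied to a dummy argument, which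
    \<open>pfst\<close> discards.\<close>
  have "pcomp (\<lambda>\<alpha> n. F \<alpha> (pfst n))" by (intro pcomp_comp[OF F(1)] tcomp_basic)
  from pcomp_index[OF this] obtain e where e: "\<And>\<alpha> n. phi \<alpha> e n = F \<alpha> (pfst n)" by blast
  have "pcomp (\<lambda>\<alpha> n. Some (curry_index e n))" by (intro pcomp_Some tcomp_curry_index tcomp_basic)
  then show ?thesis
    by (rule entI) (use F(2)[of _ "(_, _)"] in \<open>auto simp: tall_eq phi_curry_index e\<close>)
qed

text \<open>Quantification is uniform: the realizer never sees the individual, so t may be any
  classical function. The dummy argument is taken to be 0.\<close>

lemma ent_allE: "\<Phi> \<tturnstile> (\<lambda>x. tall T (\<Psi> x)) \<Longrightarrow> \<Phi> \<tturnstile> (\<lambda>x. \<Psi> x (t x))"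
proof (erule ent_trans)
  have "pcomp (\<lambda>\<alpha> n. phi \<alpha> n 0)" by (intro pcomp_phi tcomp_basic)
  then show "(\<lambda>x. tall T (\<Psi> x)) \<tturnstile> (\<lambda>x. \<Psi> x (t x))"
    by (rule entI) (auto simp: tall_eq)
qed

lemma ent_all_inI:
  assumes "(\<lambda>z. \<Phi> (fst z) \<otimes> X (snd z) (snd z)) \<tturnstile> (\<lambda>z. \<Psi> (fst z) (snd z))"
  shows "\<Phi> \<tturnstile> (\<lambda>x. all_in T X (\<Psi> x))"
  unfolding all_in_def by (intro ent_allI ent_impI assms)

lemma ent_all_inE:
  assumes "\<Phi> \<tturnstile> (\<lambda>x. all_in T X (\<Psi> x))" "\<Phi> \<tturnstile> (\<lambda>x. X (t x) (t x))"
  shows "\<Phi> \<tturnstile> (\<lambda>x. \<Psi> x (t x))"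
  using ent_impE[OF ent_allE[OF assms(1)[unfolded all_in_def]] assms(2)] .

text \<open>The union lets the witness depend on the realizer, for instance when it is a rational
  found by search; in \<open>ent_ex_inI'\<close> it depends on x alone.\<close>

lemma ent_ex_inI:
  assumes "\<Phi> \<tturnstile> (\<lambda>x. \<Union>y. X y y \<otimes> \<Psi> x y)"
  shows "\<Phi> \<tturnstile> (\<lambda>x. ex_in T X (\<Psi> x))"
proof -
  have "(\<lambda>z. X (snd z) (snd z) \<otimes> \<Psi> (fst z) (snd z)) \<tturnstile> (\<lambda>z. X (snd z) (snd z) \<^bold>\<and>\<^bsub>T\<^esub> \<Psi> (fst z) (snd z))"
    by (rule tensor_conj)
  then obtain F where F: "pcomp F" "\<And>z b \<alpha>. b \<in> X (snd z) (snd z) \<otimes> \<Psi> (fst z) (snd z) \<Longrightarrow> \<alpha> \<in> M \<Longrightarrow>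
     \<exists>c\<in>X (snd z) (snd z) \<^bold>\<and>\<^bsub>T\<^esub> \<Psi> (fst z) (snd z). F \<alpha> b = Some c" by (elim entD) blast
  have "(\<lambda>x. \<Union>y. X y y \<otimes> \<Psi> x y) \<tturnstile> (\<lambda>x. ex_in T X (\<Psi> x))"
    by (rule entI[OF F(1)]) (use F(2)[of _ "(_, _)"] in \<open>fastforce simp: ex_in_def tex_eq\<close>)
  with assms show ?thesis by (rule ent_trans)
qed

lemma ent_ex_inI':
  assumes "\<Phi> \<tturnstile> (\<lambda>x. X (t x) (t x))" "\<Phi> \<tturnstile> (\<lambda>x. \<Psi> x (t x))"
  shows "\<Phi> \<tturnstile> (\<lambda>x. ex_in T X (\<Psi> x))"
  by (rule ent_ex_inI, rule ent_trans[OF ent_tensor[OF assms]], rule ent_mono) blast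

lemma ent_ex_inE:
  assumes "\<Phi> \<tturnstile> (\<lambda>x. ex_in T X (\<Psi> x))"
    and "(\<lambda>z. \<Phi> (fst z) \<otimes> X (snd z) (snd z) \<otimes> \<Psi> (fst z) (snd z)) \<tturnstile> (\<lambda>z. \<Xi> (fst z))"
  shows "\<Phi> \<tturnstile> \<Xi>"
proof -
  have "(\<lambda>z. \<Phi> (fst z) \<otimes> (X (snd z) (snd z) \<^bold>\<and>\<^bsub>T\<^esub> \<Psi> (fst z) (snd z))) \<tturnstile> (\<lambda>z. \<Xi> (fst z))"
    by (rule ent_trans[OF _ assms(2)])
      (intro ent_tensor ent_fst ent_weak2 conj_ent1 conj_ent2)
  then obtain F where F: "pcomp F" "\<And>z b \<alpha>. b \<in> \<Phi> (fst z) \<otimes> (X (snd z) (snd z) \<^bold>\<and>\<^bsub>T\<^esub> \<Psi> (fst z) (snd z))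
     \<Longrightarrow> \<alpha> \<in> M \<Longrightarrow> \<exists>c\<in>\<Xi> (fst z). F \<alpha> b = Some c" by (elim entD) blast
  have "(\<lambda>x. \<Phi> x \<otimes> ex_in T X (\<Psi> x)) \<tturnstile> \<Xi>"
  proof (rule entI[OF F(1)])
    fix x b \<alpha> assume b: "b \<in> \<Phi> x \<otimes> ex_in T X (\<Psi> x)" and \<alpha>: "\<alpha> \<in> M"
    then obtain y where "b \<in> \<Phi> x \<otimes> (X y y \<^bold>\<and>\<^bsub>T\<^esub> \<Psi> x y)" by (auto simp: tensor_def ex_in_def tex_eq)
    with F(2)[of b "(x, y)"] \<alpha> show "\<exists>c\<in>\<Xi> x. F \<alpha> b = Some c" by simp
  qed
  with ent_tensor[OF ent_refl assms(1)] show ?thesis by (rule ent_trans)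
qed

subsection \<open>Truth of realized propositions\<close>

lemma tconj_nonempty: "A \<^bold>\<and>\<^bsub>T\<^esub> B \<noteq> {} \<longleftrightarrow> A \<noteq> {} \<and> B \<noteq> {}"
  by (auto simp: tconj_eq)

lemma tdisj_nonempty: "A \<^bold>\<or>\<^bsub>T\<^esub> B \<noteq> {} \<longleftrightarrow> A \<noteq> {} \<or> B \<noteq> {}"
  by (auto simp: tdisj_eq)

lemma timp_nonempty: "A \<^bold>\<longrightarrow>\<^bsub>T\<^esub> B \<noteq> {} \<Longrightarrow> A \<noteq> {} \<Longrightarrow> B \<noteq> {}"
proof -
  assume "A \<^bold>\<longrightarrow>\<^bsub>T\<^esub> B \<noteq> {}" "A \<noteq> {}"
  moreover obtain \<beta> where "\<beta> \<in> M" using nonempty by auto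
  ultimately show ?thesis unfolding timp_def by fastforce
qed

text \<open>A true negation is realized by every number, so negated propositions can be argued
  classically.\<close>

lemma tnot_eq: "\<^bold>\<not>\<^bsub>T\<^esub> A = (if A = {} then UNIV else {})"
  using nonempty by (auto simp: tnot_def timp_def)

lemma all_in_nonempty: "all_in T X \<phi> \<noteq> {} \<Longrightarrow> X x x \<noteq> {} \<Longrightarrow> \<phi> x \<noteq> {}"
proof -
  assume "all_in T X \<phi> \<noteq> {}" "X x x \<noteq> {}"
  then have "X x x \<^bold>\<longrightarrow>\<^bsub>T\<^esub> \<phi> x \<noteq> {}" using nonempty by (fastforce simp: all_in_def tall_eq)
  then show "\<phi> x \<noteq> {}" using \<open>X x x \<noteq> {}\<close> by (rule timp_nonempty)
qed

lemma tall_nonempty: "tall T \<phi> \<noteq> {} \<Longrightarrow> \<phi> x \<noteq> {}"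
  using nonempty by (fastforce simp: tall_eq)

lemma ex_in_nonempty: "ex_in T X \<phi> \<noteq> {} \<longleftrightarrow> (\<exists>x. X x x \<noteq> {} \<and> \<phi> x \<noteq> {})"
  by (auto simp: ex_in_def tex_eq tconj_nonempty)

lemma tiff_nonempty: "A \<^bold>\<longleftrightarrow>\<^bsub>T\<^esub> B \<noteq> {} \<Longrightarrow> (A \<noteq> {} \<longleftrightarrow> B \<noteq> {})"
  using timp_nonempty[of A B] timp_nonempty[of B A] by (auto simp: tiff_def tconj_nonempty)

lemma tv_nonempty: "tv P \<noteq> {} \<longleftrightarrow> P"
  by (simp add: tv_def)

lemmas nonempty_iffs = tconj_nonempty tdisj_nonempty ex_in_nonempty tv_nonempty

end

section \<open>Computing with rationals and binary digits\<close>

lemma tcomp_computable: "computable f \<Longrightarrow> tcomp g \<Longrightarrow> tcomp (\<lambda>\<alpha> n. f (g \<alpha> n))"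
  by (rule tcomp_comp[of "\<lambda>_. f"]) (auto simp: computable_def phi_def tcomp_def pcomp_def)

lemma tcomp_Least:
  assumes "dcomp (\<lambda>\<alpha> z. P \<alpha> (pfst z) (psnd z))" "\<And>\<alpha> n. \<exists>k. P \<alpha> n k"
  shows "tcomp (\<lambda>\<alpha> n. LEAST k. P \<alpha> n k)"
  using pcomp_mu[OF assms(1)] assms(2) by (simp add: tcomp_def)

text \<open>Numerators are differences of naturals; cross multiplication and moving terms to the
  other side leave a comparison of natural numbers.\<close>

lemma dcomp_frac_less:
  assumes "tcomp x" "tcomp y" "tcomp w" "tcomp x'" "tcomp y'" "tcomp w'"
    and pos: "\<And>\<alpha> n. w \<alpha> n > 0" "\<And>\<alpha> n. w' \<alpha> n > 0"
  shows "dcomp (\<lambda>\<alpha> n. (real (x \<alpha> n) - real (y \<alpha> n)) / real (w \<alpha> n)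
    < (real (x' \<alpha> n) - real (y' \<alpha> n)) / real (w' \<alpha> n))"
proof -
  have *: "(real a - real b) / real c < (real a' - real b') / real c' \<longleftrightarrow> a * c' + b' * c < a' * c + b * c'"
    if "c > 0" "c' > 0" for a b c a' b' c' :: nat
  proof -
    have "(real a - real b) / real c < (real a' - real b') / real c' \<longleftrightarrow>
        (real a - real b) * real c' < (real a' - real b') * real c"
      using that by (simp add: field_simps)
    also have "\<dots> \<longleftrightarrow> real (a * c' + b' * c) < real (a' * c + b * c')"
      by (simp add: algebra_simps)
    finally show ?thesis by (simp only: of_nat_less_iff)
  qed
  show ?thesis unfolding *[OF pos] by (intro tcomp_intros assms(1-6))
qed

section \<open>Approximations from the binary digits of the oracle\<close>

definition digits :: "(nat \<Rightarrow> bool) \<Rightarrow> nat \<Rightarrow> nat \<Rightarrow> nat" where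
  "digits \<alpha> n k = rec_nat 0 (\<lambda>i r. 2 * r + of_bool (\<alpha> (pe n i))) k"

lemma tcomp_digits:
  assumes "tcomp f" "tcomp g"
  shows "tcomp (\<lambda>\<alpha> n. digits \<alpha> (f \<alpha> n) (g \<alpha> n))"
  unfolding digits_def by (intro tcomp_rec tcomp_intros tcomp_comp[OF assms(1)] assms)

text \<open>The digits from position k on contribute between 0 and 2^-k, both extremes included. The
  bounds hold for every oracle, although two oracles for the same sequence may have different
  digits.\<close>

lemma digits_bounds:
  "real (digits \<alpha> n k) / 2 ^ k \<le> bin_seq \<alpha> n" "bin_seq \<alpha> n \<le> (real (digits \<alpha> n k) + 1) / 2 ^ k"
proof -
  let ?b = "\<lambda>i. of_bool (\<alpha> (pe n i)) * (1 / 2 :: real) ^ (i + 1)"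
  have half: "(\<lambda>i. (1 / 2 :: real) ^ (i + 1)) sums 1" using power_half_series by simp
  have summ: "summable ?b"
    by (rule summable_comparison_test'[OF sums_summable[OF half], of 0]) simp
  have dig: "(\<Sum>i<k. ?b i) = real (digits \<alpha> n k) / 2 ^ k"
    by (induction k) (simp_all add: digits_def field_simps)
  have split: "bin_seq \<alpha> n = (\<Sum>i. ?b (i + k)) + real (digits \<alpha> n k) / 2 ^ k"
    unfolding bin_seq_def bin_real_def dig[symmetric] by (rule suminf_split_initial_segment[OF summ])
  have summk: "summable (\<lambda>i. ?b (i + k))" using summ by (rule summable_ignore_initial_segment)
  have "(\<lambda>i. (1 / 2) ^ (i + 1) * (1 / 2 :: real) ^ k) sums (1 * (1 / 2) ^ k)"
    by (rule sums_mult2[OF half])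
  moreover have "?b (i + k) \<le> (1 / 2) ^ (i + 1) * (1 / 2) ^ k" for i
    by (simp add: power_add)
  ultimately have "(\<Sum>i. ?b (i + k)) \<le> (1 / 2) ^ k"
    using suminf_le[OF _ summk, of "\<lambda>i. (1 / 2) ^ (i + 1) * (1 / 2) ^ k"] by (simp add: sums_iff)
  then show "bin_seq \<alpha> n \<le> (real (digits \<alpha> n k) + 1) / 2 ^ k"
    by (simp add: split add_divide_distrib power_one_over)
  have "(\<Sum>i. ?b (i + k)) \<ge> 0" by (rule suminf_nonneg[OF summk]) simp
  then show "real (digits \<alpha> n k) / 2 ^ k \<le> bin_seq \<alpha> n" by (simp add: split)
qed

lemma ex_digits_below: "r < bin_seq \<alpha> n \<Longrightarrow> \<exists>k. r < real (digits \<alpha> n k) / 2 ^ k"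
  and ex_digits_above: "bin_seq \<alpha> n < r \<Longrightarrow> \<exists>k. (real (digits \<alpha> n k) + 1) / 2 ^ k < r"
proof -
  have eps: "\<exists>k. 1 / 2 ^ k < e" if "e > 0" for e :: real
    using real_arch_pow_inv[OF that, of "1 / 2"] by (auto simp: power_one_over)
  show "\<exists>k. r < real (digits \<alpha> n k) / 2 ^ k" if "r < bin_seq \<alpha> n"
  proof -
    from that eps[of "bin_seq \<alpha> n - r"] obtain k where "1 / 2 ^ k < bin_seq \<alpha> n - r" by auto
    with digits_bounds(2)[of \<alpha> n k] have "r < real (digits \<alpha> n k) / 2 ^ k"
      by (simp add: add_divide_distrib)
    then show ?thesis ..
  qed
  show "\<exists>k. (real (digits \<alpha> n k) + 1) / 2 ^ k < r" if "bin_seq \<alpha> n < r"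
  proof -
    from that eps[of "r - bin_seq \<alpha> n"] obtain k where "1 / 2 ^ k < r - bin_seq \<alpha> n" by auto
    with digits_bounds(1)[of \<alpha> n k] have "(real (digits \<alpha> n k) + 1) / 2 ^ k < r"
      by (simp add: add_divide_distrib)
    then show ?thesis ..
  qed
qed

section \<open>Rational arithmetic on indices\<close>

locale rat_enumeration =
  fixes q :: "nat \<Rightarrow> rat"
  assumes computable_q: "computable_rat_bijection q"
begin

definition qpos :: "nat \<Rightarrow> nat" where
  "qpos n = nat (fst (quotient_of (q n)))"
definition qneg :: "nat \<Rightarrow> nat" where
  "qneg n = nat (- fst (quotient_of (q n)))"
definition qden :: "nat \<Rightarrow> nat" where
  "qden n = nat (snd (quotient_of (q n)))"

lemma qden_pos: "qden n > 0"
  using quotient_of_denom_pos'[of "q n"] by (simp add: qden_def)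

lemma q_eq: "real_of_rat (q n) = (real (qpos n) - real (qneg n)) / real (qden n)"
proof -
  have "q n = of_int (fst (quotient_of (q n))) / of_int (snd (quotient_of (q n)))"
    by (rule quotient_of_div) simp
  then have "real_of_rat (q n) = real_of_int (fst (quotient_of (q n))) / real_of_int (snd (quotient_of (q n)))"
    by (metis of_rat_divide of_rat_of_int_eq)
  then show ?thesis using quotient_of_denom_pos'[of "q n"]
    by (simp add: qpos_def qneg_def qden_def)
qed

lemma tcomp_q:
  assumes "tcomp f"
  shows "tcomp (\<lambda>\<alpha> n. qpos (f \<alpha> n))" "tcomp (\<lambda>\<alpha> n. qneg (f \<alpha> n))" "tcomp (\<lambda>\<alpha> n. qden (f \<alpha> n))"
proof -
  let ?c = "\<lambda>n. int_encode (fst (quotient_of (q n)))"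
  have num: "tcomp (\<lambda>\<alpha> n. ?c (f \<alpha> n))" and den: "computable (\<lambda>n. nat (snd (quotient_of (q n))))"
    using computable_q tcomp_computable[OF _ assms] unfolding computable_rat_bijection_def by auto
  \<comment> \<open>\<open>int_encode\<close> sends i to 2i if i is nonnegative and to -2i - 1
    otherwise.\<close>
  have "nat i = (if int_encode i mod 2 = 0 then int_encode i div 2 else 0)"
    "nat (- i) = (if int_encode i mod 2 = 0 then 0 else (int_encode i + 1) div 2)" for i
    by (auto simp: int_encode_def sum_encode_def)
  then show "tcomp (\<lambda>\<alpha> n. qpos (f \<alpha> n))" "tcomp (\<lambda>\<alpha> n. qneg (f \<alpha> n))"
    unfolding qpos_def qneg_def by (simp_all only:) (intro tcomp_intros tcomp_mod tcomp_div num; simp)+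
  show "tcomp (\<lambda>\<alpha> n. qden (f \<alpha> n))" unfolding qden_def by (rule tcomp_computable[OF den assms])
qed

lemma dcomp_q_less: "tcomp f \<Longrightarrow> tcomp g \<Longrightarrow> dcomp (\<lambda>\<alpha> n. q (f \<alpha> n) < q (g \<alpha> n))"
proof -
  assume "tcomp f" "tcomp g"
  then have "dcomp (\<lambda>\<alpha> n. real_of_rat (q (f \<alpha> n)) < real_of_rat (q (g \<alpha> n)))"
    unfolding q_eq by (intro dcomp_frac_less tcomp_q qden_pos)
  then show ?thesis by (simp add: of_rat_less)
qed

lemma dcomp_q_below:
  assumes "tcomp f" "tcomp g" "tcomp h"
  shows "dcomp (\<lambda>\<alpha> n. real_of_rat (q (f \<alpha> n)) < real (digits \<alpha> (g \<alpha> n) (h \<alpha> n)) / 2 ^ h \<alpha> n)"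
proof -
  have "dcomp (\<lambda>\<alpha> n. real_of_rat (q (f \<alpha> n)) <
     (real (digits \<alpha> (g \<alpha> n) (h \<alpha> n)) - real 0) / real (2 ^ h \<alpha> n))"
    unfolding q_eq by (intro dcomp_frac_less tcomp_q qden_pos assms tcomp_digits tcomp_intros) simp
  then show ?thesis by simp
qed

lemma dcomp_q_above:
  assumes "tcomp f" "tcomp g" "tcomp h"
  shows "dcomp (\<lambda>\<alpha> n. (real (digits \<alpha> (g \<alpha> n) (h \<alpha> n)) + 1) / 2 ^ h \<alpha> n < real_of_rat (q (f \<alpha> n)))"
proof -
  have "dcomp (\<lambda>\<alpha> n. (real (digits \<alpha> (g \<alpha> n) (h \<alpha> n) + 1) - real 0) / real (2 ^ h \<alpha> n)
    < real_of_rat (q (f \<alpha> n)))"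
    unfolding q_eq by (intro dcomp_frac_less tcomp_q qden_pos assms tcomp_digits tcomp_intros) simp
  then show ?thesis by (simp add: add.commute)
qed

definition rat_index :: "nat \<Rightarrow> nat \<Rightarrow> nat \<Rightarrow> nat" where
  "rat_index x y w = (SOME i. q i = (of_nat x - of_nat y) / of_nat w)"

lemma q_surj: "\<exists>i. q i = a"
  using computable_q unfolding computable_rat_bijection_def by (metis bij_pointE)

lemma q_rat_index: "q (rat_index x y w) = (of_nat x - of_nat y) / of_nat w"
  unfolding rat_index_def by (rule someI_ex) (rule q_surj)

lemma of_rat_q_rat_index: "real_of_rat (q (rat_index x y w)) = (real x - real y) / real w"
  by (simp add: q_rat_index of_rat_divide of_rat_diff)

lemma tcomp_rat_index:
  assumes "tcomp x" "tcomp y" "tcomp w" and pos: "\<And>\<alpha> n. w \<alpha> n > 0"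
  shows "tcomp (\<lambda>\<alpha> n. rat_index (x \<alpha> n) (y \<alpha> n) (w \<alpha> n))"
proof -
  \<comment> \<open>Equality is written as two failing strict comparisons, to which
    \<open>dcomp_frac_less\<close> applies; injectivity of q makes the index found unique.\<close>
  let ?P = "\<lambda>\<alpha> n i. \<not> real_of_rat (q i) < (real (x \<alpha> n) - real (y \<alpha> n)) / real (w \<alpha> n) \<and>
    \<not> (real (x \<alpha> n) - real (y \<alpha> n)) / real (w \<alpha> n) < real_of_rat (q i)"
  have inj: "q i = q j \<Longrightarrow> i = j" for i j
    using computable_q unfolding computable_rat_bijection_def bij_def inj_def by blast
  have eq: "?P \<alpha> n i \<longleftrightarrow> i = rat_index (x \<alpha> n) (y \<alpha> n) (w \<alpha> n)" for \<alpha> n i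
  proof -
    have "?P \<alpha> n i \<longleftrightarrow> real_of_rat (q i) = real_of_rat (q (rat_index (x \<alpha> n) (y \<alpha> n) (w \<alpha> n)))"
      unfolding of_rat_q_rat_index by auto
    then show ?thesis using inj by auto
  qed
  have "dcomp (\<lambda>\<alpha> z. ?P \<alpha> (pfst z) (psnd z))"
    unfolding q_eq by (intro dcomp_frac_less tcomp_q qden_pos tcomp_intros pos
        tcomp_comp[OF assms(1)] tcomp_comp[OF assms(2)] tcomp_comp[OF assms(3)])
  then have "tcomp (\<lambda>\<alpha> n. LEAST i. ?P \<alpha> n i)"
    by (rule tcomp_Least) (use eq in blast)
  then show ?thesis unfolding eq by (simp add: Least_equality)
qed

end

section \<open>Approximation by counting\<close>

definition clip :: "real \<Rightarrow> real \<Rightarrow> real \<Rightarrow> real" where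
  "clip a b x = max a (min b x)"

text \<open>An i with i + 1 \<le> u must be accepted and one with u \<le> i rejected. At most one i
  is left open, so the count is one of the integers next to u, up to truncation, however that i is
  decided.\<close>

lemma count_approx:
  fixes t :: "nat \<Rightarrow> bool" and u :: real
  assumes "\<And>i. i < m \<Longrightarrow> t i \<Longrightarrow> real i < u" "\<And>i. i < m \<Longrightarrow> \<not> t i \<Longrightarrow> u < real i + 1"
  shows "\<bar>real (\<Sum>i<m. of_bool (t i)) - clip 0 (real m) u\<bar> < 1"
  using assms
proof (induction m)
  case (Suc m)
  let ?c = "\<Sum>i<m. of_bool (t i) :: nat"
  have IH: "\<bar>real ?c - clip 0 (real m) u\<bar> < 1" using Suc by simp
  have "?c \<le> (\<Sum>i<m. 1)" by (rule sum_mono) simp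
  then have cm: "?c \<le> m" by simp
  have eq: "?c = m" if "real m < u"
  proof -
    have "real m - 1 < real ?c" using IH that by (simp add: clip_def abs_if split: if_splits)
    then show ?thesis using cm by linarith
  qed
  show ?case
  proof (cases "t m")
    case True
    then have "real m < u" using Suc.prems(1) by simp
    with eq[OF this] True show ?thesis by (simp add: clip_def abs_if)
  next
    case False
    then have "u < real m + 1" using Suc.prems(2) by simp
    with eq IH False show ?thesis by (cases "real m < u") (auto simp: clip_def abs_if)
  qed
qed (simp add: clip_def)

text \<open>After scaling by N, x is known up to 1 and the shifted, truncated v up to less than 1.
  As \<open>clip\<close> does not increase distances, the errors add up to less than 2.\<close>

lemma clip_approx:
  fixes X c N :: nat and x v u :: real
  assumes "N > 0" "real X / N \<le> x" "x \<le> (real X + 1) / N"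
    and "\<bar>real c - clip 0 (real (2 * N)) ((v + 1) * N)\<bar> < 1"
  shows "\<bar>clip 0 1 (x - clip (-1) 1 v) - real (min (X + N - c) N) / N\<bar> < 2 / N"
proof -
  define U where "U = clip 0 (real (2 * N)) ((v + 1) * N)"
  have lip: "\<bar>clip a b s - clip a b s'\<bar> \<le> \<bar>s - s'\<bar>" for a b s s' by (simp add: clip_def)
  have scale: "clip (a * N) (b * N) (s * N) = clip a b s * N" for a b s :: real
    using assms(1) by (simp add: clip_def max_def min_def)
  have "U = (clip (-1) 1 v + 1) * N"
  proof -
    have "clip 0 2 (v + 1) = clip (-1) 1 v + 1" by (simp add: clip_def)
    then show ?thesis unfolding U_def using scale[of 0 2 "v + 1"] by simp
  qed
  then have w: "clip 0 1 (x - clip (-1) 1 v) * N = clip 0 N (x * N + N - U)"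
    using scale[of 0 1 "x - clip (-1) 1 v"] by (simp add: algebra_simps)
  \<comment> \<open>Truncated subtraction of naturals does the clipping at 0, the minimum that at
    N.\<close>
  have z: "real (min (X + N - c) N) = clip 0 N (real X + N - real c)"
    by (auto simp: clip_def min_def max_def)
  have "\<bar>x * N + N - U - (real X + N - real c)\<bar> < 2"
  proof -
    have "real X \<le> x * N" "x * N \<le> real X + 1" using assms(1-3) by (simp_all add: field_simps)
    moreover have "\<bar>real c - U\<bar> < 1" using assms(4) by (simp add: U_def)
    ultimately show ?thesis by linarith
  qed
  then have "\<bar>clip 0 1 (x - clip (-1) 1 v) * N - real (min (X + N - c) N)\<bar> < 2"
    unfolding w z by (rule le_less_trans[OF lip])
  moreover have "clip 0 1 (x - clip (-1) 1 v) - real (min (X + N - c) N) / N =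
      (clip 0 1 (x - clip (-1) 1 v) * N - real (min (X + N - c) N)) / N"
    using assms(1) by (simp add: diff_divide_distrib)
  ultimately show ?thesis using assms(1) by (simp add: abs_divide divide_strict_right_mono)
qed

section \<open>Real numbers in the topos of a Miller sequence\<close>

locale miller = rat_enumeration q for q +
  fixes \<mu> :: "nat \<Rightarrow> real"
  assumes miller: "miller_sequence q \<mu>"
    and representable: "{\<alpha>. bin_seq \<alpha> = \<mu>} \<noteq> {}"
begin

abbreviation M where "M \<equiv> {\<alpha>. bin_seq \<alpha> = \<mu>}"

sublocale oracle_set M
  by standard (rule representable)

notation (input) ent (infix "\<tturnstile>" 50)

abbreviation Q where "Q \<equiv> rat_obj q"
abbreviation R where "R \<equiv> dedekind_obj T Q"
abbreviation I where "I \<equiv> unit_interval_obj T Q"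

text \<open>A realizer of membership carries only the index of the rational, the comparison being
  classical. So every real, computable or not, gives an individual; what has to be realized is that
  it exists as a Dedekind real.\<close>

definition real_cut :: "real \<Rightarrow> nat cut" where
  "real_cut x = (\<lambda>a. Q a a \<^bold>\<and>\<^bsub>T\<^esub> tv (of_rat a < x), \<lambda>a. Q a a \<^bold>\<and>\<^bsub>T\<^esub> tv (x < of_rat a))"

lemma rat_cut_eq: "rat_cut T Q c = real_cut (of_rat c)"
  by (simp add: rat_cut_def real_cut_def of_rat_less)

lemma Q_eq: "Q a a = {i. q i = a}"
  by (auto simp: rat_obj_def)

lemma Q_nonempty: "Q a a \<noteq> {}"
  using q_surj[of a] by (auto simp: Q_eq)

lemma \<mu>_bounds: "0 \<le> \<mu> n" "\<mu> n \<le> 1"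
  using miller unfolding miller_sequence_def image_subset_iff atLeastAtMost_iff by blast+

text \<open>Unbounded search for a decidable certificate. The certificate found may vary with the
  oracle, as long as each one yields a realizer.\<close>

lemma ent_search:
  assumes "dcomp (\<lambda>\<alpha> z. P \<alpha> (pfst z) (psnd z))" "tcomp (\<lambda>\<alpha> z. g \<alpha> (pfst z) (psnd z))"
    and "\<And>x b \<alpha>. b \<in> \<Phi> x \<Longrightarrow> \<alpha> \<in> M \<Longrightarrow> \<exists>k. P \<alpha> b k"
    and "\<And>x b \<alpha> k. b \<in> \<Phi> x \<Longrightarrow> \<alpha> \<in> M \<Longrightarrow> P \<alpha> b k \<Longrightarrow> g \<alpha> b k \<in> \<Psi> x"
  shows "\<Phi> \<tturnstile> \<Psi>"
proof -
  have "pcomp (\<lambda>\<alpha> n. Option.bind (if \<exists>k. P \<alpha> n k then Some (LEAST k. P \<alpha> n k) else None)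
    (\<lambda>k. Some (g \<alpha> n k)))"
    by (intro pcomp_bind pcomp_mu pcomp_Some assms(1,2))
  then show ?thesis
  proof (rule entI)
    fix x b \<alpha> assume b: "b \<in> \<Phi> x" "\<alpha> \<in> M"
    have "P \<alpha> b (LEAST k. P \<alpha> b k)" using assms(3)[OF b] by (rule LeastI_ex)
    with assms(4)[OF b this] show "\<exists>c\<in>\<Psi> x. Option.bind (if \<exists>k. P \<alpha> b k then Some (LEAST k. P \<alpha> b k) else None)
       (\<lambda>k. Some (g \<alpha> b k)) = Some c" by auto
  qed
qed

section \<open>Comparing \<mu> n with rationals\<close>

lemma ex_q_between: "x < y \<Longrightarrow> \<exists>i. x < real_of_rat (q i) \<and> real_of_rat (q i) < y"
  using of_rat_dense[of x y] q_surj by metis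

text \<open>The computational half of roundedness of the lower cut. The search runs over pairs of a
  rational and a number of digits of \<mu> n that certifies the comparison; \<open>ent_below\<close>
  treats the upper cut.\<close>

lemma ent_above: "(\<lambda>z. {fst z} \<otimes> {i. q i = snd z \<and> of_rat (snd z) < \<mu> (fst z)}) \<tturnstile>
    (\<lambda>z. {j. snd z < q j \<and> of_rat (q j) < \<mu> (fst z)})"
proof (rule ent_search)
  let ?P = "\<lambda>\<alpha> b k. q (psnd b) < q (pfst k) \<and>
    real_of_rat (q (pfst k)) < real (digits \<alpha> (pfst b) (psnd k)) / 2 ^ psnd k"
  show "dcomp (\<lambda>\<alpha> z. ?P \<alpha> (pfst z) (psnd z))"
    by (intro tcomp_intros dcomp_q_less dcomp_q_below)
  show "tcomp (\<lambda>\<alpha> z. pfst (psnd z))" by (intro tcomp_intros)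
  fix z :: "nat \<times> rat" and b \<alpha>
  assume b: "b \<in> {fst z} \<otimes> {i. q i = snd z \<and> of_rat (snd z) < \<mu> (fst z)}" and \<alpha>: "\<alpha> \<in> M"
  then have z: "pfst b = fst z" "q (psnd b) = snd z" "of_rat (snd z) < \<mu> (fst z)" "bin_seq \<alpha> = \<mu>"
    by (auto simp: tensor_def)
  obtain j where j: "real_of_rat (snd z) < of_rat (q j)" "of_rat (q j) < \<mu> (fst z)"
    using ex_q_between[OF z(3)] by auto
  obtain k where "of_rat (q j) < real (digits \<alpha> (fst z) k) / 2 ^ k"
    using ex_digits_below[of "of_rat (q j)" \<alpha> "fst z"] j z by auto
  with j z show "\<exists>k. ?P \<alpha> b k" by (intro exI[of _ "pe j k"]) (simp add: of_rat_less)
  fix k assume "?P \<alpha> b k"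
  with z digits_bounds(1)[of \<alpha> "fst z" "psnd k"] show "pfst k \<in> {j. snd z < q j \<and> of_rat (q j) < \<mu> (fst z)}"
    by auto
qed

lemma ent_below: "(\<lambda>z. {fst z} \<otimes> {i. q i = snd z \<and> \<mu> (fst z) < of_rat (snd z)}) \<tturnstile>
    (\<lambda>z. {j. q j < snd z \<and> \<mu> (fst z) < of_rat (q j)})"
proof (rule ent_search)
  let ?P = "\<lambda>\<alpha> b k. q (pfst k) < q (psnd b) \<and>
    (real (digits \<alpha> (pfst b) (psnd k)) + 1) / 2 ^ psnd k < real_of_rat (q (pfst k))"
  show "dcomp (\<lambda>\<alpha> z. ?P \<alpha> (pfst z) (psnd z))"
    by (intro dcomp_conj tcomp_intros dcomp_q_less dcomp_q_above)
  show "tcomp (\<lambda>\<alpha> z. pfst (psnd z))" by (intro tcomp_intros)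
  fix z :: "nat \<times> rat" and b \<alpha>
  assume b: "b \<in> {fst z} \<otimes> {i. q i = snd z \<and> \<mu> (fst z) < of_rat (snd z)}" and \<alpha>: "\<alpha> \<in> M"
  then have z: "pfst b = fst z" "q (psnd b) = snd z" "\<mu> (fst z) < of_rat (snd z)" "bin_seq \<alpha> = \<mu>"
    by (auto simp: tensor_def)
  obtain j where j: "of_rat (q j) < real_of_rat (snd z)" "\<mu> (fst z) < of_rat (q j)"
    using ex_q_between[OF z(3)] by auto
  obtain k where "(real (digits \<alpha> (fst z) k) + 1) / 2 ^ k < of_rat (q j)"
    using ex_digits_above[of \<alpha> "fst z" "of_rat (q j)"] j z by auto
  with j z show "\<exists>k. ?P \<alpha> b k" by (intro exI[of _ "pe j k"]) (simp add: of_rat_less)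
  fix k assume "?P \<alpha> b k"
  with z digits_bounds(2)[of \<alpha> "fst z" "psnd k"] show "pfst k \<in> {j. q j < snd z \<and> \<mu> (fst z) < of_rat (q j)}"
    by auto
qed

text \<open>As a < b, at least one of a < \<mu> n and \<mu> n < b is true, and a strict inequality
  is eventually certified by finitely many digits.\<close>

lemma ent_decide:
  assumes "\<And>x. \<Phi> x \<noteq> {} \<Longrightarrow> a x < b x"
    and "\<Phi> \<tturnstile> (\<lambda>x. {n x})" "\<Phi> \<tturnstile> (\<lambda>x. Q (a x) (a x))" "\<Phi> \<tturnstile> (\<lambda>x. Q (b x) (b x))"
  shows "\<Phi> \<tturnstile> (\<lambda>x. {i. q i = a x \<and> of_rat (a x) < \<mu> (n x)} \<oplus> {j. q j = b x \<and> \<mu> (n x) < of_rat (b x)})"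
proof -
  \<comment> \<open>Once the realizers of \<open>\<Phi> x\<close> have been replaced by indices, the
    side condition keeps the inequality a < b available.\<close>
  let ?\<Phi> = "\<lambda>x. {p. \<Phi> x \<noteq> {} \<and> p \<in> {n x} \<otimes> (Q (a x) (a x) \<otimes> Q (b x) (b x))}"
  have "\<Phi> \<tturnstile> ?\<Phi>"
  proof -
    obtain F where F: "pcomp F" "\<And>x p \<alpha>. p \<in> \<Phi> x \<Longrightarrow> \<alpha> \<in> M \<Longrightarrow>
       \<exists>c\<in>{n x} \<otimes> (Q (a x) (a x) \<otimes> Q (b x) (b x)). F \<alpha> p = Some c"
      using ent_tensor[OF assms(2) ent_tensor[OF assms(3,4)]] by (elim entD) blast
    show ?thesis by (rule entI[OF F(1)]) (use F(2) in blast)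
  qed
  also have "?\<Phi> \<tturnstile> (\<lambda>x. {i. q i = a x \<and> of_rat (a x) < \<mu> (n x)} \<oplus> {j. q j = b x \<and> \<mu> (n x) < of_rat (b x)})"
  proof (rule ent_search)
    let ?L = "\<lambda>\<alpha> p k. real_of_rat (q (pfst (psnd p))) < real (digits \<alpha> (pfst p) k) / 2 ^ k"
    let ?U = "\<lambda>\<alpha> p k. (real (digits \<alpha> (pfst p) k) + 1) / 2 ^ k < real_of_rat (q (psnd (psnd p)))"
    show "dcomp (\<lambda>\<alpha> z. ?L \<alpha> (pfst z) (psnd z) \<or> ?U \<alpha> (pfst z) (psnd z))"
      by (intro dcomp_disj dcomp_q_below dcomp_q_above tcomp_intros)
    let ?g = "\<lambda>\<alpha> p k. if ?L \<alpha> p k then pe 0 (pfst (psnd p)) else pe 1 (psnd (psnd p))"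
    show "tcomp (\<lambda>\<alpha> z. ?g \<alpha> (pfst z) (psnd z))"
      by (intro tcomp_if dcomp_q_below tcomp_intros)
    fix x p \<alpha> assume p: "p \<in> ?\<Phi> x" and \<alpha>: "\<alpha> \<in> M"
    then have z: "pfst p = n x" "q (pfst (psnd p)) = a x" "q (psnd (psnd p)) = b x" "bin_seq \<alpha> = \<mu>"
      by (auto simp: tensor_def Q_eq)
    have "real_of_rat (a x) < of_rat (b x)" using assms(1)[of x] p by (auto simp: of_rat_less)
    then have "real_of_rat (a x) < bin_seq \<alpha> (n x) \<or> bin_seq \<alpha> (n x) < of_rat (b x)" by linarith
    then show "\<exists>k. ?L \<alpha> p k \<or> ?U \<alpha> p k"
      unfolding z(1-3) using ex_digits_below[of "of_rat (a x)" \<alpha> "n x"]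
        ex_digits_above[of \<alpha> "n x" "of_rat (b x)"] by blast
    fix k assume "?L \<alpha> p k \<or> ?U \<alpha> p k"
    then show "?g \<alpha> p k \<in> {i. q i = a x \<and> of_rat (a x) < \<mu> (n x)} \<oplus> {j. q j = b x \<and> \<mu> (n x) < of_rat (b x)}"
      using z digits_bounds[of \<alpha> "n x" k] by (auto simp: tagged_def)
  qed
  finally show ?thesis .
qed

text \<open>Only the branch selected by the tag may be run, since the other one can diverge; hence
  \<open>pcomp_if\<close>.\<close>

lemma ent_tagged_mono:
  assumes "A \<tturnstile> A'" "B \<tturnstile> B'"
  shows "(\<lambda>x. A x \<oplus> B x) \<tturnstile> (\<lambda>x. A' x \<oplus> B' x)"
proof -
  obtain F G where F: "pcomp F" "\<And>x b \<alpha>. b \<in> A x \<Longrightarrow> \<alpha> \<in> M \<Longrightarrow> \<exists>c\<in>A' x. F \<alpha> b = Some c"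
    and G: "pcomp G" "\<And>x b \<alpha>. b \<in> B x \<Longrightarrow> \<alpha> \<in> M \<Longrightarrow> \<exists>c\<in>B' x. G \<alpha> b = Some c"
    using assms by (elim entD) blast
  have "pcomp (\<lambda>\<alpha> n. Option.bind (if pfst n = 0 then F \<alpha> (psnd n) else G \<alpha> (psnd n))
      (\<lambda>y. Some (pe (pfst n) y)))"
    by (intro pcomp_bind pcomp_if pcomp_Some pcomp_comp[OF F(1)] pcomp_comp[OF G(1)] tcomp_intros)
  then show ?thesis by (rule entI) (use F(2) G(2) in \<open>fastforce simp: tagged_def\<close>)
qed

lemma ent_Union_mono:
  assumes "(\<lambda>z. A (fst z) (snd z)) \<tturnstile> (\<lambda>z. B (fst z) (snd z))"
  shows "(\<lambda>x. \<Union>y. A x y) \<tturnstile> (\<lambda>x. \<Union>y. B x y)"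
proof -
  obtain F where F: "pcomp F" "\<And>z b \<alpha>. b \<in> A (fst z) (snd z) \<Longrightarrow> \<alpha> \<in> M \<Longrightarrow>
      \<exists>c\<in>B (fst z) (snd z). F \<alpha> b = Some c" using assms by (elim entD) blast
  show ?thesis by (rule entI[OF F(1)]) (use F(2)[of _ "(_, _)"] in fastforce)
qed

lemma ent_lower: "(\<lambda>x. {i. q i = a x \<and> P x}) \<tturnstile> (\<lambda>x. Q (a x) (a x) \<^bold>\<and>\<^bsub>T\<^esub> tv (P x))"
  by (intro ent_conjI) (rule ent_mono, auto simp: Q_eq tv_def)+

text \<open>\<open>Q a b\<close> is empty unless a = b, so extensionality is realized by returning
  the realizer of membership.\<close>

lemma ent_pow_refl:
  assumes "(\<lambda>z. L (fst z) (snd z)) \<tturnstile> (\<lambda>z. Q (snd z) (snd z))"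
  shows "\<Phi> \<tturnstile> (\<lambda>x. pow_obj T Q (L x) (L x))"
proof -
  have strict: "\<Phi> \<tturnstile> (\<lambda>x. tall T (\<lambda>a. L x a \<^bold>\<longrightarrow>\<^bsub>T\<^esub> Q a a))"
    by (intro ent_allI ent_impI ent_weak2 assms)
  have "(\<lambda>z. L (fst (fst z)) (snd (fst z)) \<^bold>\<and>\<^bsub>T\<^esub> Q (snd (fst z)) (snd z)) \<tturnstile>
      (\<lambda>z. L (fst (fst z)) (snd (fst z)) \<otimes> Q (snd (fst z)) (snd z))"
    by (intro ent_tensor conj_ent1 conj_ent2)
  also have "\<dots> \<tturnstile> (\<lambda>z. L (fst (fst z)) (snd z))"
    by (rule entI[OF pcomp_Some[OF tcomp_pfst[OF tcomp_id]]]) (auto simp: tensor_def rat_obj_def)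
  finally have ext: "\<Phi> \<tturnstile> (\<lambda>x. tall T (\<lambda>a. tall T (\<lambda>b. L x a \<^bold>\<and>\<^bsub>T\<^esub> Q a b \<^bold>\<longrightarrow>\<^bsub>T\<^esub> L x b)))"
    by (intro ent_allI ent_impI ent_weak2)
  have "\<Phi> \<tturnstile> (\<lambda>x. tall T (\<lambda>a. L x a \<^bold>\<longleftrightarrow>\<^bsub>T\<^esub> L x a))"
    unfolding tiff_def by (intro ent_allI ent_conjI ent_impI ent_snd)
  with strict ext show ?thesis unfolding pow_obj_def by (intro ent_conjI)
qed

lemma ent_real_cut: "(\<lambda>n. {n}) \<tturnstile> (\<lambda>n. dedekind_cut T Q (real_cut (\<mu> n)))"
proof -
  \<comment> \<open>All \<mu> n lie in [0,1], so -1 and, for the upper cut, 2 are strict bounds with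
    a constant index for all n.\<close>
  have ex1: "(\<lambda>n. {n}) \<tturnstile> (\<lambda>n. ex_in T Q (\<lambda>a. Q a a \<^bold>\<and>\<^bsub>T\<^esub> tv (of_rat a < \<mu> n)))"
  proof (rule ent_ex_inI'[of _ _ "\<lambda>_. -1"])
    obtain i where i: "q i = -1" using q_surj by blast
    show *: "(\<lambda>n. {n}) \<tturnstile> (\<lambda>n. Q (-1) (-1))" by (rule ent_const[of _ i]) (simp add: Q_eq i)
    have "real_of_rat (-1) < \<mu> n" for n using \<mu>_bounds(1)[of n] by simp
    then show "(\<lambda>n. {n}) \<tturnstile> (\<lambda>n. Q (-1) (-1) \<^bold>\<and>\<^bsub>T\<^esub> tv (of_rat (-1) < \<mu> n))"
      by (intro ent_conjI * ent_mono) (simp add: tv_def)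
  qed
  have ex2: "(\<lambda>n. {n}) \<tturnstile> (\<lambda>n. ex_in T Q (\<lambda>a. Q a a \<^bold>\<and>\<^bsub>T\<^esub> tv (\<mu> n < of_rat a)))"
  proof (rule ent_ex_inI'[of _ _ "\<lambda>_. 2"])
    obtain i where i: "q i = 2" using q_surj by blast
    show *: "(\<lambda>n. {n}) \<tturnstile> (\<lambda>n. Q 2 2)" by (rule ent_const[of _ i]) (simp add: Q_eq i)
    have "\<mu> n < real_of_rat 2" for n using \<mu>_bounds(2)[of n] by simp
    then show "(\<lambda>n. {n}) \<tturnstile> (\<lambda>n. Q 2 2 \<^bold>\<and>\<^bsub>T\<^esub> tv (\<mu> n < of_rat 2))"
      by (intro ent_conjI * ent_mono) (simp add: tv_def)
  qed
  have fromL: "(\<lambda>z. Q (snd z) (snd z) \<^bold>\<and>\<^bsub>T\<^esub> tv (P z)) \<tturnstile> (\<lambda>z. {i. q i = snd z \<and> P z})" for P :: "nat \<times> rat \<Rightarrow> bool"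
  proof -
    have "(\<lambda>z. Q (snd z) (snd z) \<^bold>\<and>\<^bsub>T\<^esub> tv (P z)) \<tturnstile> (\<lambda>z. Q (snd z) (snd z) \<otimes> tv (P z))"
      by (intro ent_tensor conj_ent1 conj_ent2)
    also have "\<dots> \<tturnstile> (\<lambda>z. {i. q i = snd z \<and> P z})"
      by (rule entI[OF pcomp_Some[OF tcomp_pfst[OF tcomp_id]]]) (auto simp: tensor_def Q_eq tv_def split: if_splits)
    finally show ?thesis .
  qed
  \<comment> \<open>The index j produced by a search serves both as the realizer and, through
    \<open>q j\<close>, as the choice of the witness b.\<close>
  have wit: "(\<lambda>z. {j. P1 z (q j) \<and> P2 z (q j)}) \<tturnstile>
     (\<lambda>z. \<Union>b. Q b b \<otimes> (tv (P1 z b) \<^bold>\<and>\<^bsub>T\<^esub> (Q b b \<^bold>\<and>\<^bsub>T\<^esub> tv (P2 z b))))" for P1 P2 :: "nat \<times> rat \<Rightarrow> rat \<Rightarrow> bool"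
  proof -
    have "(\<lambda>z. {j. P1 z (q j) \<and> P2 z (q j)}) \<tturnstile> (\<lambda>z. \<Union>b. {j. q j = b \<and> P1 z b \<and> P2 z b})"
      by (rule ent_mono) auto
    also have "\<dots> \<tturnstile> (\<lambda>z. \<Union>b. Q b b \<otimes> (tv (P1 z b) \<^bold>\<and>\<^bsub>T\<^esub> (Q b b \<^bold>\<and>\<^bsub>T\<^esub> tv (P2 z b))))"
      by (rule ent_Union_mono, intro ent_tensor ent_conjI) (rule ent_mono, auto simp: Q_eq tv_def)+
    finally show ?thesis .
  qed
  have round1: "(\<lambda>n. {n}) \<tturnstile> (\<lambda>n. all_in T Q (\<lambda>a. Q a a \<^bold>\<and>\<^bsub>T\<^esub> tv (of_rat a < \<mu> n) \<^bold>\<longleftrightarrow>\<^bsub>T\<^esub>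
      ex_in T Q (\<lambda>b. tv (a < b) \<^bold>\<and>\<^bsub>T\<^esub> (Q b b \<^bold>\<and>\<^bsub>T\<^esub> tv (of_rat b < \<mu> n)))))"
    unfolding tiff_def
  proof (intro ent_all_inI ent_conjI ent_impI)
    have "(\<lambda>z. ({fst z} \<otimes> Q (snd z) (snd z)) \<otimes> (Q (snd z) (snd z) \<^bold>\<and>\<^bsub>T\<^esub> tv (of_rat (snd z) < \<mu> (fst z)))) \<tturnstile>
      (\<lambda>z. {fst z} \<otimes> {i. q i = snd z \<and> of_rat (snd z) < \<mu> (fst z)})"
      by (intro ent_tensor ent_weak1[OF ent_fst] ent_weak2 fromL)
    from ent_trans[OF ent_trans[OF this ent_above] wit]
    show "(\<lambda>z. ({fst z} \<otimes> Q (snd z) (snd z)) \<otimes> (Q (snd z) (snd z) \<^bold>\<and>\<^bsub>T\<^esub> tv (of_rat (snd z) < \<mu> (fst z)))) \<tturnstile>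
      (\<lambda>z. ex_in T Q (\<lambda>b. tv (snd z < b) \<^bold>\<and>\<^bsub>T\<^esub> (Q b b \<^bold>\<and>\<^bsub>T\<^esub> tv (of_rat b < \<mu> (fst z)))))"
      by (rule ent_ex_inI)
    show "(\<lambda>z. ({fst z} \<otimes> Q (snd z) (snd z)) \<otimes> ex_in T Q (\<lambda>b. tv (snd z < b) \<^bold>\<and>\<^bsub>T\<^esub> (Q b b \<^bold>\<and>\<^bsub>T\<^esub> tv (of_rat b < \<mu> (fst z)))))
        \<tturnstile> (\<lambda>z. Q (snd z) (snd z))"
      by (intro ent_weak1 ent_snd)
    show "(\<lambda>z. ({fst z} \<otimes> Q (snd z) (snd z)) \<otimes> ex_in T Q (\<lambda>b. tv (snd z < b) \<^bold>\<and>\<^bsub>T\<^esub> (Q b b \<^bold>\<and>\<^bsub>T\<^esub> tv (of_rat b < \<mu> (fst z)))))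
        \<tturnstile> (\<lambda>z. tv (of_rat (snd z) < \<mu> (fst z)))"
    proof (rule ent_const[of _ 0])
      fix z :: "nat \<times> rat"
      assume "({fst z} \<otimes> Q (snd z) (snd z)) \<otimes> ex_in T Q (\<lambda>b. tv (snd z < b) \<^bold>\<and>\<^bsub>T\<^esub> (Q b b \<^bold>\<and>\<^bsub>T\<^esub> tv (of_rat b < \<mu> (fst z)))) \<noteq> {}"
      then have "ex_in T Q (\<lambda>b. tv (snd z < b) \<^bold>\<and>\<^bsub>T\<^esub> (Q b b \<^bold>\<and>\<^bsub>T\<^esub> tv (of_rat b < \<mu> (fst z)))) \<noteq> {}"
        by (auto simp: tensor_def)
      then obtain b where "snd z < b" "of_rat b < \<mu> (fst z)" by (auto simp: nonempty_iffs)
      then show "0 \<in> tv (of_rat (snd z) < \<mu> (fst z))"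
        using of_rat_less[of "snd z" b, where 'a = real] by (simp add: tv_def)
    qed
  qed
  have round2: "(\<lambda>n. {n}) \<tturnstile> (\<lambda>n. all_in T Q (\<lambda>a. Q a a \<^bold>\<and>\<^bsub>T\<^esub> tv (\<mu> n < of_rat a) \<^bold>\<longleftrightarrow>\<^bsub>T\<^esub>
      ex_in T Q (\<lambda>b. tv (b < a) \<^bold>\<and>\<^bsub>T\<^esub> (Q b b \<^bold>\<and>\<^bsub>T\<^esub> tv (\<mu> n < of_rat b)))))"
    unfolding tiff_def
  proof (intro ent_all_inI ent_conjI ent_impI)
    have "(\<lambda>z. ({fst z} \<otimes> Q (snd z) (snd z)) \<otimes> (Q (snd z) (snd z) \<^bold>\<and>\<^bsub>T\<^esub> tv (\<mu> (fst z) < of_rat (snd z)))) \<tturnstile>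
      (\<lambda>z. {fst z} \<otimes> {i. q i = snd z \<and> \<mu> (fst z) < of_rat (snd z)})"
      by (intro ent_tensor ent_weak1[OF ent_fst] ent_weak2 fromL)
    from ent_trans[OF ent_trans[OF this ent_below] wit]
    show "(\<lambda>z. ({fst z} \<otimes> Q (snd z) (snd z)) \<otimes> (Q (snd z) (snd z) \<^bold>\<and>\<^bsub>T\<^esub> tv (\<mu> (fst z) < of_rat (snd z)))) \<tturnstile>
      (\<lambda>z. ex_in T Q (\<lambda>b. tv (b < snd z) \<^bold>\<and>\<^bsub>T\<^esub> (Q b b \<^bold>\<and>\<^bsub>T\<^esub> tv (\<mu> (fst z) < of_rat b))))"
      by (rule ent_ex_inI)
    show "(\<lambda>z. ({fst z} \<otimes> Q (snd z) (snd z)) \<otimes> ex_in T Q (\<lambda>b. tv (b < snd z) \<^bold>\<and>\<^bsub>T\<^esub> (Q b b \<^bold>\<and>\<^bsub>T\<^esub> tv (\<mu> (fst z) < of_rat b))))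
        \<tturnstile> (\<lambda>z. Q (snd z) (snd z))"
      by (intro ent_weak1 ent_snd)
    show "(\<lambda>z. ({fst z} \<otimes> Q (snd z) (snd z)) \<otimes> ex_in T Q (\<lambda>b. tv (b < snd z) \<^bold>\<and>\<^bsub>T\<^esub> (Q b b \<^bold>\<and>\<^bsub>T\<^esub> tv (\<mu> (fst z) < of_rat b))))
        \<tturnstile> (\<lambda>z. tv (\<mu> (fst z) < of_rat (snd z)))"
    proof (rule ent_const[of _ 0])
      fix z :: "nat \<times> rat"
      assume "({fst z} \<otimes> Q (snd z) (snd z)) \<otimes> ex_in T Q (\<lambda>b. tv (b < snd z) \<^bold>\<and>\<^bsub>T\<^esub> (Q b b \<^bold>\<and>\<^bsub>T\<^esub> tv (\<mu> (fst z) < of_rat b))) \<noteq> {}"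
      then have "ex_in T Q (\<lambda>b. tv (b < snd z) \<^bold>\<and>\<^bsub>T\<^esub> (Q b b \<^bold>\<and>\<^bsub>T\<^esub> tv (\<mu> (fst z) < of_rat b))) \<noteq> {}"
        by (auto simp: tensor_def)
      then obtain b where "b < snd z" "\<mu> (fst z) < of_rat b" by (auto simp: nonempty_iffs)
      then show "0 \<in> tv (\<mu> (fst z) < of_rat (snd z))"
        using of_rat_less[of b "snd z", where 'a = real] by (simp add: tv_def)
    qed
  qed
  have disj: "(\<lambda>n. {n}) \<tturnstile> (\<lambda>n. all_in T Q (\<lambda>a. \<^bold>\<not>\<^bsub>T\<^esub> ((Q a a \<^bold>\<and>\<^bsub>T\<^esub> tv (of_rat a < \<mu> n)) \<^bold>\<and>\<^bsub>T\<^esub>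
      (Q a a \<^bold>\<and>\<^bsub>T\<^esub> tv (\<mu> n < of_rat a)))))"
  proof (intro ent_all_inI ent_mono)
    have "(A \<^bold>\<and>\<^bsub>T\<^esub> tv (x < y)) \<^bold>\<and>\<^bsub>T\<^esub> (B \<^bold>\<and>\<^bsub>T\<^esub> tv (y < x)) = {}" for x y :: real and A B
      by (rule ccontr) (auto simp: nonempty_iffs)
    then show "{fst z} \<otimes> Q (snd z) (snd z) \<subseteq> \<^bold>\<not>\<^bsub>T\<^esub> ((Q (snd z) (snd z) \<^bold>\<and>\<^bsub>T\<^esub> tv (of_rat (snd z) < \<mu> (fst z))) \<^bold>\<and>\<^bsub>T\<^esub>
      (Q (snd z) (snd z) \<^bold>\<and>\<^bsub>T\<^esub> tv (\<mu> (fst z) < of_rat (snd z))))" for z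
      unfolding tnot_eq by simp
  qed
  have loc: "(\<lambda>n. {n}) \<tturnstile> (\<lambda>n. all_in T Q (\<lambda>a. all_in T Q (\<lambda>b. tv (a < b) \<^bold>\<longrightarrow>\<^bsub>T\<^esub>
      ((Q a a \<^bold>\<and>\<^bsub>T\<^esub> tv (of_rat a < \<mu> n)) \<^bold>\<or>\<^bsub>T\<^esub> (Q b b \<^bold>\<and>\<^bsub>T\<^esub> tv (\<mu> n < of_rat b))))))"
  proof (intro ent_all_inI ent_impI)
    let ?\<Phi> = "\<lambda>z. (({fst (fst z)} \<otimes> Q (snd (fst z)) (snd (fst z))) \<otimes> Q (snd z) (snd z)) \<otimes> tv (snd (fst z) < snd z)"
    let ?L = "\<lambda>z. Q (snd (fst z)) (snd (fst z)) \<^bold>\<and>\<^bsub>T\<^esub> tv (of_rat (snd (fst z)) < \<mu> (fst (fst z)))"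
    let ?U = "\<lambda>z. Q (snd z) (snd z) \<^bold>\<and>\<^bsub>T\<^esub> tv (\<mu> (fst (fst z)) < of_rat (snd z))"
    have "?\<Phi> \<tturnstile> (\<lambda>z. {i. q i = snd (fst z) \<and> of_rat (snd (fst z)) < \<mu> (fst (fst z))} \<oplus>
       {j. q j = snd z \<and> \<mu> (fst (fst z)) < of_rat (snd z)})"
    proof (rule ent_decide)
      show "?\<Phi> z \<noteq> {} \<Longrightarrow> snd (fst z) < snd z" for z by (auto simp: tensor_def tv_def)
    qed (intro ent_weak1 ent_fst ent_snd)+
    also have "\<dots> \<tturnstile> (\<lambda>z. ?L z \<oplus> ?U z)" by (intro ent_tagged_mono ent_lower)
    also have "\<dots> \<tturnstile> (\<lambda>z. ?L z \<^bold>\<or>\<^bsub>T\<^esub> ?U z)" by (rule tagged_disj)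
    finally show "?\<Phi> \<tturnstile> (\<lambda>z. ?L z \<^bold>\<or>\<^bsub>T\<^esub> ?U z)" .
  qed
  show ?thesis
    unfolding dedekind_cut_def real_cut_def prod.case
    by (intro ent_conjI ex1 ex2 round1 round2 disj loc)
qed

text \<open>Beyond being a Dedekind real, membership in I asks for two negations, for which the
  classical bounds on \<mu> n suffice.\<close>

lemma ent_real_interval: "(\<lambda>n. {n}) \<tturnstile> (\<lambda>n. I (real_cut (\<mu> n)) (real_cut (\<mu> n)))"
proof -
  have le: "cut_less T Q (real_cut x) (real_cut y) = {}" if "y \<le> x" for x y
    by (rule ccontr) (use that in \<open>auto simp: cut_less_def real_cut_def nonempty_iffs\<close>)
  have "(\<lambda>n. {n}) \<tturnstile> (\<lambda>n. R (real_cut (\<mu> n)) (real_cut (\<mu> n)))"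
    unfolding dedekind_obj_def sub_obj_def prod_obj_def
  proof (intro ent_conjI ent_real_cut ent_pow_refl)
    show "(\<lambda>z. fst (real_cut (\<mu> (fst z))) (snd z)) \<tturnstile> (\<lambda>z. Q (snd z) (snd z))"
      "(\<lambda>z. snd (real_cut (\<mu> (fst z))) (snd z)) \<tturnstile> (\<lambda>z. Q (snd z) (snd z))"
      by (simp_all add: real_cut_def conj_ent1)
  qed
  moreover have "(\<lambda>n. {n}) \<tturnstile> (\<lambda>n. cut_le T Q (rat_cut T Q 0) (real_cut (\<mu> n)))"
    by (rule ent_mono) (simp add: cut_le_def rat_cut_eq tnot_eq le \<mu>_bounds)
  moreover have "(\<lambda>n. {n}) \<tturnstile> (\<lambda>n. cut_le T Q (real_cut (\<mu> n)) (rat_cut T Q 1))"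
    by (rule ent_mono) (simp add: cut_le_def rat_cut_eq tnot_eq le \<mu>_bounds)
  ultimately show ?thesis unfolding unit_interval_obj_def sub_obj_def by (intro ent_conjI)
qed

end

section \<open>Real values of Dedekind cuts\<close>

text \<open>The classical real behind a cut of the topos, with inhabited truth values read as
  true.\<close>

definition cut_value :: "nat cut \<Rightarrow> real \<Rightarrow> bool" where
  "cut_value y v \<longleftrightarrow> (\<forall>a. (fst y a \<noteq> {} \<longleftrightarrow> of_rat a < v) \<and> (snd y a \<noteq> {} \<longleftrightarrow> v < of_rat a))"

lemma ex_cut_value:
  fixes L U :: "rat \<Rightarrow> bool"
  assumes ex: "\<exists>a. L a" "\<exists>b. U b"
    and L: "\<And>a. L a \<longleftrightarrow> (\<exists>b>a. L b)" and U: "\<And>b. U b \<longleftrightarrow> (\<exists>a<b. U a)"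
    and disj: "\<And>a. \<not> (L a \<and> U a)" and loc: "\<And>a b. a < b \<Longrightarrow> L a \<or> U b"
  shows "\<exists>v :: real. \<forall>a. (L a \<longleftrightarrow> of_rat a < v) \<and> (U a \<longleftrightarrow> v < of_rat a)"
proof -
  define S where "S = (of_rat :: rat \<Rightarrow> real) ` Collect L"
  define v where "v = Sup S"
  have less: "a < b" if "L a" "U b" for a b
    using that L[of b] disj by (metis not_less_iff_gr_or_eq)
  obtain b0 where "U b0" using ex(2) by blast
  then have bdd: "bdd_above S"
    unfolding S_def by (intro bdd_aboveI[of _ "of_rat b0"]) (auto simp: of_rat_less_eq dest: less)
  have ne: "S \<noteq> {}" using ex(1) by (auto simp: S_def)
  have upper: "of_rat a \<le> v" if "L a" for a
    unfolding v_def using that by (intro cSup_upper bdd) (auto simp: S_def)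
  have "L a \<longleftrightarrow> of_rat a < v" for a
  proof
    assume "L a"
    then obtain b where b: "a < b" "L b" using L by blast
    have "real_of_rat a < of_rat b" using b(1) by (simp add: of_rat_less)
    with upper[OF b(2)] show "of_rat a < v" by linarith
  next
    assume "of_rat a < v"
    then obtain c where "L c" "a < c"
      unfolding v_def using less_cSup_iff[OF ne bdd] by (auto simp: S_def of_rat_less)
    then show "L a" using L by blast
  qed
  moreover have "U b \<longleftrightarrow> v < of_rat b" for b
  proof
    assume "U b"
    then obtain a where a: "a < b" "U a" using U by blast
    have "v \<le> of_rat a" unfolding v_def
      using less[OF _ a(2)] by (intro cSup_least ne) (auto simp: S_def of_rat_less_eq order_less_imp_le dest: less)
    moreover have "real_of_rat a < of_rat b" using a(1) by (simp add: of_rat_less)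
    ultimately show "v < of_rat b" by linarith
  next
    assume "v < of_rat b"
    then obtain c where c: "v < of_rat c" "real_of_rat c < of_rat b" using of_rat_dense by blast
    then have "\<not> L c" using upper[of c] by auto
    then show "U b" using loc[of c b] c(2) by (auto simp: of_rat_less)
  qed
  ultimately show ?thesis by blast
qed

context miller
begin

text \<open>The component of a cut from which approximations to its value are computed.\<close>

definition located :: "nat cut \<Rightarrow> nat set" where
  "located y = all_in T Q (\<lambda>a. all_in T Q (\<lambda>b. tv (a < b) \<^bold>\<longrightarrow>\<^bsub>T\<^esub> (fst y a \<^bold>\<or>\<^bsub>T\<^esub> snd y b)))"

lemma dedekind_cut_value: "dedekind_cut T Q y \<noteq> {} \<Longrightarrow> \<exists>v. cut_value y v"
proof -
  obtain L U where y: "y = (L, U)" by (cases y)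
  assume "dedekind_cut T Q y \<noteq> {}"
  then have ne: "ex_in T Q L \<noteq> {}" "ex_in T Q U \<noteq> {}"
    "all_in T Q (\<lambda>a. L a \<^bold>\<longleftrightarrow>\<^bsub>T\<^esub> ex_in T Q (\<lambda>b. tv (a < b) \<^bold>\<and>\<^bsub>T\<^esub> L b)) \<noteq> {}"
    "all_in T Q (\<lambda>b. U b \<^bold>\<longleftrightarrow>\<^bsub>T\<^esub> ex_in T Q (\<lambda>a. tv (a < b) \<^bold>\<and>\<^bsub>T\<^esub> U a)) \<noteq> {}"
    "all_in T Q (\<lambda>a. \<^bold>\<not>\<^bsub>T\<^esub> (L a \<^bold>\<and>\<^bsub>T\<^esub> U a)) \<noteq> {}"
    "all_in T Q (\<lambda>a. all_in T Q (\<lambda>b. tv (a < b) \<^bold>\<longrightarrow>\<^bsub>T\<^esub> (L a \<^bold>\<or>\<^bsub>T\<^esub> U b))) \<noteq> {}"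
    unfolding dedekind_cut_def y prod.case tconj_nonempty by blast+
  have at: "all_in T Q \<phi> \<noteq> {} \<Longrightarrow> \<phi> a \<noteq> {}" for \<phi> and a :: rat
    using all_in_nonempty[where X = Q and x = a] Q_nonempty by blast
  have "\<exists>v :: real. \<forall>a. (L a \<noteq> {} \<longleftrightarrow> of_rat a < v) \<and> (U a \<noteq> {} \<longleftrightarrow> v < of_rat a)"
  proof (rule ex_cut_value)
    show "\<exists>a. L a \<noteq> {}" "\<exists>b. U b \<noteq> {}" using ne(1,2) by (auto simp: ex_in_nonempty)
    show "L a \<noteq> {} \<longleftrightarrow> (\<exists>b>a. L b \<noteq> {})" for a
      using tiff_nonempty[OF at[OF ne(3), of a]] by (simp add: nonempty_iffs Q_nonempty)
    show "U b \<noteq> {} \<longleftrightarrow> (\<exists>a<b. U a \<noteq> {})" for b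
      using tiff_nonempty[OF at[OF ne(4), of b]] by (simp add: nonempty_iffs Q_nonempty)
    show "\<not> (L a \<noteq> {} \<and> U a \<noteq> {})" for a
      using at[OF ne(5), of a] by (auto simp: tnot_eq tconj_nonempty[symmetric] split: if_splits)
    show "L a \<noteq> {} \<or> U b \<noteq> {}" if "a < b" for a b
      using timp_nonempty[OF at[OF at[OF ne(6), of a], of b]] that by (auto simp: nonempty_iffs)
  qed
  then show ?thesis by (simp add: cut_value_def y)
qed

lemma R_eq: "R y y' = (pow_obj T Q (fst y) (fst y') \<^bold>\<and>\<^bsub>T\<^esub> pow_obj T Q (snd y) (snd y')) \<^bold>\<and>\<^bsub>T\<^esub> dedekind_cut T Q y"
  by (simp add: dedekind_obj_def sub_obj_def prod_obj_def)

lemma R_value: "R y y' \<noteq> {} \<Longrightarrow> \<exists>v. cut_value y v"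
  by (rule dedekind_cut_value) (simp add: R_eq tconj_nonempty)

lemma R_same_value: "R y y' \<noteq> {} \<Longrightarrow> cut_value y v \<Longrightarrow> cut_value y' v"
proof -
  assume "R y y' \<noteq> {}"
  then have "tall T (\<lambda>x. fst y x \<^bold>\<longleftrightarrow>\<^bsub>T\<^esub> fst y' x) \<noteq> {}" "tall T (\<lambda>x. snd y x \<^bold>\<longleftrightarrow>\<^bsub>T\<^esub> snd y' x) \<noteq> {}"
    unfolding R_eq pow_obj_def tconj_nonempty by blast+
  then have "fst y a \<noteq> {} \<longleftrightarrow> fst y' a \<noteq> {}" "snd y a \<noteq> {} \<longleftrightarrow> snd y' a \<noteq> {}" for a
    using tiff_nonempty[OF tall_nonempty[of "\<lambda>x. fst y x \<^bold>\<longleftrightarrow>\<^bsub>T\<^esub> fst y' x"]]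
      tiff_nonempty[OF tall_nonempty[of "\<lambda>x. snd y x \<^bold>\<longleftrightarrow>\<^bsub>T\<^esub> snd y' x"]] by blast+
  then show "cut_value y v \<Longrightarrow> cut_value y' v" by (simp add: cut_value_def)
qed

lemma cut_value_real_cut: "cut_value (real_cut x) x"
  by (simp add: cut_value_def real_cut_def tconj_nonempty tv_nonempty Q_nonempty)

lemma ent_located: "(\<lambda>x. R (y x) (y' x)) \<tturnstile> (\<lambda>x. located (y x))"
proof -
  have "(\<lambda>x. R (y x) (y' x)) \<tturnstile> (\<lambda>x. dedekind_cut T Q (y x))"
    unfolding R_eq by (rule conj_ent2)
  then show ?thesis
    unfolding dedekind_cut_def located_def case_prod_beta
    by (rule ent_conjE2[OF ent_conjE2[OF ent_conjE2[OF ent_conjE2[OF ent_conjE2]]]])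
qed

lemma ent_located_at:
  assumes "\<Phi> \<tturnstile> (\<lambda>x. located (y x))" "\<And>x. \<Phi> x \<noteq> {} \<Longrightarrow> a x < b x"
    "\<Phi> \<tturnstile> (\<lambda>x. Q (a x) (a x))" "\<Phi> \<tturnstile> (\<lambda>x. Q (b x) (b x))"
  shows "\<Phi> \<tturnstile> (\<lambda>x. fst (y x) (a x) \<oplus> snd (y x) (b x))"
proof -
  have "\<Phi> \<tturnstile> (\<lambda>x. tv (a x < b x))" by (rule ent_const[of _ 0]) (use assms(2) in \<open>simp add: tv_def\<close>)
  from ent_trans[OF ent_impE[OF ent_all_inE[OF ent_all_inE[OF assms(1)[unfolded located_def] assms(3)] assms(4)] this]
      disj_tagged]
  show ?thesis .
qed

subsection \<open>Deciding approximate comparisons\<close>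

text \<open>Only the tags of locatedness are kept. The number e is the same for all oracles, but
  where both alternatives are true its answer may vary with the oracle.\<close>

definition decides :: "real \<Rightarrow> nat set" where
  "decides v = {e. \<forall>\<alpha>\<in>M. \<forall>i j. q i < q j \<longrightarrow>
     (\<exists>t. phi \<alpha> e (pe i j) = Some t \<and> (if t = 0 then of_rat (q i) < v else v < of_rat (q j)))}"

definition reps :: "real \<Rightarrow> nat set" where
  "reps x = {e. index_represents q \<mu> e x}"

lemma ent_decides:
  assumes "\<Phi> \<tturnstile> (\<lambda>x. located (y x))" "\<And>x. \<Phi> x \<noteq> {} \<Longrightarrow> cut_value (y x) (v x)"
  shows "\<Phi> \<tturnstile> (\<lambda>x. decides (v x))"
proof -
  \<comment> \<open>The rationals join the index set and their indices the realizer; currying the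
    resulting program at l gives one that answers all pairs i, j.\<close>
  let ?\<Phi> = "\<lambda>z. {p. fst (snd z) < snd (snd z) \<and>
    p \<in> \<Phi> (fst z) \<otimes> (Q (fst (snd z)) (fst (snd z)) \<otimes> Q (snd (snd z)) (snd (snd z)))}"
  have sub: "?\<Phi> \<tturnstile> (\<lambda>z. \<Phi> (fst z) \<otimes> (Q (fst (snd z)) (fst (snd z)) \<otimes> Q (snd (snd z)) (snd (snd z))))"
    by (rule ent_mono) blast
  have "?\<Phi> \<tturnstile> (\<lambda>z. fst (y (fst z)) (fst (snd z)) \<oplus> snd (y (fst z)) (snd (snd z)))"
  proof (rule ent_located_at)
    show "?\<Phi> \<tturnstile> (\<lambda>z. located (y (fst z)))"
      by (rule ent_trans[OF sub]) (intro ent_weak1 ent_subst[OF assms(1)])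
    show "?\<Phi> \<tturnstile> (\<lambda>z. Q (fst (snd z)) (fst (snd z)))"
      by (rule ent_trans[OF sub]) (intro ent_weak2[OF ent_fst])
    show "?\<Phi> \<tturnstile> (\<lambda>z. Q (snd (snd z)) (snd (snd z)))"
      by (rule ent_trans[OF sub]) (intro ent_weak2[OF ent_snd])
  qed auto
  then obtain F where F: "pcomp F" "\<And>z p \<alpha>. p \<in> ?\<Phi> z \<Longrightarrow> \<alpha> \<in> M \<Longrightarrow>
     \<exists>c\<in>fst (y (fst z)) (fst (snd z)) \<oplus> snd (y (fst z)) (snd (snd z)). F \<alpha> p = Some c" by (elim entD) blast
  have "pcomp (\<lambda>\<alpha> p. Option.bind (F \<alpha> p) (\<lambda>c. Some (pfst c)))"
    by (intro pcomp_bind pcomp_Some F tcomp_basic)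
  from pcomp_index[OF this] obtain e where e: "\<And>\<alpha> p. phi \<alpha> e p = Option.bind (F \<alpha> p) (\<lambda>c. Some (pfst c))" by blast
  have "pcomp (\<lambda>\<alpha> n. Some (curry_index e n))" by (intro pcomp_Some tcomp_curry_index tcomp_basic)
  then show ?thesis
  proof (rule entI)
    fix x l \<alpha> assume l: "l \<in> \<Phi> x"
    have "curry_index e l \<in> decides (v x)"
      unfolding decides_def
    proof (intro CollectI ballI allI impI)
      fix \<beta> i j assume \<beta>: "\<beta> \<in> M" and ij: "q i < q j"
      have "pe l (pe i j) \<in> ?\<Phi> (x, q i, q j)" using l ij by (auto simp: tensor_def Q_eq)
      from F(2)[OF this \<beta>] obtain c where c: "c \<in> fst (y x) (q i) \<oplus> snd (y x) (q j)"
        "F \<beta> (pe l (pe i j)) = Some c" by auto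
      have val: "cut_value (y x) (v x)" using l assms(2) by blast
      have "if pfst c = 0 then of_rat (q i) < v x else v x < of_rat (q j)"
        using c(1) val unfolding cut_value_def by (fastforce simp: tagged_def)
      then show "\<exists>t. phi \<beta> (curry_index e l) (pe i j) = Some t \<and>
         (if t = 0 then of_rat (q i) < v x else v x < of_rat (q j))"
        by (simp add: phi_curry_index e c(2))
    qed
    then show "\<exists>c\<in>decides (v x). Some (curry_index e l) = Some c" by simp
  qed
qed

text \<open>Counting the points of a grid of step \<open>1 / N\<close> on \<open>[-1, 1]\<close> that are found to lie below \<open>v\<close>
  needs no search and gives \<open>v\<close> up to \<open>1 / N\<close>, whatever the oracle decides near \<open>v\<close>.\<close>

lemma ent_reps: "(\<lambda>z. {fst z} \<otimes> decides (snd z)) \<tturnstile> (\<lambda>z. reps (clip 0 1 (\<mu> (fst z) - clip (-1) 1 (snd z))))"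
proof -
  \<comment> \<open>The argument p codes ((n, d), k) with d deciding v. The total error is below 2 /
    N, which is 2^-k for N = 2^(k+1).\<close>
  define N :: "nat \<Rightarrow> nat" where "N p = 2 ^ Suc (psnd p)" for p
  \<comment> \<open>\<open>rat_index i N N\<close> is the index of -1 + i / N, so the i below 2N
    enumerate the grid.\<close>
  define cnt where "cnt = (\<lambda>\<alpha> p m. rec_nat (Some 0) (\<lambda>i r. Option.bind r (\<lambda>c.
    Option.bind (phi \<alpha> (psnd (pfst p)) (pe (rat_index i (N p) (N p)) (rat_index (Suc i) (N p) (N p))))
     (\<lambda>t. Some (if t = 0 then Suc c else c)))) m)"
  \<comment> \<open>The count c stands for c / N - 1 as an approximation to the truncated v, so
    \<mu> n minus it becomes (X + N - c) / N, with X the number formed by k + 1 digits.\<close>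
  define F where "F = (\<lambda>\<alpha> p. Option.bind (cnt \<alpha> p (2 * N p)) (\<lambda>c.
     Some (rat_index (if digits \<alpha> (pfst (pfst p)) (Suc (psnd p)) + N p - c < N p
       then digits \<alpha> (pfst (pfst p)) (Suc (psnd p)) + N p - c else N p) 0 (N p))))"
  have N: "tcomp f \<Longrightarrow> tcomp (\<lambda>\<alpha> n. N (f \<alpha> n))" for f unfolding N_def by (intro tcomp_intros)
  have N0: "N p > 0" for p by (simp add: N_def)
  have "pcomp F" unfolding F_def cnt_def
    by (intro pcomp_bind pcomp_rec pcomp_Some pcomp_phi tcomp_rat_index tcomp_digits N N0 tcomp_intros)
  from pcomp_index[OF this] obtain e where e: "\<And>\<alpha> p. phi \<alpha> e p = F \<alpha> p" by blast
  have "pcomp (\<lambda>\<alpha> n. Some (curry_index e n))" by (intro pcomp_Some tcomp_curry_index tcomp_basic)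
  then show ?thesis
  proof (rule entI)
    fix z p \<alpha>
    assume "p \<in> {fst z} \<otimes> decides (snd z)"
    then obtain d where p: "p = pe (fst z) d" and d: "d \<in> decides (snd z)" by (auto simp: tensor_def)
    then have pp: "pfst p = fst z" "psnd p = d" by simp_all
    let ?x = "clip 0 1 (\<mu> (fst z) - clip (-1) 1 (snd z))"
    have "\<exists>i. F \<beta> (pe p k) = Some i \<and> \<bar>?x - of_rat (q i)\<bar> < 1 / 2 ^ k" if \<beta>: "\<beta> \<in> M" for \<beta> k
    proof -
      let ?N = "N (pe p k)"
      let ?X = "digits \<beta> (fst z) (Suc k)"
      have N: "?N = 2 ^ Suc k" by (simp add: N_def)
      define t where "t i = the (phi \<beta> d (pe (rat_index i ?N ?N) (rat_index (Suc i) ?N ?N)))" for i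
      \<comment> \<open>In the variable (v + 1) * N, with v = \<open>snd z\<close>, the grid points
        become the integers required by \<open>count_approx\<close>.\<close>
      have step: "phi \<beta> d (pe (rat_index i ?N ?N) (rat_index (Suc i) ?N ?N)) = Some (t i) \<and>
         (if t i = 0 then real i < (snd z + 1) * ?N else (snd z + 1) * ?N < real i + 1)" for i
      proof -
        have "real_of_rat (q (rat_index i ?N ?N)) < of_rat (q (rat_index (Suc i) ?N ?N))"
          unfolding of_rat_q_rat_index using N0[of "pe p k"] by (intro divide_strict_right_mono) auto
        then have "q (rat_index i ?N ?N) < q (rat_index (Suc i) ?N ?N)" by (simp add: of_rat_less)
        with d \<beta> obtain s where s: "phi \<beta> d (pe (rat_index i ?N ?N) (rat_index (Suc i) ?N ?N)) = Some s"
          "if s = 0 then of_rat (q (rat_index i ?N ?N)) < snd z else snd z < of_rat (q (rat_index (Suc i) ?N ?N))"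
          unfolding decides_def by blast
        have "t i = s" by (simp add: t_def s)
        with s show ?thesis unfolding of_rat_q_rat_index using N0[of "pe p k"]
          by (auto simp: field_simps split: if_splits)
      qed
      have cnt: "cnt \<beta> (pe p k) m = Some (\<Sum>i<m. of_bool (t i = 0))" for m
        by (induction m) (simp_all add: cnt_def pp conjunct1[OF step])
      let ?c = "\<Sum>i<2 * ?N. of_bool (t i = 0) :: nat"
      have "F \<beta> (pe p k) = Some (rat_index (min (?X + ?N - ?c) ?N) 0 ?N)"
        by (auto simp: F_def cnt pp min_def)
      moreover have "\<bar>?x - real (min (?X + ?N - ?c) ?N) / ?N\<bar> < 2 / ?N"
      proof (rule clip_approx)
        show "real ?X / ?N \<le> \<mu> (fst z)" "\<mu> (fst z) \<le> (real ?X + 1) / ?N"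
          using digits_bounds[of \<beta> "fst z" "Suc k"] \<beta> by (simp_all add: N)
        show "\<bar>real ?c - clip 0 (real (2 * ?N)) ((snd z + 1) * ?N)\<bar> < 1"
          by (rule count_approx) (use step in \<open>auto split: if_splits\<close>)
      qed (rule N0)
      ultimately show ?thesis by (simp add: of_rat_q_rat_index N)
    qed
    then have "\<forall>\<beta>\<in>M. \<exists>g. \<forall>k. F \<beta> (pe p k) = Some (g k) \<and> \<bar>?x - of_rat (q (g k))\<bar> < 1 / 2 ^ k"
      by metis
    then have "curry_index e p \<in> reps ?x"
      unfolding reps_def index_represents_def represents_def mem_Collect_eq phi_curry_index e by blast
    then show "\<exists>c\<in>reps ?x. Some (curry_index e p) = Some c" by simp
  qed
qed

subsection \<open>The fixed point property\<close>

text \<open>Under one fixed oracle of \<open>M\<close> both reals are limits of the same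
  approximations. Without an oracle every index would represent every real.\<close>

lemma index_represents_unique:
  assumes "index_represents q \<mu> n x" "index_represents q \<mu> n y"
  shows "x = y"
proof -
  obtain \<alpha> where \<alpha>: "bin_seq \<alpha> = \<mu>" using representable by blast
  obtain g where g: "\<forall>k. phi \<alpha> n k = Some (g k)" "represents q g x"
    using assms(1) \<alpha> unfolding index_represents_def by blast
  obtain h where h: "\<forall>k. phi \<alpha> n k = Some (h k)" "represents q h y"
    using assms(2) \<alpha> unfolding index_represents_def by blast
  have "g = h" using g(1) h(1) by (auto simp: fun_eq_iff)
  then have close: "\<bar>x - y\<bar> < 2 / 2 ^ k" for k
    using g(2) h(2) abs_triangle_ineq4[of "x - of_rat (q (g k))" "y - of_rat (q (g k))"]
    unfolding represents_def by (smt (verit) add_divide_distrib)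
  show ?thesis
  proof (rule ccontr)
    assume "x \<noteq> y"
    then obtain k where "(1 / 2) ^ k < \<bar>x - y\<bar> / 2"
      using real_arch_pow_inv[of "\<bar>x - y\<bar> / 2" "1 / 2"] by auto
    with close[of k] show False by (simp add: power_one_over)
  qed
qed

text \<open>The program \<open>h b\<close> applies the given realizer to b and its own index n =
  \<open>h b\<close>, and runs the resulting index c. Although c may vary with the oracle, the real
  \<open>G x n\<close> does not, so n is an index to which the Miller property applies. The
  individual x is only accessible through its realizer b, which is why the recursion theorem carries
  a parameter.\<close>

lemma ent_fixed_point:
  assumes "(\<lambda>z. \<Phi> (fst z) \<otimes> {snd z}) \<tturnstile> (\<lambda>z. reps (G (fst z) (snd z)))"
    and "\<And>x n. G x n \<in> {0..1}"
  shows "\<Phi> \<tturnstile> (\<lambda>x. {n. \<mu> n = G x n})"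
proof -
  obtain F where F: "pcomp F" "\<And>z p \<alpha>. p \<in> \<Phi> (fst z) \<otimes> {snd z} \<Longrightarrow> \<alpha> \<in> M \<Longrightarrow>
     \<exists>c\<in>reps (G (fst z) (snd z)). F \<alpha> p = Some c" using assms(1) by (elim entD) blast
  have "pcomp (\<lambda>\<alpha> p. Option.bind (F \<alpha> (pe (psnd (pfst p)) (pfst (pfst p)))) (\<lambda>c. phi \<alpha> c (psnd p)))"
    by (intro pcomp_bind pcomp_phi pcomp_comp[OF F(1)] tcomp_basic)
  from recursion_theorem[OF this] obtain h where h: "tcomp (\<lambda>_. h)"
    "\<And>\<alpha> a k. phi \<alpha> (h a) k = Option.bind (F \<alpha> (pe a (h a))) (\<lambda>c. phi \<alpha> c k)" by (simp, blast)
  show ?thesis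
  proof (rule entI[OF pcomp_Some[OF h(1)]])
    fix x b \<alpha> assume b: "b \<in> \<Phi> x"
    have "index_represents q \<mu> (h b) (G x (h b))"
      unfolding index_represents_def
    proof (intro allI impI)
      fix \<beta> assume \<beta>: "bin_seq \<beta> = \<mu>"
      have "pe b (h b) \<in> \<Phi> (fst (x, h b)) \<otimes> {snd (x, h b)}" using b by (auto simp: tensor_def)
      from F(2)[OF this] \<beta> obtain c where "c \<in> reps (G x (h b))" "F \<beta> (pe b (h b)) = Some c" by auto
      then show "\<exists>g. (\<forall>k. phi \<beta> (h b) k = Some (g k)) \<and> represents q g (G x (h b))"
        using \<beta> unfolding h(2) reps_def index_represents_def by simp
    qed
    moreover from this have "index_represents q \<mu> (h b) (\<mu> (h b))"
      using miller assms(2) unfolding miller_sequence_def real_index_def by blast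
    ultimately have "\<mu> (h b) = G x (h b)" by (simp add: index_represents_unique)
    then show "\<exists>c\<in>{n. \<mu> n = G x n}. Some (h b) = Some c" by simp
  qed
qed

subsection \<open>Equality with zero\<close>

text \<open>For a < 0, locatedness at a and 0 has to choose the lower alternative, since
  \<open>snd (y x) 0\<close> is empty when the value is 0; this yields a realizer of
  \<open>fst (y x) a\<close>. The upper cut is symmetric. The query is possible because 0 is a
  rational and so has an index.\<close>

lemma ent_R_zero:
  assumes "\<Phi> \<tturnstile> (\<lambda>x. R (y x) (y x))" "\<And>x. \<Phi> x \<noteq> {} \<Longrightarrow> cut_value (y x) 0"
  shows "\<Phi> \<tturnstile> (\<lambda>x. R (y x) (rat_cut T Q 0))"
proof -
  have loc: "\<Phi> \<tturnstile> (\<lambda>x. located (y x))" using assms(1) ent_located by (rule ent_trans)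
  obtain i0 where i0: "q i0 = 0" using q_surj by blast
  have Q0: "\<Psi> \<tturnstile> (\<lambda>_. Q 0 0)" for \<Psi> :: "'y \<Rightarrow> nat set" by (rule ent_const[of _ i0]) (simp add: Q_eq i0)
  have tagged1: "(\<lambda>x. A x \<oplus> {}) \<tturnstile> A" and tagged2: "(\<lambda>x. {} \<oplus> A x) \<tturnstile> A" for A :: "'y \<Rightarrow> nat set"
    by (rule entI[OF pcomp_Some[OF tcomp_psnd[OF tcomp_id]]], auto simp: tagged_def)+
  have strictL: "\<Phi> \<tturnstile> (\<lambda>x. tall T (\<lambda>a. fst (y x) a \<^bold>\<longrightarrow>\<^bsub>T\<^esub> Q a a))"
    and extL: "\<Phi> \<tturnstile> (\<lambda>x. tall T (\<lambda>a. tall T (\<lambda>b. fst (y x) a \<^bold>\<and>\<^bsub>T\<^esub> Q a b \<^bold>\<longrightarrow>\<^bsub>T\<^esub> fst (y x) b)))"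
    and strictU: "\<Phi> \<tturnstile> (\<lambda>x. tall T (\<lambda>a. snd (y x) a \<^bold>\<longrightarrow>\<^bsub>T\<^esub> Q a a))"
    and extU: "\<Phi> \<tturnstile> (\<lambda>x. tall T (\<lambda>a. tall T (\<lambda>b. snd (y x) a \<^bold>\<and>\<^bsub>T\<^esub> Q a b \<^bold>\<longrightarrow>\<^bsub>T\<^esub> snd (y x) b)))"
    and cut: "\<Phi> \<tturnstile> (\<lambda>x. dedekind_cut T Q (y x))"
  proof -
    note all = assms(1)[unfolded R_eq pow_obj_def]
    note L = ent_conjE1[OF ent_conjE1[OF all]] and U = ent_conjE2[OF ent_conjE1[OF all]]
    show "\<Phi> \<tturnstile> (\<lambda>x. tall T (\<lambda>a. fst (y x) a \<^bold>\<longrightarrow>\<^bsub>T\<^esub> Q a a))" by (rule ent_conjE1[OF L])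
    show "\<Phi> \<tturnstile> (\<lambda>x. tall T (\<lambda>a. tall T (\<lambda>b. fst (y x) a \<^bold>\<and>\<^bsub>T\<^esub> Q a b \<^bold>\<longrightarrow>\<^bsub>T\<^esub> fst (y x) b)))"
      by (rule ent_conjE1[OF ent_conjE2[OF L]])
    show "\<Phi> \<tturnstile> (\<lambda>x. tall T (\<lambda>a. snd (y x) a \<^bold>\<longrightarrow>\<^bsub>T\<^esub> Q a a))" by (rule ent_conjE1[OF U])
    show "\<Phi> \<tturnstile> (\<lambda>x. tall T (\<lambda>a. tall T (\<lambda>b. snd (y x) a \<^bold>\<and>\<^bsub>T\<^esub> Q a b \<^bold>\<longrightarrow>\<^bsub>T\<^esub> snd (y x) b)))"
      by (rule ent_conjE1[OF ent_conjE2[OF U]])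
    show "\<Phi> \<tturnstile> (\<lambda>x. dedekind_cut T Q (y x))" by (rule ent_conjE2[OF all])
  qed
  have L: "\<Phi> \<tturnstile> (\<lambda>x. tall T (\<lambda>a. fst (y x) a \<^bold>\<longleftrightarrow>\<^bsub>T\<^esub> Q a a \<^bold>\<and>\<^bsub>T\<^esub> tv (a < 0)))"
    unfolding tiff_def
  proof (intro ent_allI ent_conjI ent_impI)
    let ?\<Phi> = "\<lambda>z. \<Phi> (fst z) \<otimes> fst (y (fst z)) (snd z)"
    show "?\<Phi> \<tturnstile> (\<lambda>z. Q (snd z) (snd z))"
      by (rule ent_impE[OF ent_allE[OF ent_weak1[OF ent_subst[OF strictL]]] ent_snd])
    show "?\<Phi> \<tturnstile> (\<lambda>z. tv (snd z < 0))"
    proof (rule ent_const[of _ 0])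
      fix z assume "?\<Phi> z \<noteq> {}"
      then have "\<Phi> (fst z) \<noteq> {}" "fst (y (fst z)) (snd z) \<noteq> {}" by (auto simp: tensor_def)
      then show "0 \<in> tv (snd z < 0)" using assms(2)[of "fst z"] by (simp add: cut_value_def tv_def)
    qed
    let ?\<Psi> = "\<lambda>z. \<Phi> (fst z) \<otimes> (Q (snd z) (snd z) \<^bold>\<and>\<^bsub>T\<^esub> tv (snd z < 0))"
    have neg: "snd z < 0 \<and> \<Phi> (fst z) \<noteq> {}" if "?\<Psi> z \<noteq> {}" for z
      using that by (auto simp: tensor_def tconj_eq tv_def split: if_splits)
    have "?\<Psi> \<tturnstile> (\<lambda>z. fst (y (fst z)) (snd z) \<oplus> snd (y (fst z)) 0)"
    proof (rule ent_located_at)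
      show "?\<Psi> \<tturnstile> (\<lambda>z. located (y (fst z)))" by (intro ent_weak1 ent_subst[OF loc])
      show "?\<Psi> \<tturnstile> (\<lambda>z. Q (snd z) (snd z))" by (intro ent_weak2 conj_ent1)
    qed (use neg Q0 in auto)
    then obtain F where F: "pcomp F" "\<And>z p \<alpha>. p \<in> ?\<Psi> z \<Longrightarrow> \<alpha> \<in> M \<Longrightarrow>
      \<exists>c\<in>fst (y (fst z)) (snd z) \<oplus> snd (y (fst z)) 0. F \<alpha> p = Some c" by (elim entD) blast
    have "?\<Psi> \<tturnstile> (\<lambda>z. fst (y (fst z)) (snd z) \<oplus> {})"
    proof (rule entI[OF F(1)])
      fix z p \<alpha> assume p: "p \<in> ?\<Psi> z" and "\<alpha> \<in> M"
      from F(2)[OF this] assms(2)[of "fst z"] neg[of z] p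
      show "\<exists>c\<in>fst (y (fst z)) (snd z) \<oplus> {}. F \<alpha> p = Some c"
        by (fastforce simp: cut_value_def)
    qed
    then show "?\<Psi> \<tturnstile> (\<lambda>z. fst (y (fst z)) (snd z))" using tagged1 by (rule ent_trans)
  qed
  have U: "\<Phi> \<tturnstile> (\<lambda>x. tall T (\<lambda>a. snd (y x) a \<^bold>\<longleftrightarrow>\<^bsub>T\<^esub> Q a a \<^bold>\<and>\<^bsub>T\<^esub> tv (0 < a)))"
    unfolding tiff_def
  proof (intro ent_allI ent_conjI ent_impI)
    let ?\<Phi> = "\<lambda>z. \<Phi> (fst z) \<otimes> snd (y (fst z)) (snd z)"
    show "?\<Phi> \<tturnstile> (\<lambda>z. Q (snd z) (snd z))"
      by (rule ent_impE[OF ent_allE[OF ent_weak1[OF ent_subst[OF strictU]]] ent_snd])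
    show "?\<Phi> \<tturnstile> (\<lambda>z. tv (0 < snd z))"
    proof (rule ent_const[of _ 0])
      fix z assume "?\<Phi> z \<noteq> {}"
      then have "\<Phi> (fst z) \<noteq> {}" "snd (y (fst z)) (snd z) \<noteq> {}" by (auto simp: tensor_def)
      then show "0 \<in> tv (0 < snd z)" using assms(2)[of "fst z"] by (simp add: cut_value_def tv_def)
    qed
    let ?\<Psi> = "\<lambda>z. \<Phi> (fst z) \<otimes> (Q (snd z) (snd z) \<^bold>\<and>\<^bsub>T\<^esub> tv (0 < snd z))"
    have pos: "0 < snd z \<and> \<Phi> (fst z) \<noteq> {}" if "?\<Psi> z \<noteq> {}" for z
      using that by (auto simp: tensor_def tconj_eq tv_def split: if_splits)
    have "?\<Psi> \<tturnstile> (\<lambda>z. fst (y (fst z)) 0 \<oplus> snd (y (fst z)) (snd z))"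
    proof (rule ent_located_at)
      show "?\<Psi> \<tturnstile> (\<lambda>z. located (y (fst z)))" by (intro ent_weak1 ent_subst[OF loc])
      show "?\<Psi> \<tturnstile> (\<lambda>z. Q (snd z) (snd z))" by (intro ent_weak2 conj_ent1)
    qed (use pos Q0 in auto)
    then obtain F where F: "pcomp F" "\<And>z p \<alpha>. p \<in> ?\<Psi> z \<Longrightarrow> \<alpha> \<in> M \<Longrightarrow>
      \<exists>c\<in>fst (y (fst z)) 0 \<oplus> snd (y (fst z)) (snd z). F \<alpha> p = Some c" by (elim entD) blast
    have "?\<Psi> \<tturnstile> (\<lambda>z. {} \<oplus> snd (y (fst z)) (snd z))"
    proof (rule entI[OF F(1)])
      fix z p \<alpha> assume p: "p \<in> ?\<Psi> z" and "\<alpha> \<in> M"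
      from F(2)[OF this] assms(2)[of "fst z"] pos[of z] p
      show "\<exists>c\<in>{} \<oplus> snd (y (fst z)) (snd z). F \<alpha> p = Some c"
        by (fastforce simp: cut_value_def)
    qed
    then show "?\<Psi> \<tturnstile> (\<lambda>z. snd (y (fst z)) (snd z))" using tagged2 by (rule ent_trans)
  qed
  show ?thesis unfolding R_eq pow_obj_def
    by (intro ent_conjI strictL extL strictU extU cut) (use L U in \<open>simp_all add: rat_cut_def\<close>)
qed

end

section \<open>The intermediate value theorem\<close>

text \<open>If v > 0, then x - clip (-1) 1 v < x, so the equation can only hold through truncation
  at 0, which gives x = 0 and v < 0. If v < 0, it gives x = 1 and v > 0 in the same way.\<close>

lemma clip_fixed_point:
  assumes "x = clip 0 1 (x - clip (-1) 1 v)" "x = 0 \<Longrightarrow> v < 0" "x = 1 \<Longrightarrow> 0 < v"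
  shows "v = 0"
  using assms by (auto simp: clip_def max_def min_def split: if_splits)

context miller
begin

lemma functional_single_valued:
  assumes "functional T I R f \<noteq> {}" "I x x \<noteq> {}" "R y y \<noteq> {}" "R y' y' \<noteq> {}"
    "f (x, y) \<noteq> {}" "f (x, y') \<noteq> {}"
  shows "R y y' \<noteq> {}"
proof -
  have "all_in T I (\<lambda>x. all_in T R (\<lambda>y. all_in T R (\<lambda>y'. f (x, y) \<^bold>\<and>\<^bsub>T\<^esub> f (x, y') \<^bold>\<longrightarrow>\<^bsub>T\<^esub> R y y'))) \<noteq> {}"
    using assms(1) unfolding functional_def tconj_nonempty by blast
  from all_in_nonempty[OF this assms(2)]
  have "all_in T R (\<lambda>y. all_in T R (\<lambda>y'. f (x, y) \<^bold>\<and>\<^bsub>T\<^esub> f (x, y') \<^bold>\<longrightarrow>\<^bsub>T\<^esub> R y y')) \<noteq> {}" .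
  from all_in_nonempty[OF this assms(3)]
  have "all_in T R (\<lambda>y'. f (x, y) \<^bold>\<and>\<^bsub>T\<^esub> f (x, y') \<^bold>\<longrightarrow>\<^bsub>T\<^esub> R y y') \<noteq> {}" .
  from all_in_nonempty[OF this assms(4)]
  have "f (x, y) \<^bold>\<and>\<^bsub>T\<^esub> f (x, y') \<^bold>\<longrightarrow>\<^bsub>T\<^esub> R y y' \<noteq> {}" .
  from timp_nonempty[OF this] show ?thesis using assms(5,6) by (simp add: tconj_nonempty)
qed

lemma interval_nonempty: "I (real_cut (\<mu> n)) (real_cut (\<mu> n)) \<noteq> {}"
  using ent_real_interval nonempty unfolding entails_def by fastforce

text \<open>A classical choice outside the topos. No program computes this real; it only indexes the
  predicates to be realized.\<close>

definition fun_value :: "(nat cut \<times> nat cut \<Rightarrow> nat set) \<Rightarrow> nat \<Rightarrow> real" where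
  "fun_value f n = (SOME v. \<exists>y. R y y \<noteq> {} \<and> f (real_cut (\<mu> n), y) \<noteq> {} \<and> cut_value y v)"

text \<open>Single-valuedness makes any two values of f at the same point equal in R, and equal
  elements of R have the same classical real.\<close>

lemma fun_value:
  assumes "functional T I R f \<noteq> {}" "R y y \<noteq> {}" "f (real_cut (\<mu> n), y) \<noteq> {}"
  shows "cut_value y (fun_value f n)"
proof -
  let ?P = "\<lambda>v. \<exists>y. R y y \<noteq> {} \<and> f (real_cut (\<mu> n), y) \<noteq> {} \<and> cut_value y v"
  obtain v where "cut_value y v" using R_value[OF assms(2)] by blast
  with assms have "?P v" by blast
  then have "?P (fun_value f n)" unfolding fun_value_def by (rule someI)
  then obtain y' where "R y' y' \<noteq> {}" "f (real_cut (\<mu> n), y') \<noteq> {}" "cut_value y' (fun_value f n)" by blast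
  with functional_single_valued[OF assms(1) interval_nonempty _ assms(2) _ assms(3), of y'] R_same_value
  show ?thesis by blast
qed

abbreviation fun_obj where "fun_obj \<equiv> exp_obj T I R"

definition sign_change :: "(nat cut \<times> nat cut \<Rightarrow> nat set) \<Rightarrow> nat set" where
  "sign_change f =
    (value_in T R f (rat_cut T Q 0) (\<lambda>y. cut_less T Q y (rat_cut T Q 0)) \<^bold>\<and>\<^bsub>T\<^esub>
     value_in T R f (rat_cut T Q 1) (\<lambda>y. cut_less T Q (rat_cut T Q 0) y))"

lemma cut_less_value:
  assumes "cut_less T Q x y \<noteq> {}" "cut_value x v" "cut_value y w"
  shows "v < w"
  using assms unfolding cut_less_def cut_value_def ex_in_nonempty tconj_nonempty by force

text \<open>If \<mu> n is 0 or 1, then \<open>real_cut (\<mu> n)\<close> is literally the rational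
  cut, so the corresponding sign condition is one on \<open>fun_value f n\<close>.\<close>

lemma fun_value_zero:
  assumes "functional T I R f \<noteq> {}" "sign_change f \<noteq> {}"
    and "\<mu> n = clip 0 1 (\<mu> n - clip (-1) 1 (fun_value f n))"
  shows "fun_value f n = 0"
proof (rule clip_fixed_point[OF assms(3)])
  have "value_in T R f (rat_cut T Q 0) (\<lambda>y. cut_less T Q y (rat_cut T Q 0)) \<noteq> {}"
    and "value_in T R f (rat_cut T Q 1) (\<lambda>y. cut_less T Q (rat_cut T Q 0) y) \<noteq> {}"
    using assms(2) unfolding sign_change_def tconj_nonempty by blast+
  then obtain y z where y: "R y y \<noteq> {}" "f (rat_cut T Q 0, y) \<noteq> {}" "cut_less T Q y (rat_cut T Q 0) \<noteq> {}"
    and z: "R z z \<noteq> {}" "f (rat_cut T Q 1, z) \<noteq> {}" "cut_less T Q (rat_cut T Q 0) z \<noteq> {}"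
    unfolding value_in_def ex_in_nonempty tconj_nonempty by blast
  have zero: "cut_value (rat_cut T Q 0) 0" using cut_value_real_cut[of 0] by (simp add: rat_cut_eq)
  show "fun_value f n < 0" if "\<mu> n = 0"
    using fun_value[OF assms(1) y(1), of n] y(2) that
    by (intro cut_less_value[OF y(3) _ zero]) (simp add: rat_cut_eq)
  show "0 < fun_value f n" if "\<mu> n = 1"
    using fun_value[OF assms(1) z(1), of n] z(2) that
    by (intro cut_less_value[OF z(3) zero]) (simp add: rat_cut_eq)
qed

lemma fun_obj_functional: "fun_obj f f \<noteq> {} \<Longrightarrow> functional T I R f \<noteq> {}"
  unfolding exp_obj_def sub_obj_def tconj_nonempty by blast

lemma ent_fun_value:
  "(\<lambda>z. fun_obj (fst z) (fst z) \<otimes> {snd z}) \<tturnstile> (\<lambda>z. ex_in T R (\<lambda>y. fst z (real_cut (\<mu> (snd z)), y)))"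
proof -
  have "(\<lambda>f. fun_obj f f) \<tturnstile> (\<lambda>f. all_in T I (\<lambda>x. ex_in T R (\<lambda>y. f (x, y))))"
    unfolding exp_obj_def sub_obj_def functional_def
    by (rule ent_conjE2[OF ent_conjE2[OF ent_refl]])
  from ent_weak1[OF ent_subst[OF this, of fst]]
  have "(\<lambda>z. fun_obj (fst z) (fst z) \<otimes> {snd z}) \<tturnstile> (\<lambda>z. all_in T I (\<lambda>x. ex_in T R (\<lambda>y. fst z (x, y))))" .
  then show ?thesis
    by (rule ent_all_inE) (intro ent_weak2 ent_subst[OF ent_real_interval])
qed

text \<open>Every function has such a fixed point; the sign change is what later turns it into a
  zero.\<close>

lemma ent_root:
  "(\<lambda>f. fun_obj f f) \<tturnstile> (\<lambda>f. {n. \<mu> n = clip 0 1 (\<mu> n - clip (-1) 1 (fun_value f n))})"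
proof (rule ent_fixed_point)
  have "(\<lambda>z. fun_obj (fst z) (fst z) \<otimes> {snd z}) \<tturnstile> (\<lambda>z. decides (fun_value (fst z) (snd z)))"
  proof (rule ent_ex_inE[OF ent_fun_value])
    let ?\<Phi> = "\<lambda>w. (fun_obj (fst (fst w)) (fst (fst w)) \<otimes> {snd (fst w)}) \<otimes> R (snd w) (snd w) \<otimes>
        fst (fst w) (real_cut (\<mu> (snd (fst w))), snd w)"
    show "?\<Phi> \<tturnstile> (\<lambda>w. decides (fun_value (fst (fst w)) (snd (fst w))))"
    proof (rule ent_decides)
      show "?\<Phi> \<tturnstile> (\<lambda>w. located (snd w))" by (intro ent_weak2[OF ent_weak1] ent_located)
      fix w :: "((nat cut \<times> nat cut \<Rightarrow> nat set) \<times> nat) \<times> nat cut"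
      assume "?\<Phi> w \<noteq> {}"
      then have "fun_obj (fst (fst w)) (fst (fst w)) \<noteq> {}" "R (snd w) (snd w) \<noteq> {}"
        "fst (fst w) (real_cut (\<mu> (snd (fst w))), snd w) \<noteq> {}" by (auto simp: tensor_def)
      then show "cut_value (snd w) (fun_value (fst (fst w)) (snd (fst w)))"
        by (intro fun_value fun_obj_functional)
    qed
  qed
  with ent_snd have "(\<lambda>z. fun_obj (fst z) (fst z) \<otimes> {snd z}) \<tturnstile>
      (\<lambda>z. {snd z} \<otimes> decides (fun_value (fst z) (snd z)))" by (rule ent_tensor)
  also have "\<dots> \<tturnstile> (\<lambda>z. reps (clip 0 1 (\<mu> (snd z) - clip (-1) 1 (fun_value (fst z) (snd z)))))"
    using ent_subst[OF ent_reps, of "\<lambda>z. (snd z, fun_value (fst z) (snd z))"] by simp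
  finally show "(\<lambda>z. fun_obj (fst z) (fst z) \<otimes> {snd z}) \<tturnstile>
      (\<lambda>z. reps (clip 0 1 (\<mu> (snd z) - clip (-1) 1 (fun_value (fst z) (snd z)))))" .
  show "clip 0 1 x \<in> {0..1}" for x by (simp add: clip_def)
qed

text \<open>Placing the condition on the value inside the set of realizers keeps it as a classical
  fact of the context. It is \<open>ent_R_zero\<close> that turns it into a realized
  equality.\<close>

lemma ent_zero_value:
  "(\<lambda>z. fun_obj (fst z) (fst z) \<otimes> {n. n = snd z \<and> fun_value (fst z) n = 0}) \<tturnstile>
    (\<lambda>z. value_in T R (fst z) (real_cut (\<mu> (snd z))) (\<lambda>y. R y (rat_cut T Q 0)))"
  (is "?\<Phi> \<tturnstile> _")
proof (rule ent_ex_inE)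
  have "?\<Phi> \<tturnstile> (\<lambda>z. fun_obj (fst z) (fst z) \<otimes> {snd z})"
    by (rule ent_mono) (auto simp: tensor_def)
  then show "?\<Phi> \<tturnstile> (\<lambda>z. ex_in T R (\<lambda>y. fst z (real_cut (\<mu> (snd z)), y)))"
    using ent_fun_value by (rule ent_trans)
  let ?\<Psi> = "\<lambda>w. ?\<Phi> (fst w) \<otimes> R (snd w) (snd w) \<otimes> fst (fst w) (real_cut (\<mu> (snd (fst w))), snd w)"
  have real: "?\<Psi> \<tturnstile> (\<lambda>w. R (snd w) (snd w))" by (intro ent_weak2[OF ent_fst])
  have graph: "?\<Psi> \<tturnstile> (\<lambda>w. fst (fst w) (real_cut (\<mu> (snd (fst w))), snd w))" by (intro ent_weak2[OF ent_snd])
  have zero: "?\<Psi> \<tturnstile> (\<lambda>w. R (snd w) (rat_cut T Q 0))"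
  proof (rule ent_R_zero[OF real])
    fix w assume "?\<Psi> w \<noteq> {}"
    then have "fun_obj (fst (fst w)) (fst (fst w)) \<noteq> {}" "R (snd w) (snd w) \<noteq> {}"
      "fst (fst w) (real_cut (\<mu> (snd (fst w))), snd w) \<noteq> {}" "fun_value (fst (fst w)) (snd (fst w)) = 0"
      by (auto simp: tensor_def)
    then show "cut_value (snd w) 0" using fun_value[OF fun_obj_functional] by metis
  qed
  show "?\<Psi> \<tturnstile> (\<lambda>w. value_in T R (fst (fst w)) (real_cut (\<mu> (snd (fst w)))) (\<lambda>y. R y (rat_cut T Q 0)))"
    unfolding value_in_def by (rule ent_ex_inI'[of _ _ snd]) (intro real ent_conjI graph zero)+
qed

lemma ent_intermediate_value:
  "(\<lambda>f. fun_obj f f \<otimes> sign_change f) \<tturnstile>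
    (\<lambda>f. ex_in T I (\<lambda>x. value_in T R f x (\<lambda>y. R y (rat_cut T Q 0))))"
proof -
  let ?Z = "\<lambda>f n. {m. m = n \<and> fun_value f m = 0}"
  have "(\<lambda>f. fun_obj f f \<otimes> sign_change f) \<tturnstile>
      (\<lambda>f. (fun_obj f f \<otimes> sign_change f) \<otimes> {n. \<mu> n = clip 0 1 (\<mu> n - clip (-1) 1 (fun_value f n))})"
    by (intro ent_tensor ent_refl ent_weak1 ent_root)
  \<comment> \<open>Here the sign change acts classically: once it is realized, every fixed point is
    a zero, and the number n stays the same.\<close>
  also have "\<dots> \<tturnstile> (\<lambda>f. (fun_obj f f \<otimes> sign_change f) \<otimes> {n. fun_value f n = 0})"
    by (rule ent_mono) (use fun_value_zero fun_obj_functional in \<open>fastforce simp: tensor_def\<close>)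
  also have "\<dots> \<tturnstile> (\<lambda>f. fun_obj f f \<otimes> {n. fun_value f n = 0})"
    by (intro ent_tensor ent_weak1[OF ent_fst] ent_snd)
  \<comment> \<open>The realizer n is promoted to an index of the union, so that
    \<open>real_cut (\<mu> n)\<close> can be named as the witness.\<close>
  also have "\<dots> \<tturnstile> (\<lambda>f. \<Union>n. fun_obj f f \<otimes> ?Z f n)"
    by (rule ent_mono) (auto simp: tensor_def)
  also have "\<dots> \<tturnstile> (\<lambda>f. \<Union>n. I (real_cut (\<mu> n)) (real_cut (\<mu> n)) \<otimes>
      value_in T R f (real_cut (\<mu> n)) (\<lambda>y. R y (rat_cut T Q 0)))"
  proof (rule ent_Union_mono, rule ent_tensor[OF ent_weak2 ent_zero_value])
    have "(\<lambda>z. ?Z (fst z) (snd z)) \<tturnstile> (\<lambda>z. {snd z})" by (rule ent_mono) auto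
    then show "(\<lambda>z. ?Z (fst z) (snd z)) \<tturnstile> (\<lambda>z. I (real_cut (\<mu> (snd z))) (real_cut (\<mu> (snd z))))"
      using ent_subst[OF ent_real_interval] by (rule ent_trans)
  qed
  also have "\<dots> \<tturnstile> (\<lambda>f. \<Union>x. I x x \<otimes> value_in T R f x (\<lambda>y. R y (rat_cut T Q 0)))"
    by (rule ent_mono) blast
  finally show ?thesis by (rule ent_ex_inI)
qed

end

theorem theorem7p4:
  fixes q :: "nat \<Rightarrow> rat" and \<mu> :: "nat \<Rightarrow> real"
  assumes "computable_rat_bijection q" and "miller_sequence q \<mu>"
  shows "let T = miller_ppca \<mu>; Q = rat_obj q;
             R = dedekind_obj T Q; I = unit_interval_obj T Q;
             zero = rat_cut T Q 0; one = rat_cut T Q 1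
         in valid T (all_in T (exp_obj T I R) (\<lambda>f.
              value_in T R f zero (\<lambda>y. cut_less T Q y zero) \<^bold>\<and>\<^bsub>T\<^esub>
              value_in T R f one (\<lambda>y. cut_less T Q zero y)
              \<^bold>\<longrightarrow>\<^bsub>T\<^esub> ex_in T I (\<lambda>x. value_in T R f x (\<lambda>y. R y zero))))"
proof (cases "{\<alpha>. bin_seq \<alpha> = \<mu>} = {}")
  case True
  then have "valid (miller_ppca \<mu>) \<phi>" for \<phi>
    by (simp add: valid_def entails_def miller_ppca_def)
  then show ?thesis by (simp add: Let_def)
next
  case False
  interpret miller q \<mu> by standard (fact assms False)+
  have T: "miller_ppca \<mu> = T" by (simp add: miller_ppca_def oracle_ppca_def)
  have "entails T (\<lambda>_ :: unit. UNIV) (\<lambda>_. all_in T fun_obj (\<lambda>f. sign_change f \<^bold>\<longrightarrow>\<^bsub>T\<^esub>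
      ex_in T I (\<lambda>x. value_in T R f x (\<lambda>y. R y (rat_cut T Q 0)))))"
  proof (intro ent_all_inI ent_impI)
    let ?\<Phi> = "\<lambda>z. (UNIV \<otimes> fun_obj (snd z) (snd z)) \<otimes> sign_change (snd z)"
    have "entails T ?\<Phi> (\<lambda>z. fun_obj (snd z) (snd z) \<otimes> sign_change (snd z))"
      by (intro ent_tensor ent_weak1[OF ent_snd] ent_snd)
    then show "entails T ?\<Phi> (\<lambda>z. ex_in T I (\<lambda>x. value_in T R (snd z) x (\<lambda>y. R y (rat_cut T Q 0))))"
      using ent_subst[OF ent_intermediate_value] by (rule ent_trans)
  qed
  then show ?thesis unfolding Let_def valid_def T sign_change_def .
qed

end
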